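(* Let $f,g:\mathbb{R}^n\to[0,\infty)$ be integrable $\log$-concave functions with $\int_{\mathbb{R}^n} f>0$ and $\int_{\mathbb{R}^n} g>0$, let $0<\lambda<1$, and let $N,M>n+1$ be integers. Let $f^*,g^*$ be the symmetric decreasing rearrangements of $f,g$, and let $[f]_N,[g]_M,[f^*]_N,[g^*]_M$ be the random $\log$-concave functions built from independent uniform samples under the graphs of $f,g,f^*,g^*$, respectively (as defined in the context), all samples being independent. Then for any $\alpha>0$, $$\mathbb{P}\left(\int_{\mathbb{R}^n}([f]_N\star_{\lambda}[g]_M)(v)\,dv>\alpha\right)\ \geq\ \mathbb{P}\left(\int_{\mathbb{R}^n}([f^*]_N\star_{\lambda}[g^*]_M)(v)\,dv>\alpha\right).$$
   Context: Log-concavity: a function $f:\mathbb{R}^n\to[0,\infty)$ is $\log$-concave if its support $\{f>0\}$ is convex and $\log f$ is concave on its support. Sup-convolution: for $f,g:\mathbb{R}^n\to[0,\infty)$ and $0<\lambda<1$, $$(f\star_\lambda g)(v)=\sup\{f(x)^{\lambda}g(y)^{1-\lambda}: x,y\in\mathbb{R}^n,\ v=\lambda x+(1-\lambda)y\}.$$ Symmetric decreasing rearrangement: for a Borel set $A\subseteq\mathbb{R}^n$ of finite Lebesgue measure, $A^*$ is the open Euclidean ball centered at the origin with the same Lebesgue measure as $A$. For $f:\mathbb{R}^n\to[0,\infty)$ such that $\{f>t\}$ has finite measure for every $t>0$ (in particular for $f$ integrable), $f^*(x)=\int_0^\infty \mathbf{1}_{\{f>t\}^*}(x)\,dt$. If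 $f$ is $\log$-concave then so is $f^*$. Stochastic approximation: for an integrable $\log$-concave $f:\mathbb{R}^n\to[0,\infty)$ with positive integral, let $G_f=\{(x,z)\in\mathbb{R}^n\times[0,\infty): x\in\operatorname{supp} f,\ z\le f(x)\}$. Sample independent random vectors $(X_1,Z_1),\dots,(X_N,Z_N)$ according to the uniform (normalized Lebesgue) probability measure on $G_f$. Set $H_{f,N}=\operatorname{conv}\{(X_1,\log Z_1),\dots,(X_N,\log Z_N)\}\subseteq\mathbb{R}^n\times\mathbb{R}$ (almost surely all $Z_i>0$) and define $$[f]_N(x)=\exp\left(\sup\{z:(x,z)\in H_{f,N}\}\right),$$ with the convention that $[f]_N(x)=0$ for $x\notin\operatorname{conv}\{X_1,\dots,X_N\}$. Equivalently, $[f]_N$ is the least $\log$-concave function supported on $\operatorname{conv}\{X_1,\dots,X_N\}$ with $[f]_N(X_i)\ge Z_i$ for all $i$. The functions $[g]_M$, $[f^*]_N$, $[g^*]_M$ are defined in the same way from samples under the graphs of $g,f^*,g^*$. *)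

theory Defs
  imports "HOL-Probability.Probability"
begin

definition log_concave :: "('a::real_vector \<Rightarrow> real) \<Rightarrow> bool" where
  "log_concave f \<longleftrightarrow> (\<forall>x. 0 \<le> f x) \<and> convex {x. 0 < f x} \<and>
     concave_on {x. 0 < f x} (\<lambda>x. ln (f x))"

(* The supremum is taken in ennreal, so that it is meaningful without a boundedness
   assumption; note that 0 powr a = 0. *)
definition sup_conv ::
    "real \<Rightarrow> ('a::real_vector \<Rightarrow> real) \<Rightarrow> ('a \<Rightarrow> real) \<Rightarrow> 'a \<Rightarrow> ennreal" where
  "sup_conv lam f g v =
     Sup {ennreal (f x powr lam * g y powr (1 - lam)) | x y.
            v = lam *\<^sub>R x + (1 - lam) *\<^sub>R y}"

(* Meaningful for Lebesgue measurable A of finite measure; a null set A gives the empty ball. *)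
definition ball_rearrangement :: "'a::euclidean_space set \<Rightarrow> 'a set" where
  "ball_rearrangement A =
     (THE B. (\<exists>r. B = ball 0 r) \<and> emeasure lebesgue B = emeasure lebesgue A)"

(* The layer t = 0 is left out because {f > 0} may have infinite measure. *)
definition sym_decr_rearrangement :: "('a::euclidean_space \<Rightarrow> real) \<Rightarrow> 'a \<Rightarrow> real" where
  "sym_decr_rearrangement f x =
     (LINT t:{0<..}|lborel. indicator (ball_rearrangement {y. f y > t}) x)"

definition under_graph :: "('a \<Rightarrow> real) \<Rightarrow> ('a \<times> real) set" where
  "under_graph f = {(x, z). 0 < f x \<and> 0 \<le> z \<and> z \<le> f x}"

(* The random vector V is Borel measurable and its law is normalized Lebesgue measure on A.
   A itself need only be Lebesgue measurable: log-concave functions, and hence the sets under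
   their graphs, need not be Borel. *)
definition uniformly_distributed ::
    "'w measure \<Rightarrow> ('w \<Rightarrow> 'b::euclidean_space) \<Rightarrow> 'b set \<Rightarrow> bool" where
  "uniformly_distributed P V A \<longleftrightarrow> V \<in> borel_measurable P \<and>
     (\<forall>B\<in>sets borel. emeasure P (V -` B \<inter> space P) =
        emeasure lebesgue (A \<inter> B) / emeasure lebesgue A)"

(* Sample i is p i = (X_i, Z_i), for i = 1, ..., N. *)
definition log_hull :: "nat \<Rightarrow> (nat \<Rightarrow> 'a::real_vector \<times> real) \<Rightarrow> ('a \<times> real) set" where
  "log_hull N p = convex hull ((\<lambda>i. (fst (p i), ln (snd (p i)))) ` {1..N})"

definition stoch_approx :: "nat \<Rightarrow> (nat \<Rightarrow> 'a::real_vector \<times> real) \<Rightarrow> 'a \<Rightarrow> real" where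
  "stoch_approx N p x =
     (if x \<in> convex hull ((\<lambda>i. fst (p i)) ` {1..N})
      then exp (Sup {z. (x, z) \<in> log_hull N p}) else 0)"

end

theory Submission
  imports Defs
begin

text \<open>
  Let \<open>I\<close> index all \<open>N + M\<close> sample points.  The integral of the sup-convolution is a function of the
  tuple \<open>p = (x\<^sub>k, z\<^sub>k)\<close> of sample points, and the event that it is at most \<open>\<alpha>\<close> is a set \<open>C\<close> of such tuples.
  The points are independent and uniform on the regions \<open>A\<^sub>k\<close> under the graphs of \<open>f\<close> and \<open>g\<close>, so the
  probability of \<open>C\<close> is the Lebesgue measure of \<open>C \<inter> \<Prod>\<^sub>k A\<^sub>k\<close>, divided by the product of the measures of the
  \<open>A\<^sub>k\<close>.  The horizontal slices of \<open>A\<^sub>k\<close> are superlevel sets, hence convex, and the region under the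
  symmetric decreasing rearrangement is the set \<open>A\<^sub>k\<^sup>*\<close> in which each slice is replaced by a centred ball of
  equal measure.  The theorem therefore says that the measure of \<open>C \<inter> \<Prod>\<^sub>k A\<^sub>k\<close> is at most that of
  \<open>C \<inter> \<Prod>\<^sub>k A\<^sub>k\<^sup>*\<close> (lemma \<open>emeasure_PiE_le_level_balls\<close>).

  What makes this true is the behaviour of \<open>C\<close> when every point moves parallel to one horizontal direction
  \<open>u\<close>.  The supremum in the sup-convolution runs over convex weights, so each superlevel set of the
  sup-convolution meets a line parallel to \<open>u\<close> in an interval, whose length is a supremum of affine
  functions of the displacements; hence the integral is convex along such a motion
  (\<open>weighted_sup_integral_shadow_midpoint\<close>).  It is also unchanged when all points are reflected in the
  hyperplane orthogonal to \<open>u\<close>.  So \<open>C\<close> contains the midpoint of \<open>p\<close> and the mirror image of \<open>q\<close> whenever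
  \<open>p\<close> and \<open>q\<close> belong to \<open>C\<close> and differ by a motion along \<open>u\<close>.

  This is the situation of Anderson's theorem.  On a tuple of lines parallel to \<open>u\<close> the sets \<open>A\<^sub>k\<close> cut
  out a box of displacements, and \<open>C\<close> cuts out a set \<open>K\<close>.  The midpoints of \<open>K \<inter> box\<close> and of its mirror image
  lie in \<open>K\<close> and in the centred box, so the Prekopa-Leindler inequality shows that \<open>K\<close> has more measure
  in the centred box.  Integrating over all tuples of lines, the simultaneous Steiner symmetrization of
  all \<open>A\<^sub>k\<close> along \<open>u\<close> does not decrease the measure of \<open>C \<inter> \<Prod>\<^sub>k A\<^sub>k\<close> (\<open>emeasure_steiner_mono\<close>).

  Steiner symmetrizations come arbitrarily close to the sets \<open>A\<^sub>k\<^sup>*\<close>.  Suppose that \<open>B - A\<^sub>k\<^sup>*\<close> has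
  measure at least \<open>\<delta>\<close> for the current set \<open>B\<close>.  Averaging over all horizontal shifts \<open>w\<close> the measure of the
  points of \<open>B - A\<^sub>k\<^sup>*\<close> that \<open>w\<close> carries into \<open>A\<^sub>k\<^sup>* - B\<close> yields one shift for which this measure exceeds
  a constant depending only on \<open>\<delta>\<close> and on a bound for the sets (\<open>exists_shift_with_gain\<close>).  Symmetrizing along that \<open>w\<close> increases
  the measure of \<open>B \<inter> A\<^sub>k\<^sup>*\<close> by at least this constant (\<open>steiner_gain\<close>), which cannot happen infinitely often.
  This settles the case of bounded sets, and the general case follows by exhaustion.
\<close>

abbreviation vol :: "'a::euclidean_space set \<Rightarrow> ennreal" where
  "vol \<equiv> emeasure lborel"

abbreviation lborels :: "'i set \<Rightarrow> ('i \<Rightarrow> 'a::euclidean_space) measure" where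
  "lborels I \<equiv> PiM I (\<lambda>_. lborel)"

abbreviation slice :: "real \<Rightarrow> ('a \<times> real) set \<Rightarrow> 'a set" where
  "slice z A \<equiv> {x. (x, z) \<in> A}"

section \<open>The midpoint Prekopa-Leindler inequality\<close>

text \<open>
  If \<open>A\<close> has a maximum, one of the segments is \<open>A\<close> itself.  Otherwise \<open>A\<close> is the union of an increasing
  sequence of sets \<open>A \<inter> {..q}\<close> with \<open>q\<close> below some point of \<open>A\<close>.
\<close>

lemma emeasure_le_if_initial_segments_le:
  fixes A :: "real set"
  assumes [measurable]: "A \<in> sets borel"
    and le: "\<And>a. a \<in> A \<Longrightarrow> vol (A \<inter> {..a}) \<le> X"
  shows "vol A \<le> X"
proof -
  have seg: "vol (A \<inter> {..q}) \<le> X" if "a \<in> A" "q \<le> a" for q a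
    using order_trans[OF emeasure_mono le[OF that(1)]] that(2) by (auto simp: subset_iff)
  have lim: "vol A \<le> X" if "\<And>n::nat. vol (A \<inter> {..q n}) \<le> X"
    "incseq q" "A \<subseteq> (\<Union>n. {..q n})" for q :: "nat \<Rightarrow> real"
  proof -
    have "incseq (\<lambda>n. A \<inter> {..q n})"
      using that(2) by (force simp: incseq_def le_fun_def)
    then have "(SUP n. vol (A \<inter> {..q n})) = vol (\<Union>n. A \<inter> {..q n})"
      by (intro SUP_emeasure_incseq) auto
    also have "(\<Union>n. A \<inter> {..q n}) = A" using that(3) by blast
    finally show ?thesis using that(1) by (metis SUP_least)
  qed
  consider "A = {}" | "A \<noteq> {}" "bdd_above A" "Sup A \<in> A" | "A \<noteq> {}" "bdd_above A" "Sup A \<notin> A"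
    | "\<not> bdd_above A" by fast
  then show ?thesis
  proof cases
    case 2
    then have "A \<inter> {..Sup A} = A" by (auto intro: cSup_upper)
    with le[OF 2(3)] show ?thesis by simp
  next
    case 3
    have lt: "x < Sup A" if "x \<in> A" for x
      using that 3 cSup_upper[OF that 3(2)] by (cases "x = Sup A") auto
    show ?thesis
    proof (rule lim[of "\<lambda>n. Sup A - 1 / real (Suc n)"])
      show "vol (A \<inter> {..Sup A - 1 / real (Suc n)}) \<le> X" for n
        using less_cSup_iff[OF 3(1,2), of "Sup A - 1 / real (Suc n)"] by (auto intro!: seg)
      show "incseq (\<lambda>n. Sup A - 1 / real (Suc n))"
        by (intro incseq_SucI) (simp add: field_simps)
      show "A \<subseteq> (\<Union>n. {..Sup A - 1 / real (Suc n)})"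
      proof
        fix x assume "x \<in> A"
        then have "0 < Sup A - x" using lt by simp
        then obtain n where "inverse (real (Suc n)) < Sup A - x" using reals_Archimedean by blast
        then show "x \<in> (\<Union>n. {..Sup A - 1 / real (Suc n)})"
          by (auto simp: inverse_eq_divide intro!: exI[of _ n])
      qed
    qed
  next
    case 4
    show ?thesis
    proof (rule lim[of real])
      show "vol (A \<inter> {..real n}) \<le> X" for n
      proof -
        from 4 obtain a where "a \<in> A" "real n \<le> a"
          by (metis bdd_above.I linear)
        then show ?thesis by (rule seg)
      qed
      show "incseq real" by (simp add: incseq_def)
      show "A \<subseteq> (\<Union>n. {..real n})" using real_arch_simple by auto
    qed
  qed simp
qed

lemma emeasure_vimage_real_affine:
  fixes c :: real
  assumes [measurable]: "A \<in> sets borel" and c: "c \<noteq> 0"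
  shows "vol A = ennreal \<bar>c\<bar> * vol {x. t + c * x \<in> A}"
proof -
  have "vol A = (\<integral>\<^sup>+x. indicator A x \<partial>lborel)" by simp
  also have "\<dots> = ennreal \<bar>c\<bar> * (\<integral>\<^sup>+x. indicator A (t + c * x) \<partial>lborel)"
    by (rule nn_integral_real_affine) (use c in auto)
  also have "(\<integral>\<^sup>+x. indicator A (t + c * x) \<partial>lborel) = (\<integral>\<^sup>+x. indicator {x. t + c * x \<in> A} x \<partial>lborel)"
    by (intro nn_integral_cong) (auto simp: indicator_def)
  also have "\<dots> = vol {x. t + c * x \<in> A}" by (subst nn_integral_indicator) auto
  finally show ?thesis .
qed

text \<open>
  For \<open>a \<in> A\<close> and \<open>b \<in> B\<close> the translates \<open>b + (A \<inter> {..a})\<close> and \<open>a + (B \<inter> {b<..})\<close> lie on different sides of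
  \<open>a + b\<close>, and both are contained in \<open>2 Z\<close>.  Then let \<open>a\<close> run to the upper end of \<open>A\<close> and \<open>b\<close> to the lower
  end of \<open>B\<close>.
\<close>

lemma brunn_minkowski_real_midpoint:
  fixes A B Z :: "real set"
  assumes [measurable]: "A \<in> sets borel" "B \<in> sets borel" "Z \<in> sets borel"
    and ne: "A \<noteq> {}" "B \<noteq> {}"
    and mid: "\<And>a b. a \<in> A \<Longrightarrow> b \<in> B \<Longrightarrow> (a + b) / 2 \<in> Z"
  shows "vol A + vol B \<le> 2 * vol Z"
proof -
  have two: "2 * vol Z = vol {s. s / 2 \<in> Z}"
    using emeasure_vimage_real_affine[of "{s. s / 2 \<in> Z}" 2 0] by simp
  have key: "vol (A \<inter> {..a}) + vol (B \<inter> {b..}) \<le> 2 * vol Z"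
    if a: "a \<in> A" and b: "b \<in> B" for a b
  proof -
    \<comment> \<open>The half-open ray keeps the two translates disjoint at \<open>a + b\<close>.\<close>
    let ?A = "{s. s - b \<in> A \<inter> {..a}}" and ?B = "{s. s - a \<in> B \<inter> {b<..}}"
    have "vol (A \<inter> {..a}) = vol ?A"
      using emeasure_vimage_real_affine[of "A \<inter> {..a}" 1 "-b"] by simp
    moreover have "vol (B \<inter> {b<..}) = vol ?B"
      using emeasure_vimage_real_affine[of "B \<inter> {b<..}" 1 "-a"] by simp
    moreover have "vol (B \<inter> {b..}) = vol (B \<inter> {b<..})"
      using AE_lborel_singleton[of b] by (intro emeasure_eq_AE) auto
    moreover have "vol ?A + vol ?B = vol (?A \<union> ?B)"
      by (intro plus_emeasure) auto
    moreover have "?A \<union> ?B \<subseteq> {s. s / 2 \<in> Z}"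
      using mid[OF _ b] mid[OF a] by fastforce
    then have "vol (?A \<union> ?B) \<le> vol {s. s / 2 \<in> Z}"
      by (intro emeasure_mono) auto
    ultimately show ?thesis using two by simp
  qed
  have B1: "vol (A \<inter> {..a}) + vol B \<le> 2 * vol Z" if a: "a \<in> A" for a
  proof -
    let ?c = "vol (A \<inter> {..a})" and ?Y = "2 * vol Z"
    have B': "vol B = vol {s. - s \<in> B}"
      using emeasure_vimage_real_affine[of B "-1" 0] by simp
    show ?thesis
    proof (cases "?c = \<infinity>")
      case True
      obtain b where "b \<in> B" using ne by blast
      from key[OF a this] True show ?thesis by (simp add: top_unique)
    next
      case False
      have "vol {s. - s \<in> B} \<le> ?Y - ?c"
      proof (rule emeasure_le_if_initial_segments_le)
        fix s assume s: "s \<in> {s. - s \<in> B}"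
        have "vol (B \<inter> {-s..}) = vol ({s. - s \<in> B} \<inter> {..s})"
          using emeasure_vimage_real_affine[of "B \<inter> {-s..}" "-1" 0]
          by (simp add: Int_def)
        with key[OF a, of "-s"] s
        have "vol ({s. - s \<in> B} \<inter> {..s}) + ?c \<le> ?Y" by (simp add: add.commute)
        then show "vol ({s. - s \<in> B} \<inter> {..s}) \<le> ?Y - ?c"
          using False by (simp add: ennreal_le_minus_iff add.commute)
      qed auto
      moreover obtain b where "b \<in> B" using ne by blast
      have "?c \<le> ?Y" using key[OF a \<open>b \<in> B\<close>] by (meson le_iff_add order_trans)
      ultimately show ?thesis using B' False
        by (metis add.commute add_left_mono ennreal_minus_cancel_iff diff_add_cancel_ennreal)
    qed
  qed
  show ?thesis
  proof (cases "vol B = \<infinity>")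
    case True
    obtain a where "a \<in> A" using ne by blast
    from B1[OF this] True show ?thesis by (simp add: top_unique)
  next
    case False
    have "vol A \<le> 2 * vol Z - vol B"
      by (rule emeasure_le_if_initial_segments_le)
        (use B1 False in \<open>auto simp: ennreal_le_minus_iff add.commute\<close>)
    moreover obtain a where "a \<in> A" using ne by blast
    have "vol B \<le> 2 * vol Z"
      using B1[OF \<open>a \<in> A\<close>] by (metis add.commute le_iff_add order_trans)
    ultimately show ?thesis using False by (metis add.commute add_left_mono diff_add_cancel_ennreal)
  qed
qed

text \<open>
  The layer-cake formula with the levels rescaled to the unit interval, so that functions with different
  suprema can be compared level by level.
\<close>

lemma nn_integral_layer_cake_rescaled:
  fixes f :: "real \<Rightarrow> real"
  assumes [measurable]: "f \<in> borel_measurable borel" and f: "\<And>x. 0 \<le> f x" "\<And>x. f x \<le> F" and F: "0 < F"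
  shows "(\<integral>\<^sup>+x. f x \<partial>lborel) = ennreal F * (\<integral>\<^sup>+t. indicator {0<..<1} t * vol {x. F * t < f x} \<partial>lborel)"
proof -
  have "ennreal (f x) = ennreal F * (\<integral>\<^sup>+t. indicator {0<..<1} t * indicator {x. F * t < f x} x \<partial>lborel)" for x
  proof -
    have "(\<integral>\<^sup>+t. indicator {0<..<1} t * indicator {x. F * t < f x} x \<partial>lborel)
        = (\<integral>\<^sup>+t. indicator {0<..<f x / F} t \<partial>lborel)"
    proof (intro nn_integral_cong)
      fix t
      have "F * t < f x \<Longrightarrow> t < 1"
        using F f(2)[of x] mult_less_cancel_left_pos[of F t 1] by linarith
      then show "indicator {0<..<1} t * indicator {x. F * t < f x} x = (indicator {0<..<f x / F} t :: ennreal)"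
        using F by (simp add: indicator_def pos_less_divide_eq mult.commute)
    qed
    also have "\<dots> = ennreal (f x / F)"
      by (subst nn_integral_indicator) (use F f[of x] in auto)
    finally show ?thesis using F f(1)[of x] by (simp flip: ennreal_mult')
  qed
  then have "(\<integral>\<^sup>+x. f x \<partial>lborel) = (\<integral>\<^sup>+x. ennreal F * (\<integral>\<^sup>+t. indicator {0<..<1} t * indicator {x. F * t < f x} x \<partial>lborel) \<partial>lborel)"
    by simp
  also have "\<dots> = ennreal F * (\<integral>\<^sup>+x. (\<integral>\<^sup>+t. indicator {0<..<1} t * indicator {x. F * t < f x} x \<partial>lborel) \<partial>lborel)"
    by (intro nn_integral_cmult) auto
  also have "(\<integral>\<^sup>+x. (\<integral>\<^sup>+t. indicator {0<..<1} t * indicator {x. F * t < f x} x \<partial>lborel) \<partial>lborel)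
      = (\<integral>\<^sup>+t. (\<integral>\<^sup>+x. indicator {0<..<1} t * indicator {x. F * t < f x} x \<partial>lborel) \<partial>lborel)"
    by (rule lborel_pair.Fubini') auto
  also have "\<dots> = (\<integral>\<^sup>+t. indicator {0<..<1} t * vol {x. F * t < f x} \<partial>lborel)"
    by (intro nn_integral_cong, subst nn_integral_cmult) auto
  finally show ?thesis .
qed

lemma ennreal_four_mult_le_sum_squared: "4 * (a * b) \<le> (a + b)\<^sup>2" for a b :: ennreal
proof (cases "a = \<infinity> \<or> b = \<infinity>")
  case False
  then obtain x y where xy: "a = ennreal x" "b = ennreal y" "0 \<le> x" "0 \<le> y"
    by (cases a; cases b) auto
  have "4 * (x * y) \<le> (x + y)\<^sup>2" using zero_le_power2[of "x - y"] by (simp add: power2_eq_square algebra_simps)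
  then have "ennreal (4 * (x * y)) \<le> ennreal ((x + y)\<^sup>2)" by (rule ennreal_leI)
  then show ?thesis using xy by (simp add: ennreal_mult ennreal_plus ennreal_power[symmetric])
qed (auto simp: power2_eq_square)

text \<open>
  Once \<open>f\<close> and \<open>g\<close> are scaled to have supremum \<open>1\<close>, their superlevel sets at levels below \<open>1\<close> are nonempty
  and the Brunn-Minkowski inequality applies at each level.  This bounds the integral of \<open>h\<close> from below
  by the arithmetic mean of the two scaled integrals, hence by their geometric mean.
\<close>

lemma prekopa_leindler_real_bounded:
  fixes f g h :: "real \<Rightarrow> real"
  assumes [measurable]: "f \<in> borel_measurable borel" "g \<in> borel_measurable borel" "h \<in> borel_measurable borel"
    and f: "\<And>x. 0 \<le> f x" "\<And>x. f x \<le> K" and g: "\<And>x. 0 \<le> g x" "\<And>x. g x \<le> K" and h: "\<And>x. 0 \<le> h x"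
    and fgh: "\<And>x y. f x * g y \<le> (h ((x + y) / 2))\<^sup>2"
  shows "(\<integral>\<^sup>+x. f x \<partial>lborel) * (\<integral>\<^sup>+x. g x \<partial>lborel) \<le> (\<integral>\<^sup>+x. h x \<partial>lborel)\<^sup>2"
proof -
  define F G where "F = Sup (range f)" and "G = Sup (range g)"
  have bdd: "bdd_above (range f)" "bdd_above (range g)"
    using f g by (auto intro!: bdd_aboveI[of _ K])
  have fF: "f x \<le> F" and gG: "g x \<le> G" for x
    unfolding F_def G_def using bdd by (auto intro!: cSup_upper)
  show ?thesis
  proof (cases "F \<le> 0 \<or> G \<le> 0")
    case True
    then have "(\<forall>x. f x = 0) \<or> (\<forall>x. g x = 0)"
      using f(1) g(1) fF gG by (meson order.trans order_antisym)
    then show ?thesis by auto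
  next
    case False
    then have pos: "0 < F" "0 < G" by auto
    \<comment> \<open>Truncating \<open>h\<close> at the geometric mean of the suprema matches the levels \<open>F * t\<close>, \<open>G * t\<close> and \<open>c * t\<close>.\<close>
    define c where "c = sqrt (F * G)"
    have c: "0 < c" "c\<^sup>2 = F * G" using pos by (auto simp: c_def)
    define a where "a = (\<integral>\<^sup>+t. indicator {0<..<1} t * vol {x. F * t < f x} \<partial>lborel)"
    define b where "b = (\<integral>\<^sup>+t. indicator {0<..<1} t * vol {x. G * t < g x} \<partial>lborel)"
    define d where "d = (\<integral>\<^sup>+t. indicator {0<..<1} t * vol {x. c * t < min (h x) c} \<partial>lborel)"
    have If: "(\<integral>\<^sup>+x. f x \<partial>lborel) = F * a" and Ig: "(\<integral>\<^sup>+x. g x \<partial>lborel) = G * b"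
      unfolding a_def b_def using f g fF gG pos by (auto intro!: nn_integral_layer_cake_rescaled)
    have "(\<integral>\<^sup>+x. min (h x) c \<partial>lborel) = c * d"
      unfolding d_def using h c by (intro nn_integral_layer_cake_rescaled) auto
    moreover have "(\<integral>\<^sup>+x. min (h x) c \<partial>lborel) \<le> (\<integral>\<^sup>+x. h x \<partial>lborel)"
      by (intro nn_integral_mono ennreal_leI) simp
    ultimately have Ih: "c * d \<le> (\<integral>\<^sup>+x. h x \<partial>lborel)" by simp
    have "a + b = (\<integral>\<^sup>+t. indicator {0<..<1} t * vol {x. F * t < f x}
        + indicator {0<..<1} t * vol {x. G * t < g x} \<partial>lborel)"
      unfolding a_def b_def by (rule nn_integral_add[symmetric]) auto
    also have "\<dots> \<le> (\<integral>\<^sup>+t. 2 * (indicator {0<..<1} t * vol {x. c * t < min (h x) c}) \<partial>lborel)"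
    proof (intro nn_integral_mono)
      fix t :: real
      show "indicator {0<..<1} t * vol {x. F * t < f x} + indicator {0<..<1} t * vol {x. G * t < g x}
        \<le> 2 * (indicator {0<..<1} t * vol {x. c * t < min (h x) c})"
      proof (cases "t \<in> {0<..<1}")
        case True
        then have t: "0 < t" "F * t < F" "G * t < G" "c * t < c" using pos c by auto
        have "vol {x. F * t < f x} + vol {x. G * t < g x}
            \<le> 2 * vol {x. c * t < min (h x) c}"
        proof (rule brunn_minkowski_real_midpoint)
          show "{x. F * t < f x} \<noteq> {}"
            using less_cSup_iff[of "range f" "F * t"] bdd t(2) by (auto simp: F_def)
          show "{x. G * t < g x} \<noteq> {}"
            using less_cSup_iff[of "range g" "G * t"] bdd t(3) by (auto simp: G_def)
          fix x y assume "x \<in> {x. F * t < f x}" "y \<in> {x. G * t < g x}"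
          then have "(F * t) * (G * t) < f x * g y"
            using mult_pos_pos[OF pos(1) t(1)] mult_pos_pos[OF pos(2) t(1)]
            by (intro mult_strict_mono) auto
          also have "\<dots> \<le> (h ((x + y) / 2))\<^sup>2" by (rule fgh)
          also have "(F * t) * (G * t) = (c * t)\<^sup>2" using c by (simp add: power2_eq_square algebra_simps)
          finally show "(x + y) / 2 \<in> {x. c * t < min (h x) c}"
            using power_less_imp_less_base[OF _ h] t by auto
        qed auto
        then show ?thesis using True by simp
      qed simp
    qed
    also have "\<dots> = 2 * d" unfolding d_def by (rule nn_integral_cmult) auto
    finally have abd: "a + b \<le> 2 * d" .
    have "4 * ((F * a) * (G * b)) = ennreal (c\<^sup>2) * (4 * (a * b))"
      using pos unfolding c(2) by (simp add: ennreal_mult' algebra_simps)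
    also have "\<dots> \<le> ennreal (c\<^sup>2) * (2 * d)\<^sup>2"
      by (intro mult_left_mono order_trans[OF ennreal_four_mult_le_sum_squared] power_mono abd) auto
    also have "\<dots> = 4 * (c * d)\<^sup>2"
      using c(1) by (simp add: ennreal_power[symmetric] power_mult_distrib mult_ac)
    also have "\<dots> \<le> 4 * (\<integral>\<^sup>+x. h x \<partial>lborel)\<^sup>2" by (intro mult_left_mono power_mono Ih) auto
    finally show ?thesis unfolding If Ig
      by (subst (asm) ennreal_mult_le_mult_iff) auto
  qed
qed

lemma nn_integral_min_nat_SUP:
  fixes f :: "'a \<Rightarrow> ennreal"
  assumes [measurable]: "f \<in> borel_measurable M"
  shows "(\<integral>\<^sup>+x. f x \<partial>M) = (SUP n::nat. \<integral>\<^sup>+x. min (f x) (of_nat n) \<partial>M)"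
proof -
  have "f x = (SUP n::nat. min (f x) (of_nat n))" for x
  proof (rule antisym)
    show "f x \<le> (SUP n::nat. min (f x) (of_nat n))"
    proof (cases "f x = \<infinity>")
      case True
      then show ?thesis by (simp add: ennreal_SUP_of_nat_eq_top)
    next
      case False
      then obtain n :: nat where "f x \<le> of_nat n"
        using ennreal_Ex_less_of_nat[of "f x"] by (metis infinity_ennreal_def less_imp_le less_top)
      then show ?thesis by (intro SUP_upper2[of n]) auto
    qed
  qed (auto intro: SUP_least)
  then have "(\<integral>\<^sup>+x. f x \<partial>M) = (\<integral>\<^sup>+x. (SUP n::nat. min (f x) (of_nat n)) \<partial>M)" by simp
  also have "\<dots> = (SUP n::nat. \<integral>\<^sup>+x. min (f x) (of_nat n) \<partial>M)"
    by (rule nn_integral_monotone_convergence_SUP)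
      (auto simp: incseq_def le_fun_def intro: min.coboundedI2)
  finally show ?thesis .
qed

text \<open>
  Truncating \<open>f\<close>, \<open>g\<close> and \<open>h\<close> at integers preserves the hypothesis, provided that the level for \<open>h\<close> is the
  larger one of the levels for \<open>f\<close> and \<open>g\<close>.
\<close>

lemma prekopa_leindler_real:
  fixes f g h :: "real \<Rightarrow> ennreal"
  assumes [measurable]: "f \<in> borel_measurable borel" "g \<in> borel_measurable borel" "h \<in> borel_measurable borel"
    and fgh: "\<And>x y. f x * g y \<le> (h ((x + y) / 2))\<^sup>2"
  shows "(\<integral>\<^sup>+x. f x \<partial>lborel) * (\<integral>\<^sup>+x. g x \<partial>lborel) \<le> (\<integral>\<^sup>+x. h x \<partial>lborel)\<^sup>2"
proof -
  have trunc: "(\<integral>\<^sup>+x. min (f x) (of_nat n) \<partial>lborel) * (\<integral>\<^sup>+x. min (g x) (of_nat m) \<partial>lborel) \<le> (\<integral>\<^sup>+x. h x \<partial>lborel)\<^sup>2" for n m :: nat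
  proof -
    define k where "k = max n m"
    let ?f = "\<lambda>x. enn2real (min (f x) (of_nat n))" and ?g = "\<lambda>x. enn2real (min (g x) (of_nat m))"
      and ?h = "\<lambda>x. enn2real (min (h x) (of_nat k))"
    have fin: "min e (of_nat j) < (top::ennreal)" for e j by (simp add: min_less_iff_disj of_nat_less_top)
    have le: "enn2real (min e (of_nat j)) \<le> real k" if "j \<le> k" for e j
    proof -
      have "enn2real (min e (of_nat j)) \<le> enn2real (of_nat j)"
        by (intro enn2real_mono) (auto simp: of_nat_less_top)
      then show ?thesis using that by simp
    qed
    have "(\<integral>\<^sup>+x. ?f x \<partial>lborel) * (\<integral>\<^sup>+x. ?g x \<partial>lborel) \<le> (\<integral>\<^sup>+x. ?h x \<partial>lborel)\<^sup>2"
    proof (rule prekopa_leindler_real_bounded)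
      fix x y
      let ?u = "min (f x) (of_nat n)" and ?v = "min (g y) (of_nat m)" and ?w = "h ((x + y) / 2)"
      have "?u * ?v \<le> f x * g y" by (intro mult_mono) auto
      then have 1: "?u * ?v \<le> ?w\<^sup>2" using fgh[of x y] by simp
      have "?u * ?v \<le> of_nat k * of_nat k"
        by (intro mult_mono) (auto simp: k_def min.coboundedI2)
      with 1 have "?u * ?v \<le> (min ?w (of_nat k))\<^sup>2"
        by (auto simp: min_def power2_eq_square)
      then have "enn2real (?u * ?v) \<le> enn2real ((min ?w (of_nat k))\<^sup>2)"
        by (intro enn2real_mono) (use fin in \<open>auto simp: power2_eq_square ennreal_mult_less_top\<close>)
      then show "?f x * ?g y \<le> (?h ((x + y) / 2))\<^sup>2"
        by (simp add: enn2real_mult power2_eq_square)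
    qed (auto simp: k_def intro!: order_trans[OF le])
    also have "\<dots> \<le> (\<integral>\<^sup>+x. h x \<partial>lborel)\<^sup>2"
      using fin by (intro power_mono nn_integral_mono) auto
    finally show ?thesis using fin by simp
  qed
  have "(\<integral>\<^sup>+x. f x \<partial>lborel) * (\<integral>\<^sup>+x. min (g x) (of_nat m) \<partial>lborel) \<le> (\<integral>\<^sup>+x. h x \<partial>lborel)\<^sup>2" for m :: nat
    by (subst nn_integral_min_nat_SUP, measurable) (auto simp: SUP_mult_right_ennreal intro!: SUP_least trunc)
  then show ?thesis
    by (subst (2) nn_integral_min_nat_SUP, measurable) (auto simp: SUP_mult_left_ennreal intro!: SUP_least)
qed

text \<open>
  Induction on the number of coordinates: integrating out one coordinate with the one-dimensional
  inequality yields three functions that satisfy the same hypothesis.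
\<close>

lemma prekopa_leindler_PiM:
  fixes f g h :: "('i \<Rightarrow> real) \<Rightarrow> ennreal"
  assumes "finite I"
    and "f \<in> borel_measurable (lborels I)" "g \<in> borel_measurable (lborels I)"
      "h \<in> borel_measurable (lborels I)"
    and "\<And>x y. x \<in> space (lborels I) \<Longrightarrow> y \<in> space (lborels I) \<Longrightarrow>
      f x * g y \<le> (h (\<lambda>i\<in>I. (x i + y i) / 2))\<^sup>2"
  shows "(\<integral>\<^sup>+x. f x \<partial>lborels I) * (\<integral>\<^sup>+x. g x \<partial>lborels I)
    \<le> (\<integral>\<^sup>+x. h x \<partial>lborels I)\<^sup>2"
  using assms
proof (induction I arbitrary: f g h rule: finite_induct)
  case empty
  interpret product_sigma_finite "\<lambda>_. lborel :: real measure" by standard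
  show ?case using empty(4)[of "\<lambda>_. undefined" "\<lambda>_. undefined"]
    by (simp add: nn_integral_empty restrict_def)
next
  case (insert i I)
  interpret product_sigma_finite "\<lambda>_. lborel :: real measure" by standard
  note insert.prems(1-3)[measurable]
  have upd: "x(i := a) \<in> space (PiM (insert i I) (\<lambda>_. lborel))" if "x \<in> space (lborels I)" for x :: "'i \<Rightarrow> real" and a
    using that by (auto simp: space_PiM PiE_def extensional_def)
  have *: "(\<integral>\<^sup>+x. (\<integral>\<^sup>+a. f (x(i := a)) \<partial>lborel) \<partial>lborels I) * (\<integral>\<^sup>+x. (\<integral>\<^sup>+a. g (x(i := a)) \<partial>lborel) \<partial>lborels I)
    \<le> (\<integral>\<^sup>+x. (\<integral>\<^sup>+a. h (x(i := a)) \<partial>lborel) \<partial>lborels I)\<^sup>2"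
  proof (rule insert.IH)
    fix x y :: "'i \<Rightarrow> real" assume xy: "x \<in> space (lborels I)" "y \<in> space (lborels I)"
    let ?m = "\<lambda>i\<in>I. (x i + y i) / 2"
    have m: "?m \<in> space (lborels I)" by (auto simp: space_PiM)
    have meas: "(\<lambda>a. k (z(i := a))) \<in> borel_measurable borel"
      if z: "z \<in> space (lborels I)" and [measurable]: "k \<in> borel_measurable (PiM (insert i I) (\<lambda>_. lborel))"
      for z and k :: "('i \<Rightarrow> real) \<Rightarrow> ennreal"
    proof -
      have "(\<lambda>a. z(i := a)) \<in> measurable borel (PiM (insert i I) (\<lambda>_. lborel))"
        by (rule measurable_fun_upd[where J=I]) (use z in auto)
      then show ?thesis by (rule measurable_compose) fact
    qed
    show "(\<integral>\<^sup>+a. f (x(i := a)) \<partial>lborel) * (\<integral>\<^sup>+a. g (y(i := a)) \<partial>lborel) \<le> (\<integral>\<^sup>+a. h (?m(i := a)) \<partial>lborel)\<^sup>2"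
    proof (rule prekopa_leindler_real)
      fix a b
      have "(\<lambda>j\<in>insert i I. ((x(i := a)) j + (y(i := b)) j) / 2) = ?m(i := (a + b) / 2)"
        using insert.hyps by (auto simp: fun_eq_iff)
      then show "f (x(i := a)) * g (y(i := b)) \<le> (h (?m(i := (a + b) / 2)))\<^sup>2"
        using insert.prems(4)[OF upd[OF xy(1), of a] upd[OF xy(2), of b]] by (simp only:)
    qed (use meas xy m in auto)
  qed measurable
  show ?case
    using * insert.hyps insert.prems(1-3) by (simp add: product_nn_integral_insert)
qed

section \<open>Integration along lines\<close>

lemma distr_PiM_coordinatewise:
  assumes "product_sigma_finite M" "finite I"
    and T: "\<And>i. i \<in> I \<Longrightarrow> T i \<in> measurable (M i) (M i)"
      "\<And>i. i \<in> I \<Longrightarrow> distr (M i) (M i) (T i) = M i"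
  shows "distr (PiM I M) (PiM I M) (\<lambda>p. \<lambda>i\<in>I. T i (p i)) = PiM I M"
proof -
  interpret product_sigma_finite M by fact
  have meas[measurable]: "(\<lambda>p. \<lambda>i\<in>I. T i (p i)) \<in> measurable (PiM I M) (PiM I M)"
    by (intro measurable_restrict measurable_compose[OF measurable_component_singleton]) (use T(1) in auto)
  show ?thesis
  proof (rule PiM_eqI)
    fix A assume A: "\<And>i. i \<in> I \<Longrightarrow> A i \<in> sets (M i)"
    have "(\<lambda>p. \<lambda>i\<in>I. T i (p i)) -` Pi\<^sub>E I A \<inter> space (PiM I M) = Pi\<^sub>E I (\<lambda>i. T i -` A i \<inter> space (M i))"
      by (auto simp: space_PiM PiE_def Pi_def)
    then have "emeasure (distr (PiM I M) (PiM I M) (\<lambda>p. \<lambda>i\<in>I. T i (p i))) (Pi\<^sub>E I A)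
        = emeasure (PiM I M) (Pi\<^sub>E I (\<lambda>i. T i -` A i \<inter> space (M i)))"
      using A assms(2) by (subst emeasure_distr) (auto intro!: sets_PiM_I_finite)
    also have "\<dots> = (\<Prod>i\<in>I. emeasure (M i) (T i -` A i \<inter> space (M i)))"
      by (intro emeasure_PiM assms measurable_sets[OF T(1)] A)
    also have "\<dots> = (\<Prod>i\<in>I. emeasure (distr (M i) (M i) (T i)) (A i))"
      by (intro prod.cong refl, subst emeasure_distr) (auto intro: T A)
    also have "\<dots> = (\<Prod>i\<in>I. emeasure (M i) (A i))" using T(2) by simp
    finally show "emeasure (distr (PiM I M) (PiM I M) (\<lambda>p. \<lambda>i\<in>I. T i (p i))) (Pi\<^sub>E I A) = (\<Prod>i\<in>I. emeasure (M i) (A i))" .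
  qed (use assms in auto)
qed

lemma nn_integral_PiM_coordinatewise:
  assumes "product_sigma_finite M" "finite I"
    and T: "\<And>i. i \<in> I \<Longrightarrow> T i \<in> measurable (M i) (M i)"
      "\<And>i. i \<in> I \<Longrightarrow> distr (M i) (M i) (T i) = M i"
    and [measurable]: "f \<in> borel_measurable (PiM I M)"
  shows "(\<integral>\<^sup>+p. f (\<lambda>i\<in>I. T i (p i)) \<partial>PiM I M) = (\<integral>\<^sup>+p. f p \<partial>PiM I M)"
proof -
  have [measurable]: "(\<lambda>p. \<lambda>i\<in>I. T i (p i)) \<in> measurable (PiM I M) (PiM I M)"
    by (intro measurable_restrict measurable_compose[OF measurable_component_singleton]) (use T(1) in auto)
  have "(\<integral>\<^sup>+p. f p \<partial>PiM I M) = (\<integral>\<^sup>+p. f p \<partial>distr (PiM I M) (PiM I M) (\<lambda>p. \<lambda>i\<in>I. T i (p i)))"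
    using distr_PiM_coordinatewise[OF assms(1-4)] by simp
  also have "\<dots> = (\<integral>\<^sup>+p. f (\<lambda>i\<in>I. T i (p i)) \<partial>PiM I M)" by (rule nn_integral_distr) auto
  finally show ?thesis ..
qed

lemma nn_integral_lborel_plus:
  fixes c :: "'a::euclidean_space"
  assumes [measurable]: "f \<in> borel_measurable borel"
  shows "(\<integral>\<^sup>+x. f (c + x) \<partial>lborel) = (\<integral>\<^sup>+x. f x \<partial>lborel)"
proof -
  have "(\<integral>\<^sup>+x. f x \<partial>lborel) = (\<integral>\<^sup>+x. f x \<partial>distr lborel borel ((+) c))" by (simp add: lborel_distr_plus)
  also have "\<dots> = (\<integral>\<^sup>+x. f (c + x) \<partial>lborel)" by (rule nn_integral_distr) auto
  finally show ?thesis ..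
qed

text \<open>
  A line in a unit direction \<open>u\<close> meets this slab in a segment of length \<open>1\<close>.  Integrating over the slab
  therefore counts every such line once, like integrating over the hyperplane orthogonal to \<open>u\<close>, but it
  needs no coordinates on the hyperplane.
\<close>

definition unit_slab :: "'a::real_inner \<Rightarrow> 'a set" where
  "unit_slab u = {x. 0 \<le> x \<bullet> u \<and> x \<bullet> u < 1}"

lemma unit_slab_borel[measurable]: "unit_slab u \<in> sets borel" for u :: "'a::euclidean_space"
  unfolding unit_slab_def by measurable

lemma nn_integral_unit_slab_line:
  fixes u :: "'a::euclidean_space"
  assumes "norm u = 1"
  shows "(\<integral>\<^sup>+t. indicator (unit_slab u) (x - t *\<^sub>R u) \<partial>lborel) = 1"
proof -
  have "u \<bullet> u = 1" using assms by (simp add: norm_eq_1)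
  then have "(\<integral>\<^sup>+t. indicator (unit_slab u) (x - t *\<^sub>R u) \<partial>lborel) = (\<integral>\<^sup>+t. indicator {x \<bullet> u - 1 <.. x \<bullet> u} t \<partial>lborel)"
    by (intro nn_integral_cong) (auto simp: unit_slab_def indicator_def inner_diff_left)
  also have "\<dots> = 1" by (subst nn_integral_indicator) auto
  finally show ?thesis .
qed

text \<open>
  Exchanging the integrals and translating by \<open>t *\<^sub>R u\<close> moves the displacement from \<open>f\<close> to the indicator
  of the slab, whose integral over \<open>t\<close> is \<open>1\<close>.
\<close>

lemma nn_integral_by_lines:
  fixes u :: "'a::euclidean_space"
  assumes u: "norm u = 1" and [measurable]: "f \<in> borel_measurable borel"
  shows "(\<integral>\<^sup>+x. f x \<partial>lborel)
    = (\<integral>\<^sup>+x. indicator (unit_slab u) x * (\<integral>\<^sup>+t. f (x + t *\<^sub>R u) \<partial>lborel) \<partial>lborel)"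
proof -
  have "(\<integral>\<^sup>+x. indicator (unit_slab u) x * (\<integral>\<^sup>+t. f (x + t *\<^sub>R u) \<partial>lborel) \<partial>lborel)
      = (\<integral>\<^sup>+x. (\<integral>\<^sup>+t. indicator (unit_slab u) x * f (x + t *\<^sub>R u) \<partial>lborel) \<partial>lborel)"
    by (intro nn_integral_cong nn_integral_cmult[symmetric]) auto
  also have "\<dots> = (\<integral>\<^sup>+t. (\<integral>\<^sup>+x. indicator (unit_slab u) x * f (x + t *\<^sub>R u) \<partial>lborel) \<partial>lborel)"
    by (rule lborel_pair.Fubini') auto
  also have "\<dots> = (\<integral>\<^sup>+t. (\<integral>\<^sup>+x. indicator (unit_slab u) (x - t *\<^sub>R u) * f x \<partial>lborel) \<partial>lborel)"
  proof (rule nn_integral_cong)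
    fix t :: real
    show "(\<integral>\<^sup>+x. indicator (unit_slab u) x * f (x + t *\<^sub>R u) \<partial>lborel) = (\<integral>\<^sup>+x. indicator (unit_slab u) (x - t *\<^sub>R u) * f x \<partial>lborel)"
      using nn_integral_lborel_plus[of "\<lambda>x. indicator (unit_slab u) (x - t *\<^sub>R u) * f x" "t *\<^sub>R u"]
      by (simp add: add.commute)
  qed
  also have "\<dots> = (\<integral>\<^sup>+x. (\<integral>\<^sup>+t. indicator (unit_slab u) (x - t *\<^sub>R u) * f x \<partial>lborel) \<partial>lborel)"
    by (rule lborel_pair.Fubini') auto
  also have "\<dots> = (\<integral>\<^sup>+x. f x \<partial>lborel)"
    by (intro nn_integral_cong, subst nn_integral_multc) (auto simp: nn_integral_unit_slab_line[OF u])
  finally show ?thesis ..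
qed

lemma sigma_finite_PiM_lborel:
  "finite I \<Longrightarrow> sigma_finite_measure (PiM I (\<lambda>_. lborel :: 'a::euclidean_space measure))"
  by (rule product_sigma_finite.sigma_finite) unfold_locales

text \<open>
  The same decomposition for tuples of points, each point moving independently on its own line.
\<close>

lemma nn_integral_PiM_by_lines:
  fixes u :: "'a::euclidean_space" and f :: "('i \<Rightarrow> 'a) \<Rightarrow> ennreal"
  assumes u: "norm u = 1" and I: "finite I" and [measurable]: "f \<in> borel_measurable (lborels I)"
  shows "(\<integral>\<^sup>+p. f p \<partial>lborels I)
    = (\<integral>\<^sup>+p. (\<Prod>i\<in>I. indicator (unit_slab u) (p i)) *
         (\<integral>\<^sup>+t. f (\<lambda>i\<in>I. p i + t i *\<^sub>R u) \<partial>lborels I) \<partial>lborels I)"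
proof -
  let ?E = "PiM I (\<lambda>_. lborel :: 'a measure)" and ?R = "PiM I (\<lambda>_. lborel :: real measure)"
  interpret E: product_sigma_finite "\<lambda>_::'i. lborel :: 'a measure" by standard
  interpret R: product_sigma_finite "\<lambda>_::'i. lborel :: real measure" by standard
  let ?s = "\<lambda>p. \<Prod>i\<in>I. indicator (unit_slab u) (p i) :: ennreal"
  have "(\<integral>\<^sup>+p. ?s p * (\<integral>\<^sup>+t. f (\<lambda>i\<in>I. p i + t i *\<^sub>R u) \<partial>?R) \<partial>?E)
      = (\<integral>\<^sup>+p. (\<integral>\<^sup>+t. ?s p * f (\<lambda>i\<in>I. p i + t i *\<^sub>R u) \<partial>?R) \<partial>?E)"
    by (intro nn_integral_cong nn_integral_cmult[symmetric]) auto
  also have "\<dots> = (\<integral>\<^sup>+t. (\<integral>\<^sup>+p. ?s p * f (\<lambda>i\<in>I. p i + t i *\<^sub>R u) \<partial>?E) \<partial>?R)"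
    by (rule pair_sigma_finite.Fubini'[OF pair_sigma_finite.intro]) (auto intro: sigma_finite_PiM_lborel I)
  also have "\<dots> = (\<integral>\<^sup>+t. (\<integral>\<^sup>+p. (\<Prod>i\<in>I. indicator (unit_slab u) (p i - t i *\<^sub>R u)) * f p \<partial>?E) \<partial>?R)"
  proof (rule nn_integral_cong)
    fix t
    have "(\<integral>\<^sup>+p. (\<lambda>p. (\<Prod>i\<in>I. indicator (unit_slab u) (p i - t i *\<^sub>R u)) * f p) (\<lambda>i\<in>I. t i *\<^sub>R u + p i) \<partial>?E)
       = (\<integral>\<^sup>+p. (\<lambda>p. (\<Prod>i\<in>I. indicator (unit_slab u) (p i - t i *\<^sub>R u)) * f p) p \<partial>?E)"
    proof (rule nn_integral_PiM_coordinatewise[where T="\<lambda>i x. t i *\<^sub>R u + x"])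
      show "distr lborel lborel ((+) (t i *\<^sub>R u)) = lborel" for i
        using lborel_distr_plus[of "t i *\<^sub>R u"] by (metis distr_cong sets_lborel)
    qed (use I E.product_sigma_finite_axioms in auto)
    moreover have "(\<Prod>i\<in>I. indicator (unit_slab u) ((\<lambda>i\<in>I. t i *\<^sub>R u + p i) i - t i *\<^sub>R u)) = ?s p" for p
      by (intro prod.cong) auto
    ultimately show "(\<integral>\<^sup>+p. ?s p * f (\<lambda>i\<in>I. p i + t i *\<^sub>R u) \<partial>?E)
        = (\<integral>\<^sup>+p. (\<Prod>i\<in>I. indicator (unit_slab u) (p i - t i *\<^sub>R u)) * f p \<partial>?E)"
      by (simp add: add.commute)
  qed
  also have "\<dots> = (\<integral>\<^sup>+p. (\<integral>\<^sup>+t. (\<Prod>i\<in>I. indicator (unit_slab u) (p i - t i *\<^sub>R u)) * f p \<partial>?R) \<partial>?E)"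
    by (rule pair_sigma_finite.Fubini'[OF pair_sigma_finite.intro]) (auto intro: sigma_finite_PiM_lborel I)
  also have "\<dots> = (\<integral>\<^sup>+p. f p \<partial>?E)"
  proof (rule nn_integral_cong)
    fix p :: "'i \<Rightarrow> 'a"
    have "(\<integral>\<^sup>+t. (\<Prod>i\<in>I. indicator (unit_slab u) (p i - t i *\<^sub>R u)) * f p \<partial>?R)
        = (\<integral>\<^sup>+t. (\<Prod>i\<in>I. indicator (unit_slab u) (p i - t i *\<^sub>R u)) \<partial>?R) * f p"
      by (rule nn_integral_multc) auto
    also have "(\<integral>\<^sup>+t. (\<Prod>i\<in>I. indicator (unit_slab u) (p i - t i *\<^sub>R u)) \<partial>?R)
        = (\<Prod>i\<in>I. (\<integral>\<^sup>+s. indicator (unit_slab u) (p i - s *\<^sub>R u) \<partial>lborel))"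
      using I by (intro R.product_nn_integral_prod) auto
    also have "\<dots> = 1" by (simp add: nn_integral_unit_slab_line[OF u])
    finally show "(\<integral>\<^sup>+t. (\<Prod>i\<in>I. indicator (unit_slab u) (p i - t i *\<^sub>R u)) * f p \<partial>?R) = f p" by simp
  qed
  finally show ?thesis ..
qed

section \<open>Steiner symmetrization in horizontal directions\<close>

lemma borel_fst[measurable]: "fst \<in> borel_measurable (borel :: ('a::euclidean_space \<times> 'b::euclidean_space) measure)"
  by (intro borel_measurable_continuous_onI continuous_intros)

lemma borel_snd[measurable]: "snd \<in> borel_measurable (borel :: ('a::euclidean_space \<times> 'b::euclidean_space) measure)"
  by (intro borel_measurable_continuous_onI continuous_intros)

lemma convex_real_diff_le_measure:
  fixes J :: "real set"
  assumes "convex J" and [measurable]: "J \<in> sets borel" and "vol J < \<infinity>" "s \<in> J" "t \<in> J"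
  shows "t - s \<le> measure lborel J"
proof (cases "s \<le> t")
  case True
  have "{s..t} \<subseteq> J" using assms by (simp add: convex_contains_segment closed_segment_eq_real_ivl True)
      (metis True closed_segment_eq_real_ivl)
  then have "measure lborel {s..t} \<le> measure lborel J"
    using assms by (intro measure_mono_fmeasurable) (auto simp: fmeasurable_def)
  then show ?thesis using True by simp
next
  case False
  then show ?thesis using measure_nonneg[of lborel J] by linarith
qed

text \<open>
  A set of reals is no longer than its diameter.  Together with \<open>convex_real_diff_le_measure\<close> this turns
  statements about lengths of intervals into statements about pairs of points in them.
\<close>

lemma emeasure_real_le_if_diff_le:
  fixes J :: "real set"
  assumes J: "\<And>s t. s \<in> J \<Longrightarrow> t \<in> J \<Longrightarrow> t - s \<le> d"
  shows "vol J \<le> ennreal d"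
proof (cases "J = {}")
  case False
  then obtain s where s: "s \<in> J" by blast
  have "bdd_below J" using J[OF _ s] by (intro bdd_belowI[of _ "s - d"]) (auto simp: algebra_simps)
  have "t - d \<le> Inf J" if "t \<in> J" for t
    using J[OF _ that] by (intro cInf_greatest False) (auto simp: algebra_simps)
  then have "J \<subseteq> {Inf J..Inf J + d}"
    using \<open>bdd_below J\<close> by (auto intro: cInf_lower simp: algebra_simps)
  then have "vol J \<le> vol {Inf J..Inf J + d}" by (intro emeasure_mono) auto
  also have "\<dots> \<le> ennreal d" by (simp add: emeasure_lborel_Icc_eq)
  finally show ?thesis .
qed simp

lemma mult_measure_real_le_if_diff_le:
  fixes J :: "real set"
  assumes "J \<noteq> {}" "0 \<le> c" and J: "\<And>s t. s \<in> J \<Longrightarrow> t \<in> J \<Longrightarrow> c * (t - s) \<le> d"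
  shows "c * measure lborel J \<le> d"
proof (cases "c = 0")
  case True
  then show ?thesis using assms by fastforce
next
  case False
  then have c: "0 < c" using assms by simp
  have "0 \<le> d" using assms by fastforce
  have "vol J \<le> ennreal (d / c)"
    using J c by (intro emeasure_real_le_if_diff_le) (simp add: field_simps)
  then have "measure lborel J \<le> d / c"
    unfolding measure_def using \<open>0 \<le> d\<close> c by (intro enn2real_leI) auto
  then show ?thesis using c by (simp add: field_simps)
qed

text \<open>
  In \<open>'a \<times> real\<close> the second component is the height; horizontal refers to sets, lines and motions at a
  fixed height.
\<close>

definition horizontally_convex :: "('a::real_vector \<times> real) set \<Rightarrow> bool" where
  "horizontally_convex B \<longleftrightarrow> (\<forall>z. convex (slice z B))"

definition chord_length :: "'a::euclidean_space \<Rightarrow> ('a \<times> real) set \<Rightarrow> 'a \<times> real \<Rightarrow> real" where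
  "chord_length u B x = measure lborel {t. x + t *\<^sub>R (u, 0) \<in> B}"

text \<open>
  Every chord parallel to \<open>u\<close> is centred at the hyperplane orthogonal to \<open>u\<close>.  The chords are closed, so
  that they contain half the difference of any two points of the original chord; lines that
  miss \<open>B\<close> have chord length \<open>0\<close> and must not contribute points.
\<close>

definition steiner_symmetral :: "'a::euclidean_space \<Rightarrow> ('a \<times> real) set \<Rightarrow> ('a \<times> real) set" where
  "steiner_symmetral u B = {x. 0 < chord_length u B x \<and> \<bar>fst x \<bullet> u\<bar> \<le> chord_length u B x / 2}"

lemma sets_line[measurable]:
  fixes B :: "('a::euclidean_space \<times> real) set"
  assumes [measurable]: "B \<in> sets borel"
  shows "{t. x + t *\<^sub>R (u, 0) \<in> B} \<in> sets borel"
  by measurable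

lemma bounded_line:
  fixes B :: "('a::euclidean_space \<times> real) set"
  assumes "bounded B" and u: "norm u = 1"
  shows "bounded {t. x + t *\<^sub>R (u, 0) \<in> B}"
proof -
  obtain K where K: "\<And>y. y \<in> B \<Longrightarrow> norm y \<le> K" using assms(1) by (auto simp: bounded_iff)
  have "\<bar>t\<bar> \<le> K + norm x" if "x + t *\<^sub>R (u, 0) \<in> B" for t
    using K[OF that] norm_triangle_ineq2[of "t *\<^sub>R (u, 0::real)" "- x"] u
    by (simp add: add.commute del: scaleR_Pair)
  then show ?thesis by (auto simp: bounded_iff simp del: scaleR_Pair)
qed

lemma emeasure_line:
  fixes B :: "('a::euclidean_space \<times> real) set"
  assumes "B \<in> sets borel" "bounded B" "norm u = 1"
  shows "vol {t. x + t *\<^sub>R (u, 0) \<in> B} = ennreal (chord_length u B x)"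
    "vol {t. x + t *\<^sub>R (u, 0) \<in> B} < \<infinity>"
proof -
  show *: "vol {t. x + t *\<^sub>R (u, 0) \<in> B} < \<infinity>"
    using bounded_line[OF assms(2,3)] by (rule emeasure_bounded_finite)
  show "vol {t. x + t *\<^sub>R (u, 0) \<in> B} = ennreal (chord_length u B x)"
    unfolding chord_length_def using * by (intro emeasure_eq_ennreal_measure) auto
qed

lemma chord_shift:
  fixes B :: "('a::euclidean_space \<times> real) set"
  assumes "B \<in> sets borel"
  shows "chord_length u B (x + s *\<^sub>R (u, 0)) = chord_length u B x"
proof -
  let ?J = "{t. x + t *\<^sub>R (u, 0) \<in> B}"
  have "{t. x + s *\<^sub>R (u, 0) + t *\<^sub>R (u, 0) \<in> B} = {t. s + 1 * t \<in> ?J}"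
    by (simp add: algebra_simps)
  then show ?thesis
    unfolding chord_length_def measure_def using emeasure_vimage_real_affine[of ?J 1 s] sets_line[OF assms, of x u] by simp
qed

lemma convex_line:
  assumes "horizontally_convex B"
  shows "convex {t. x + t *\<^sub>R (u, 0) \<in> B}"
proof (rule convexI, clarsimp)
  fix s t a b :: real
  assume *: "x + (s *\<^sub>R u, 0) \<in> B" "x + (t *\<^sub>R u, 0) \<in> B" "0 \<le> a" "0 \<le> b" "a + b = 1"
  have "convex {y. (y, snd x) \<in> B}" using assms by (simp add: horizontally_convex_def)
  then have "a *\<^sub>R (fst x + s *\<^sub>R u) + b *\<^sub>R (fst x + t *\<^sub>R u) \<in> {y. (y, snd x) \<in> B}"
    using * by (intro convexD) (auto simp: prod_eq_iff plus_prod_def)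
  moreover have "a *\<^sub>R (fst x + s *\<^sub>R u) + b *\<^sub>R (fst x + t *\<^sub>R u) = fst x + (a * s + b * t) *\<^sub>R u"
    using \<open>a + b = 1\<close> by (simp add: scaleR_add_right scaleR_add_left) (metis add.commute add.left_commute scaleR_add_left scaleR_one)
  ultimately show "x + ((a * s + b * t) *\<^sub>R u, 0) \<in> B" by (simp add: plus_prod_def)
qed

lemma chord_borel[measurable]:
  fixes B :: "('a::euclidean_space \<times> real) set"
  assumes [measurable]: "B \<in> sets borel"
  shows "chord_length u B \<in> borel_measurable borel"
proof -
  have "chord_length u B = (\<lambda>x. enn2real (\<integral>\<^sup>+t. indicator B (x + t *\<^sub>R (u, 0)) \<partial>lborel))"
    by (auto simp: chord_length_def measure_def fun_eq_iff indicator_def[abs_def] simp flip: nn_integral_indicator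
        intro!: arg_cong[where f=enn2real] nn_integral_cong)
  then show ?thesis by simp
qed

lemma steiner_borel[measurable]:
  fixes B :: "('a::euclidean_space \<times> real) set"
  assumes [measurable]: "B \<in> sets borel"
  shows "steiner_symmetral u B \<in> sets borel"
  unfolding steiner_symmetral_def by measurable

text \<open>
  Convex combinations of points on two chords of a slice lie on the chord between them.
\<close>

lemma chord_concave:
  fixes B :: "('a::euclidean_space \<times> real) set"
  assumes B: "B \<in> sets borel" "bounded B" "horizontally_convex B" and u: "norm u = 1"
    and pos: "0 < chord_length u B (x, z)" "0 < chord_length u B (y, z)"
    and ab: "0 \<le> a" "0 \<le> b" "a + b = 1"
  shows "a * chord_length u B (x, z) + b * chord_length u B (y, z) \<le> chord_length u B (a *\<^sub>R x + b *\<^sub>R y, z)"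
proof -
  let ?J = "\<lambda>x. {t. (x, z) + t *\<^sub>R (u, 0) \<in> B}"
  have ne: "?J x \<noteq> {}" "?J y \<noteq> {}" using pos by (auto simp: chord_length_def simp del: scaleR_Pair Collect_empty_eq)
  have mix: "a * s + b * t \<in> ?J (a *\<^sub>R x + b *\<^sub>R y)" if "s \<in> ?J x" "t \<in> ?J y" for s t
  proof -
    have "a *\<^sub>R (x + s *\<^sub>R u) + b *\<^sub>R (y + t *\<^sub>R u) \<in> (slice z B)"
      using B(3) that ab by (intro convexD) (auto simp: horizontally_convex_def)
    then show ?thesis by (simp add: algebra_simps)
  qed
  let ?d = "chord_length u B (a *\<^sub>R x + b *\<^sub>R y, z)"
  have *: "a * (t - s) + b * (t' - s') \<le> ?d" if "s \<in> ?J x" "t \<in> ?J x" "s' \<in> ?J y" "t' \<in> ?J y" for s t s' t'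
    using convex_real_diff_le_measure[OF convex_line[OF B(3)] _ emeasure_line(2)[OF B(1,2) u]
      mix[OF that(1,3)] mix[OF that(2,4)]] B(1) unfolding chord_length_def
    by (simp add: algebra_simps)
  have "a * chord_length u B (x, z) \<le> ?d - b * (t' - s')" if "s' \<in> ?J y" "t' \<in> ?J y" for s' t'
    unfolding chord_length_def[of u B "(x,z)"] using ne ab *[OF _ _ that]
    by (intro mult_measure_real_le_if_diff_le) (auto simp: algebra_simps)
  then have "b * chord_length u B (y, z) \<le> ?d - a * chord_length u B (x, z)"
    unfolding chord_length_def[of u B "(y,z)"] using ne ab
    by (intro mult_measure_real_le_if_diff_le) (auto simp: algebra_simps)
  then show ?thesis by simp
qed

lemma steiner_horizontally_convex:
  fixes B :: "('a::euclidean_space \<times> real) set"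
  assumes B: "B \<in> sets borel" "bounded B" "horizontally_convex B" and u: "norm u = 1"
  shows "horizontally_convex (steiner_symmetral u B)"
  unfolding horizontally_convex_def
proof (intro allI convexI)
  fix z x y and a b :: real
  assume xy: "x \<in> (slice z (steiner_symmetral u B))" "y \<in> (slice z (steiner_symmetral u B))" and ab: "0 \<le> a" "0 \<le> b" "a + b = 1"
  let ?c = "\<lambda>x. chord_length u B (x, z)"
  have pos: "0 < ?c x" "0 < ?c y" and le: "\<bar>x \<bullet> u\<bar> \<le> ?c x / 2" "\<bar>y \<bullet> u\<bar> \<le> ?c y / 2"
    using xy by (auto simp: steiner_symmetral_def)
  have conc: "a * ?c x + b * ?c y \<le> ?c (a *\<^sub>R x + b *\<^sub>R y)" by (rule chord_concave[OF B u pos ab])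
  have "0 < a \<or> 0 < b" using ab by linarith
  then have "0 < a * ?c x + b * ?c y"
    using pos ab by (auto intro: add_pos_nonneg add_nonneg_pos)
  moreover have "\<bar>(a *\<^sub>R x + b *\<^sub>R y) \<bullet> u\<bar> \<le> a * \<bar>x \<bullet> u\<bar> + b * \<bar>y \<bullet> u\<bar>"
    using ab abs_triangle_ineq[of "a * (x \<bullet> u)" "b * (y \<bullet> u)"] by (simp add: inner_add_left abs_mult)
  moreover have "a * \<bar>x \<bullet> u\<bar> + b * \<bar>y \<bullet> u\<bar> \<le> a * (?c x / 2) + b * (?c y / 2)"
    using le ab by (intro add_mono mult_left_mono) auto
  ultimately show "a *\<^sub>R x + b *\<^sub>R y \<in> (slice z (steiner_symmetral u B))"
    using conc by (simp add: steiner_symmetral_def field_simps)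
qed

text \<open>
  Pythagoras: the first summand on the right does not depend on \<open>t\<close>.
\<close>

lemma norm_line_squared:
  fixes x u :: "'a::real_inner"
  assumes u: "norm u = 1"
  shows "(norm (x + t *\<^sub>R u))\<^sup>2 = (norm (x - (x \<bullet> u) *\<^sub>R u))\<^sup>2 + (x \<bullet> u + t)\<^sup>2"
proof -
  have "u \<bullet> u = 1" using u by (simp add: norm_eq_1)
  then show ?thesis
    unfolding power2_norm_eq_inner
    by (simp add: inner_add_left inner_add_right inner_diff_left inner_diff_right inner_commute power2_eq_square algebra_simps)
qed

text \<open>
  A chord is at most as long as the chord that the ball cuts out of the same line, and the latter is
  centred already.
\<close>

lemma steiner_subset_cball:
  fixes B :: "('a::euclidean_space \<times> real) set"
  assumes B: "B \<in> sets borel" and sub: "B \<subseteq> cball 0 R \<times> Z" and u: "norm u = 1"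
  shows "steiner_symmetral u B \<subseteq> cball 0 R \<times> Z"
proof (clarsimp simp: steiner_symmetral_def)
  fix x z assume pos: "0 < chord_length u B (x, z)" and le: "\<bar>x \<bullet> u\<bar> * 2 \<le> chord_length u B (x, z)"
  let ?J = "{t. (x, z) + t *\<^sub>R (u, 0) \<in> B}" and ?y = "norm (x - (x \<bullet> u) *\<^sub>R u)"
  have "?J \<noteq> {}" using pos by (auto simp: chord_length_def simp del: scaleR_Pair Collect_empty_eq)
  then obtain t0 where t0: "t0 \<in> ?J" by blast
  then have z: "z \<in> Z" and R0: "norm (x + t0 *\<^sub>R u) \<le> R" using sub by auto
  have R: "0 \<le> R" using R0 norm_ge_zero order_trans by blast
  have sq: "?y\<^sup>2 + (x \<bullet> u + t)\<^sup>2 \<le> R\<^sup>2" if "t \<in> ?J" for t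
  proof -
    have "norm (x + t *\<^sub>R u) \<le> R" using that sub by auto
    then have "(norm (x + t *\<^sub>R u))\<^sup>2 \<le> R\<^sup>2" by (intro power_mono) auto
    then show ?thesis by (simp only: norm_line_squared[OF u])
  qed
  define q where "q = sqrt (R\<^sup>2 - ?y\<^sup>2)"
  have yR: "?y\<^sup>2 \<le> R\<^sup>2" using sq[OF t0] by (smt (verit) zero_le_power2)
  then have q: "0 \<le> q" "q\<^sup>2 = R\<^sup>2 - ?y\<^sup>2" by (auto simp: q_def)
  have absq: "\<bar>x \<bullet> u + t\<bar> \<le> q" if "t \<in> ?J" for t
    using sq[OF that] q by (intro abs_le_square_iff[THEN iffD2, of _ q, simplified abs_of_nonneg[OF q(1)]]) simp
  have "1 * measure lborel ?J \<le> 2 * q"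
  proof (rule mult_measure_real_le_if_diff_le)
    fix s t assume "s \<in> ?J" "t \<in> ?J"
    then show "1 * (t - s) \<le> 2 * q" using absq[of s] absq[of t] by simp
  qed (use t0 in auto)
  then have "\<bar>x \<bullet> u\<bar> \<le> q" using le by (simp add: chord_length_def)
  then have "(x \<bullet> u)\<^sup>2 \<le> q\<^sup>2" using q(1) by (simp add: abs_le_square_iff[symmetric])
  then have "(norm x)\<^sup>2 \<le> R\<^sup>2" using norm_line_squared[OF u, of x 0] q(2) by simp
  then show "norm x \<le> R \<and> z \<in> Z" using R z by (simp add: power2_le_iff_abs_le)
qed

lemma line_steiner:
  fixes B :: "('a::euclidean_space \<times> real) set"
  assumes B: "B \<in> sets borel" and u: "norm u = 1"
  shows "{t. x + t *\<^sub>R (u, 0) \<in> steiner_symmetral u B} = (if 0 < chord_length u B x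
    then {- (fst x \<bullet> u) - chord_length u B x / 2 .. - (fst x \<bullet> u) + chord_length u B x / 2} else {})"
proof -
  have "u \<bullet> u = 1" using u by (simp add: norm_eq_1)
  then show ?thesis
    unfolding steiner_symmetral_def mem_Collect_eq chord_shift[OF B] by (auto simp: inner_add_left abs_if split: if_splits)
qed

lemma emeasure_by_lines:
  fixes B :: "('a::euclidean_space \<times> real) set"
  assumes u: "norm u = 1" and [measurable]: "B \<in> sets borel"
  shows "vol B = (\<integral>\<^sup>+x. indicator (unit_slab (u, 0)) x * vol {t. x + t *\<^sub>R (u, 0) \<in> B} \<partial>lborel)"
proof -
  have "vol B = (\<integral>\<^sup>+x. indicator B x \<partial>lborel)" by simp
  also have "\<dots> = (\<integral>\<^sup>+x. indicator (unit_slab (u, 0)) x * (\<integral>\<^sup>+t. indicator B (x + t *\<^sub>R (u, 0)) \<partial>lborel) \<partial>lborel)"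
    by (rule nn_integral_by_lines) (use u in auto)
  also note split = calculation
  have line: "(\<integral>\<^sup>+t. indicator B (x + t *\<^sub>R (u, 0)) \<partial>lborel) = vol {t. x + t *\<^sub>R (u, 0) \<in> B}" for x
    by (subst nn_integral_indicator[symmetric]) (auto simp: indicator_def simp del: scaleR_Pair nn_integral_indicator intro!: nn_integral_cong)
  show ?thesis by (simp only: split line)
qed

lemma emeasure_section_by_lines:
  fixes B :: "('a::euclidean_space \<times> real) set"
  assumes u: "norm u = 1" and [measurable]: "B \<in> sets borel"
  shows "vol (slice z B) = (\<integral>\<^sup>+x. indicator (unit_slab u) x * vol {t. (x, z) + t *\<^sub>R (u, 0) \<in> B} \<partial>lborel)"
proof -
  have "vol (slice z B) = (\<integral>\<^sup>+x. indicator B (x, z) \<partial>lborel)"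
    by (subst nn_integral_indicator[symmetric]) (auto simp: indicator_def simp del: nn_integral_indicator intro!: nn_integral_cong)
  also have "\<dots> = (\<integral>\<^sup>+x. indicator (unit_slab u) x * (\<integral>\<^sup>+t. indicator B (x + t *\<^sub>R u, z) \<partial>lborel) \<partial>lborel)"
    by (rule nn_integral_by_lines) (use u in auto)
  also note split = calculation
  have line: "(\<integral>\<^sup>+t. indicator B (x + t *\<^sub>R u, z) \<partial>lborel) = vol {t. (x, z) + t *\<^sub>R (u, 0) \<in> B}" for x
    by (subst nn_integral_indicator[symmetric]) (auto simp: indicator_def simp del: nn_integral_indicator intro!: nn_integral_cong)
  show ?thesis by (simp only: split line)
qed

lemma emeasure_line_steiner:
  fixes B :: "('a::euclidean_space \<times> real) set"
  assumes B: "B \<in> sets borel" "bounded B" and u: "norm u = 1"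
  shows "vol {t. x + t *\<^sub>R (u, 0) \<in> steiner_symmetral u B} = vol {t. x + t *\<^sub>R (u, 0) \<in> B}"
proof -
  have "0 \<le> chord_length u B x" by (simp add: chord_length_def)
  then show ?thesis
    unfolding line_steiner[OF B(1) u] emeasure_line(1)[OF B u] by (auto simp: emeasure_lborel_Icc_eq)
qed

lemma emeasure_section_steiner:
  fixes B :: "('a::euclidean_space \<times> real) set"
  assumes [measurable]: "B \<in> sets borel" and "bounded B" "norm u = 1"
  shows "vol (slice z (steiner_symmetral u B)) = vol (slice z B)"
  using assms by (simp only: emeasure_section_by_lines steiner_borel emeasure_line_steiner)

text \<open>
  A stack of open balls centred on the height axis, the ball at height \<open>z\<close> having radius \<open>r z\<close>.
\<close>

definition level_balls :: "(real \<Rightarrow> real) \<Rightarrow> ('a::real_normed_vector \<times> real) set" where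
  "level_balls r = {x. norm (fst x) < r (snd x)}"

lemma level_balls_borel[measurable]:
  assumes "r \<in> borel_measurable borel"
  shows "(level_balls r :: ('a::euclidean_space \<times> real) set) \<in> sets borel"
proof -
  have [measurable]: "(\<lambda>x::'a \<times> real. r (snd x)) \<in> borel_measurable borel"
    by (rule measurable_compose[OF borel_snd assms])
  have "{x \<in> space borel. norm (fst x :: 'a) < r (snd x)} \<in> sets borel" by measurable
  then show ?thesis by (simp add: level_balls_def)
qed

text \<open>
  On each line the symmetrized chord and the chord of the stack of balls are concentric, so one of them
  contains the other, and their intersection has the length of the shorter one.  Before the
  symmetrization, the points of \<open>B\<close> in the stack and the points counted by the second summand fit
  disjointly into the chord of \<open>B\<close>; shifting the latter by \<open>s\<close>, they fit disjointly into the chord of the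
  stack.
\<close>

lemma steiner_gain:
  fixes B :: "('a::euclidean_space \<times> real) set"
  assumes B[measurable]: "B \<in> sets borel" and bB: "bounded B" and r[measurable]: "r \<in> borel_measurable borel"
    and u: "norm u = 1"
  shows "vol (B \<inter> level_balls r)
     + vol {x \<in> B - level_balls r. x + s *\<^sub>R (u, 0) \<in> level_balls r - B}
    \<le> vol (steiner_symmetral u B \<inter> level_balls r)"
proof -
  let ?D = "level_balls r" and ?u = "(u, 0::real)"
  let ?G = "{x \<in> B - ?D. x + s *\<^sub>R ?u \<in> ?D - B}"
  let ?L = "\<lambda>A x. {t. x + t *\<^sub>R ?u \<in> A}"
  have G[measurable]: "?G \<in> sets borel" by measurable
  have line: "vol (?L (B \<inter> ?D) x) + vol (?L ?G x) \<le> vol (?L (steiner_symmetral u B \<inter> ?D) x)" for x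
  proof -
    define m where "m = - (fst x \<bullet> u)"
    define c where "c = chord_length u B x"
    have "vol (?L (B \<inter> ?D) x) + vol (?L ?G x) = vol (?L (B \<inter> ?D) x \<union> ?L ?G x)"
      using sets_line[OF G] by (intro plus_emeasure) (auto simp del: scaleR_Pair)
    also have "\<dots> \<le> vol (?L B x)" by (intro emeasure_mono) auto
    also have "\<dots> = ennreal c" unfolding c_def by (rule emeasure_line(1)) fact+
    finally have le_c: "vol (?L (B \<inter> ?D) x) + vol (?L ?G x) \<le> ennreal c" .
    show ?thesis
    proof (cases "0 < c")
      case False
      then show ?thesis using le_c by (simp add: ennreal_neg)
    next
      case True
      have "?L (steiner_symmetral u B \<inter> ?D) x = ?L (steiner_symmetral u B) x \<inter> ?L ?D x" by auto
      also have "\<dots> = {m - c / 2..m + c / 2} \<inter> ?L ?D x"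
        unfolding line_steiner[OF B u] using True by (simp add: m_def c_def)
      finally have st: "?L (steiner_symmetral u B \<inter> ?D) x = {m - c / 2..m + c / 2} \<inter> ?L ?D x" .
      \<comment> \<open>The chord of the stack of balls is an interval centred at the same point \<open>m\<close>.\<close>
      have near: "t' \<in> ?L ?D x" if "t \<in> ?L ?D x" "\<bar>t' - m\<bar> \<le> \<bar>t - m\<bar>" for t t'
      proof -
        have "(t' - m)\<^sup>2 \<le> (t - m)\<^sup>2" using that(2) by (rule abs_le_square_iff[THEN iffD1])
        then have "(norm (fst x + t' *\<^sub>R u))\<^sup>2 \<le> (norm (fst x + t *\<^sub>R u))\<^sup>2"
          unfolding norm_line_squared[OF u] by (simp add: m_def add.commute)
        then have "norm (fst x + t' *\<^sub>R u) \<le> norm (fst x + t *\<^sub>R u)" by (simp add: power2_le_iff_abs_le)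
        then show ?thesis using that(1) by (auto simp: level_balls_def)
      qed
      show ?thesis
      proof (cases "?L ?D x \<subseteq> {m - c / 2..m + c / 2}")
        case True
        have "vol (?L ?G x) = vol {t. t - s \<in> ?L ?G x}"
          using emeasure_vimage_real_affine[of "?L ?G x" 1 "-s"] sets_line[OF G, of x u] by simp
        moreover have "vol (?L (B \<inter> ?D) x) + vol {t. t - s \<in> ?L ?G x}
            = vol (?L (B \<inter> ?D) x \<union> {t. t - s \<in> ?L ?G x})"
        proof (intro plus_emeasure)
          have "(\<lambda>t. t - s) -` ?L ?G x \<inter> space borel \<in> sets borel"
            by (rule measurable_sets[OF _ sets_line[OF G]]) auto
          then show "{t. t - s \<in> ?L ?G x} \<in> sets lborel" by (simp add: vimage_def)
        qed (auto simp: algebra_simps)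
        moreover have "\<dots> \<le> vol (?L ?D x)"
          by (intro emeasure_mono) (auto simp: algebra_simps)
        moreover have "?L (steiner_symmetral u B \<inter> ?D) x = ?L ?D x" using st True by blast
        ultimately show ?thesis by simp
      next
        case False
        then obtain t where t: "t \<in> ?L ?D x" "t \<notin> {m - c / 2..m + c / 2}" by blast
        have "{m - c / 2..m + c / 2} \<subseteq> ?L ?D x"
          using t(2) by (intro subsetI near[OF t(1)]) (auto simp: abs_if)
        then have "?L (steiner_symmetral u B \<inter> ?D) x = {m - c / 2..m + c / 2}" using st by blast
        then have "vol (?L (steiner_symmetral u B \<inter> ?D) x) = ennreal c" using \<open>0 < c\<close> by simp
        then show ?thesis using le_c by simp
      qed
    qed
  qed
  have "vol (B \<inter> ?D) + vol ?G
    = (\<integral>\<^sup>+x. indicator (unit_slab ?u) x * (vol (?L (B \<inter> ?D) x) + vol (?L ?G x)) \<partial>lborel)"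
    unfolding emeasure_by_lines[OF u G] emeasure_by_lines[OF u sets.Int[OF B level_balls_borel[OF r]]]
    by (subst nn_integral_add[symmetric]) (auto simp: distrib_left simp del: scaleR_Pair)
  also have "\<dots> \<le> (\<integral>\<^sup>+x. indicator (unit_slab ?u) x * vol (?L (steiner_symmetral u B \<inter> ?D) x) \<partial>lborel)"
    by (intro nn_integral_mono mult_left_mono line) auto
  also have "\<dots> = vol (steiner_symmetral u B \<inter> ?D)"
    by (rule emeasure_by_lines[OF u, symmetric]) measurable
  finally show ?thesis .
qed

text \<open>
  The reflection in the hyperplane orthogonal to a unit vector \<open>u\<close>, at fixed height.
\<close>

definition mirror_point :: "'a::real_inner \<Rightarrow> 'a \<times> real \<Rightarrow> 'a \<times> real" where
  "mirror_point u x = (fst x - (2 * (fst x \<bullet> u)) *\<^sub>R u, snd x)"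

text \<open>
  Convexity and reflection symmetry in one condition: this is all that Anderson's argument needs to know
  about the intersections of \<open>C\<close> with tuples of lines parallel to \<open>u\<close>.
\<close>

definition mirror_midpoint_closed :: "'i set \<Rightarrow> 'a::real_inner \<Rightarrow> ('i \<Rightarrow> 'a \<times> real) set \<Rightarrow> bool" where
  "mirror_midpoint_closed I u C \<longleftrightarrow> (\<forall>p\<in>C. \<forall>q\<in>C. (\<forall>i\<in>I. \<exists>s. q i = p i + s *\<^sub>R (u, 0)) \<longrightarrow>
     (\<lambda>i\<in>I. (1/2) *\<^sub>R (p i + mirror_point u (q i))) \<in> C)"

lemma ennreal_power2_le_imp_le: "a * a \<le> b\<^sup>2 \<Longrightarrow> a \<le> b" for a b :: ennreal
proof (rule ccontr)
  assume *: "a * a \<le> b\<^sup>2" and "\<not> a \<le> b"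
  then have ba: "b < a" by simp
  show False
  proof (cases "b = 0")
    case False
    have "b * b < b * a" using ba False
      by (intro ennreal_mult_strict_left_mono) (auto simp: less_top[symmetric] top_unique zero_less_iff_neq_zero)
    also have "\<dots> \<le> a * a" using ba by (intro mult_right_mono) auto
    finally show False using * by (simp add: power2_eq_square)
  qed (use * ba in auto)
qed

text \<open>
  Anderson's argument.  On a tuple of lines parallel to \<open>u\<close>, let \<open>X\<close> be the set of displacements that
  lead into \<open>C\<close> and the \<open>B i\<close>, and \<open>Z\<close> the set of those that lead into \<open>C\<close> and the symmetrized sets.
  The reflected copy of \<open>X\<close> has the same measure as \<open>X\<close>, and the midpoints of \<open>X\<close> and its
  reflection belong to \<open>Z\<close>.
\<close>

lemma emeasure_steiner_mono:
  fixes B :: "'i \<Rightarrow> ('a::euclidean_space \<times> real) set"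
  assumes I: "finite I" and B: "\<And>i. i \<in> I \<Longrightarrow> B i \<in> sets borel" "\<And>i. i \<in> I \<Longrightarrow> bounded (B i)"
      "\<And>i. i \<in> I \<Longrightarrow> horizontally_convex (B i)"
    and u: "norm u = 1" and C[measurable]: "C \<in> sets (lborels I)" and mC: "mirror_midpoint_closed I u C"
  shows "emeasure (lborels I) (C \<inter> PiE I B) \<le> emeasure (lborels I) (C \<inter> PiE I (\<lambda>i. steiner_symmetral u (B i)))"
proof -
  let ?E = "PiM I (\<lambda>_. lborel :: ('a \<times> real) measure)" and ?R = "PiM I (\<lambda>_. lborel :: real measure)"
  let ?u = "(u, 0::real)"
  interpret E: product_sigma_finite "\<lambda>_::'i. lborel :: ('a \<times> real) measure" by standard
  interpret R: product_sigma_finite "\<lambda>_::'i. lborel :: real measure" by standard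
  define X where "X B p = {t \<in> space ?R. (\<lambda>i\<in>I. p i + t i *\<^sub>R ?u) \<in> C \<inter> PiE I B}" for B :: "'i \<Rightarrow> ('a \<times> real) set" and p
  have box[measurable]: "C \<inter> PiE I A \<in> sets ?E" if "\<And>i. i \<in> I \<Longrightarrow> A i \<in> sets borel" for A
    using that I by (intro sets.Int C sets_PiM_I_finite) auto
  have sX: "X A p \<in> sets ?R" if "\<And>i. i \<in> I \<Longrightarrow> A i \<in> sets borel" for A p
    unfolding X_def using box[OF that] by measurable
  have lines: "emeasure ?E (C \<inter> PiE I A) = (\<integral>\<^sup>+p. (\<Prod>i\<in>I. indicator (unit_slab ?u) (p i)) * emeasure ?R (X A p) \<partial>?E)"
    if A: "\<And>i. i \<in> I \<Longrightarrow> A i \<in> sets borel" for A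
  proof -
    note box[OF A, measurable]
    have "emeasure ?E (C \<inter> PiE I A) = (\<integral>\<^sup>+p. indicator (C \<inter> PiE I A) p \<partial>?E)"
      by (rule nn_integral_indicator[symmetric]) (rule box[OF A])
    also have "\<dots> = (\<integral>\<^sup>+p. (\<Prod>i\<in>I. indicator (unit_slab ?u) (p i)) *
         (\<integral>\<^sup>+t. indicator (C \<inter> PiE I A) (\<lambda>i\<in>I. p i + t i *\<^sub>R ?u) \<partial>?R) \<partial>?E)"
      by (rule nn_integral_PiM_by_lines) (use u I box[OF A] in auto)
    also note split = calculation
    have line: "(\<integral>\<^sup>+t. indicator (C \<inter> PiE I A) (\<lambda>i\<in>I. p i + t i *\<^sub>R ?u) \<partial>?R) = emeasure ?R (X A p)" for p
      by (subst nn_integral_indicator[OF sX[OF A], symmetric])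
        (auto simp: X_def indicator_def simp del: scaleR_Pair intro!: nn_integral_cong)
    show ?thesis by (simp only: split line)
  qed
  have main: "emeasure ?R (X B p) \<le> emeasure ?R (X (\<lambda>i. steiner_symmetral u (B i)) p)" for p
  proof (cases "\<exists>i\<in>I. chord_length u (B i) (p i) = 0")
    case True
    then obtain i where i: "i \<in> I" "chord_length u (B i) (p i) = 0" by blast
    have "emeasure ?R (X B p) \<le> emeasure ?R (PiE I (\<lambda>i. {t. p i + t *\<^sub>R ?u \<in> B i}))"
      using B(1) I sets_line[OF B(1)]
      by (intro emeasure_mono sets_PiM_I_finite) (auto simp: X_def space_PiM PiE_def Pi_def simp del: scaleR_Pair)
    also have "\<dots> = (\<Prod>i\<in>I. vol {t. p i + t *\<^sub>R ?u \<in> B i})"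
      using I sets_line[OF B(1)] by (intro R.emeasure_PiM) auto
    also have "\<dots> = 0"
      using i I by (intro prod_zero) (auto simp: emeasure_line(1)[OF B(1,2) u] simp del: scaleR_Pair intro!: bexI[of _ i])
    finally show ?thesis by simp
  next
    case False
    then have pos: "0 < chord_length u (B i) (p i)" if "i \<in> I" for i
      using that by (metis chord_length_def less_eq_real_def measure_nonneg)
    \<comment> \<open>In the parameter of the line through \<open>p i\<close>, the mirror image of the displacement \<open>t\<close>.\<close>
    define T where "T i t = - (2 * (fst (p i) \<bullet> u)) - t" for i t
    let ?T = "\<lambda>t. \<lambda>i\<in>I. T i (t i)"
    let ?X = "X B p" and ?Z = "X (\<lambda>i. steiner_symmetral u (B i)) p"
    have u1: "u \<bullet> u = 1" using u by (simp add: norm_eq_1)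
    have [measurable]: "?X \<in> sets ?R" "?Z \<in> sets ?R"
      using sX[of B] sX[of "\<lambda>i. steiner_symmetral u (B i)"] B(1) by auto
    have Tm: "T i \<in> measurable lborel lborel" for i unfolding T_def by measurable
    have Td: "distr lborel lborel (T i) = lborel" for i
    proof -
      have "T i = (\<lambda>x. - (2 * (fst (p i) \<bullet> u)) + (-1) * x)" by (auto simp: T_def)
      then have "lborel = density (distr lborel borel (T i)) (\<lambda>_. 1)"
        using lborel_real_affine[of "-1" "- (2 * (fst (p i) \<bullet> u))"] by simp
      then show ?thesis by (simp add: density_1) (metis distr_cong sets_lborel)
    qed
    have [measurable]: "?T \<in> measurable ?R ?R"
      by (intro measurable_restrict measurable_compose[OF measurable_component_singleton]) (use Tm in auto)
    have refl: "(\<integral>\<^sup>+t. indicator ?X (?T t) \<partial>?R) = emeasure ?R ?X"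
      using nn_integral_PiM_coordinatewise[OF R.product_sigma_finite_axioms I, of T "indicator ?X"] Tm Td by simp
    have "emeasure ?R ?X * emeasure ?R ?X = (\<integral>\<^sup>+t. indicator ?X t \<partial>?R) * (\<integral>\<^sup>+t. indicator ?X (?T t) \<partial>?R)"
      unfolding refl by simp
    also have "\<dots> \<le> (\<integral>\<^sup>+t. indicator ?Z t \<partial>?R)\<^sup>2"
    proof (rule prekopa_leindler_PiM[OF I])
      fix s t assume st: "s \<in> space ?R" "t \<in> space ?R"
      let ?m = "\<lambda>i\<in>I. (s i + t i) / 2"
      have "?m \<in> ?Z" if sX: "s \<in> ?X" and tX: "?T t \<in> ?X"
      proof -
        let ?p = "\<lambda>i\<in>I. p i + s i *\<^sub>R ?u" and ?q = "\<lambda>i\<in>I. p i + ?T t i *\<^sub>R ?u"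
        have pq: "?p \<in> C" "?q \<in> C" "?p \<in> PiE I B" "?q \<in> PiE I B" using sX tX by (auto simp: X_def)
        have eq: "(1/2) *\<^sub>R (?p i + mirror_point u (?q i)) = p i + ?m i *\<^sub>R ?u" if "i \<in> I" for i
          using that u1 by (auto simp: mirror_point_def T_def prod_eq_iff inner_add_left algebra_simps)
             (simp_all add: scaleR_add_left[symmetric] scaleR_diff_left[symmetric] field_simps)
        have "\<forall>i\<in>I. \<exists>r. ?q i = ?p i + r *\<^sub>R ?u"
          by (intro ballI exI[of _ "?T t _ - s _"]) (auto simp: algebra_simps)
        then have "(\<lambda>i\<in>I. (1/2) *\<^sub>R (?p i + mirror_point u (?q i))) \<in> C"
          by (rule mC[unfolded mirror_midpoint_closed_def, THEN bspec, OF pq(1), THEN bspec, OF pq(2), THEN mp])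
        also have "(\<lambda>i\<in>I. (1/2) *\<^sub>R (?p i + mirror_point u (?q i))) = (\<lambda>i\<in>I. p i + ?m i *\<^sub>R ?u)"
          using eq by (auto simp: fun_eq_iff restrict_def)
        finally have "(\<lambda>i\<in>I. p i + ?m i *\<^sub>R ?u) \<in> C" .
        moreover have "p i + ?m i *\<^sub>R ?u \<in> steiner_symmetral u (B i)" if i: "i \<in> I" for i
        proof -
          let ?J = "{t. p i + t *\<^sub>R ?u \<in> B i}"
          have "s i \<in> ?J" "T i (t i) \<in> ?J" using pq(3,4) i by (auto simp: PiE_def Pi_def)
          then have "s i - T i (t i) \<le> chord_length u (B i) (p i)" "T i (t i) - s i \<le> chord_length u (B i) (p i)"
            unfolding chord_length_def
            by (auto intro!: convex_real_diff_le_measure convex_line B(3) i sets_line B(1)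
                simp only: emeasure_line(2)[OF B(1,2)[OF i] u])
          then have "?m i \<in> {t. p i + t *\<^sub>R ?u \<in> steiner_symmetral u (B i)}"
            unfolding line_steiner[OF B(1)[OF i] u] using pos[OF i] i
            by (auto simp: T_def field_simps)
          then show ?thesis by simp
        qed
        ultimately show ?thesis by (auto simp: X_def space_PiM simp del: scaleR_Pair)
      qed
      then show "indicator ?X s * indicator ?X (?T t) \<le> (indicator ?Z ?m :: ennreal)\<^sup>2"
        by (auto simp: indicator_def)
    qed measurable
    also have "\<dots> = (emeasure ?R ?Z)\<^sup>2" by simp
    finally show ?thesis by (rule ennreal_power2_le_imp_le)
  qed
  show ?thesis
    by (subst (1 2) lines) (auto intro!: B steiner_borel nn_integral_mono mult_left_mono main)
qed

section \<open>Rearrangement of horizontally convex sets into stacks of balls\<close>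

lemma section_borel[measurable]:
  fixes B :: "('a::euclidean_space \<times> real) set"
  assumes [measurable]: "B \<in> sets borel"
  shows "slice z B \<in> sets borel"
proof -
  have "{x \<in> space borel. (x, z) \<in> B} \<in> sets borel" by measurable
  then show ?thesis by simp
qed

lemma emeasure_by_sections:
  fixes B :: "('a::euclidean_space \<times> real) set"
  assumes "B \<in> sets borel"
  shows "vol B = (\<integral>\<^sup>+z. vol (slice z B) \<partial>lborel)"
proof -
  have "B \<in> sets (lborel \<Otimes>\<^sub>M lborel)" unfolding lborel_prod using assms by simp
  from lborel_pair.emeasure_pair_measure_alt2[OF this] show ?thesis
    unfolding lborel_prod by (simp add: vimage_def)
qed

lemma nn_integral_by_sections:
  fixes f :: "'a::euclidean_space \<times> real \<Rightarrow> ennreal"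
  assumes [measurable]: "f \<in> borel_measurable borel"
  shows "(\<integral>\<^sup>+p. f p \<partial>lborel) = (\<integral>\<^sup>+z. (\<integral>\<^sup>+x. f (x, z) \<partial>lborel) \<partial>lborel)"
proof -
  have "f \<in> borel_measurable (lborel \<Otimes>\<^sub>M lborel)" by (simp add: lborel_prod)
  from lborel_pair.nn_integral_snd[of f] this show ?thesis by (simp add: lborel_prod)
qed

text \<open>
  The radius of the ball that has the measure of the slice at height \<open>z\<close>.
\<close>

definition level_radius :: "('a::euclidean_space \<times> real) set \<Rightarrow> real \<Rightarrow> real" where
  "level_radius B z = root DIM('a) (measure lborel (slice z B) / measure lborel (ball (0::'a) 1))"

lemma level_radius_borel[measurable]:
  fixes B :: "('a::euclidean_space \<times> real) set"
  assumes [measurable]: "B \<in> sets borel"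
  shows "level_radius B \<in> borel_measurable borel"
  unfolding level_radius_def[abs_def] measure_def by measurable

lemma level_radius_nonneg: "0 \<le> level_radius B z"
  by (simp add: level_radius_def)

lemma section_level_balls: "slice z (level_balls r) = ball 0 (r z)"
  by (auto simp: level_balls_def)

lemma emeasure_ball_level_radius:
  fixes B :: "('a::euclidean_space \<times> real) set"
  assumes "vol (slice z B) < \<infinity>"
  shows "vol (ball (0::'a) (level_radius B z)) = vol (slice z B)"
proof -
  have V: "0 < measure lborel (ball (0::'a) 1)" using content_ball_pos[of 1 "0::'a"] by simp
  have "measure lborel (ball (0::'a) (level_radius B z)) = level_radius B z ^ DIM('a) * measure lborel (ball (0::'a) 1)"
    by (rule content_ball_conv_unit_ball) (rule level_radius_nonneg)
  also have "\<dots> = measure lborel (slice z B)"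
    using V by (simp add: level_radius_def real_root_pow_pos2)
  finally show ?thesis
    using assms emeasure_lborel_ball_finite[of "0::'a" "level_radius B z"]
    by (simp add: emeasure_eq_ennreal_measure less_top)
qed

text \<open>
  Let \<open>a z\<close> be the measure of the slice of \<open>B - D\<close> at height \<open>z\<close>; the slices of \<open>D - B\<close> have the same
  measure.  The integral over all \<open>w\<close> of the measure of the points that \<open>w\<close> carries from \<open>B - D\<close> to
  \<open>D - B\<close> is the integral of \<open>(a z)\<^sup>2\<close>.  The integral of \<open>a\<close> is at least \<open>\<delta>\<close> and is taken over heights in
  \<open>{-R..R}\<close>, so the integral of \<open>(a z)\<^sup>2\<close> is at least \<open>\<delta>\<^sup>2 / (2 * R)\<close>.  Only shifts with \<open>norm w \<le> 2 * R\<close>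
  contribute.
\<close>

lemma exists_shift_with_gain:
  fixes B :: "('a::euclidean_space \<times> real) set"
  assumes [measurable]: "B \<in> sets borel" "D \<in> sets borel"
    and R: "0 < R" and sub: "B \<subseteq> cball 0 R \<times> {-R..R}" "D \<subseteq> cball 0 R \<times> {-R..R}"
    and eq: "\<And>z. vol (slice z D) = vol (slice z B)"
    and \<delta>: "0 < \<delta>" "ennreal \<delta> \<le> vol (B - D)"
    and \<gamma>: "0 \<le> \<gamma>" "\<gamma> * measure lborel (cball (0::'a) (2 * R)) \<le> \<delta>\<^sup>2 / (4 * R)"
  shows "\<exists>w. w \<noteq> 0 \<and> ennreal \<gamma> < vol {x \<in> B - D. x + (w, 0) \<in> D - B}"
proof (rule ccontr)
  let ?M = "\<lambda>w. vol {x \<in> B - D. x + (w, 0) \<in> D - B}"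
  assume none: "\<not> ?thesis"
  have le\<gamma>: "?M w \<le> ennreal \<gamma>" for w
  proof (cases "w = 0")
    case True
    then have "{x \<in> B - D. x + (w, 0) \<in> D - B} = {}" by (auto simp: zero_prod_def[symmetric])
    then show ?thesis by (simp only: emeasure_empty) simp
  qed (use none in \<open>auto simp: not_less\<close>)
  define a where "a z = vol (slice z (B - D))" for z
  have a[measurable]: "a \<in> borel_measurable borel" unfolding a_def[abs_def] by measurable
  have secfin: "vol (slice z (B \<inter> D)) < \<infinity>" for z
    using sub by (intro emeasure_bounded_finite bounded_subset[OF bounded_cball[of "0::'a" R]]) auto
  have aD: "vol (slice z (D - B)) = a z" for z
  proof -
    have "vol (slice z (D - B)) + vol (slice z (B \<inter> D)) = vol (slice z D)"
      by (subst plus_emeasure) (auto intro!: section_borel arg_cong[where f="vol"])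
    moreover have "a z + vol (slice z (B \<inter> D)) = vol (slice z B)"
      unfolding a_def by (subst plus_emeasure) (auto intro!: section_borel arg_cong[where f="vol"])
    ultimately show ?thesis using secfin[of z] eq[of z]
      by (metis ennreal_add_left_cancel add.commute infinity_ennreal_def less_irrefl)
  qed
  have MI: "?M w = (\<integral>\<^sup>+p. indicator (B - D) p * indicator (D - B) (p + (w, 0)) \<partial>lborel)" for w
  proof -
    have "{x \<in> B - D. x + (w, 0) \<in> D - B} \<in> sets borel" by measurable
    then show ?thesis
      by (subst nn_integral_indicator[symmetric]) (auto simp: indicator_def simp del: nn_integral_indicator intro!: nn_integral_cong)
  qed
  have "(\<integral>\<^sup>+w. ?M w \<partial>lborel) = (\<integral>\<^sup>+p. (\<integral>\<^sup>+w. indicator (B - D) p * indicator (D - B) (p + (w, 0)) \<partial>lborel) \<partial>lborel)"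
    unfolding MI by (rule lborel_pair.Fubini') measurable
  also have "\<dots> = (\<integral>\<^sup>+p. indicator (B - D) p * a (snd p) \<partial>lborel)"
  proof (rule nn_integral_cong)
    fix p :: "'a \<times> real"
    have "(\<integral>\<^sup>+w. indicator (D - B) (p + (w, 0)) \<partial>lborel) = (\<integral>\<^sup>+w. (\<lambda>x. indicator (D - B) (x, snd p)) (fst p + w) \<partial>lborel)"
      by (intro nn_integral_cong) (auto simp: plus_prod_def)
    also have "\<dots> = (\<integral>\<^sup>+x. indicator (D - B) (x, snd p) \<partial>lborel)"
      by (rule nn_integral_lborel_plus) measurable
    also have "\<dots> = (\<integral>\<^sup>+x. indicator {x. (x, snd p) \<in> D - B} x \<partial>lborel)"
      by (intro nn_integral_cong) (auto simp: indicator_def)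
    also have "\<dots> = a (snd p)" unfolding aD[symmetric] by (rule nn_integral_indicator) measurable
    finally show "(\<integral>\<^sup>+w. indicator (B - D) p * indicator (D - B) (p + (w, 0)) \<partial>lborel) = indicator (B - D) p * a (snd p)"
      by (subst nn_integral_cmult) auto
  qed
  also have "\<dots> = (\<integral>\<^sup>+z. (\<integral>\<^sup>+x. indicator (B - D) (x, z) * a z \<partial>lborel) \<partial>lborel)"
    by (subst nn_integral_by_sections) auto
  also have "\<dots> = (\<integral>\<^sup>+z. a z * a z \<partial>lborel)"
  proof (rule nn_integral_cong)
    fix z
    have "(\<integral>\<^sup>+x. indicator (B - D) (x, z) \<partial>lborel) = (\<integral>\<^sup>+x. indicator (slice z (B - D)) x \<partial>lborel)"
      by (intro nn_integral_cong) (auto simp: indicator_def)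
    also have "\<dots> = a z" unfolding a_def by (rule nn_integral_indicator) measurable
    finally show "(\<integral>\<^sup>+x. indicator (B - D) (x, z) * a z \<partial>lborel) = a z * a z"
      by (subst nn_integral_multc) auto
  qed
  finally have int_sq: "(\<integral>\<^sup>+w. ?M w \<partial>lborel) = (\<integral>\<^sup>+z. a z * a z \<partial>lborel)" .
  have "(\<integral>\<^sup>+w. ?M w \<partial>lborel) \<le> (\<integral>\<^sup>+w. ennreal \<gamma> * indicator (cball (0::'a) (2 * R)) w \<partial>lborel)"
  proof (rule nn_integral_mono)
    fix w :: 'a
    show "?M w \<le> ennreal \<gamma> * indicator (cball 0 (2 * R)) w"
    proof (cases "w \<in> cball 0 (2 * R)")
      case False
      have "x \<notin> B - D \<or> x + (w, 0) \<notin> D - B" for x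
      proof (rule ccontr)
        assume "\<not> ?thesis"
        then have "norm (fst x) \<le> R" "norm (fst x + w) \<le> R" using sub by (auto simp: plus_prod_def)
        then have "norm w \<le> 2 * R" using norm_triangle_ineq4[of "fst x + w" "fst x"] by simp
        then show False using False by simp
      qed
      then have "{x \<in> B - D. x + (w, 0) \<in> D - B} = {}" by blast
      then show ?thesis by (simp only: emeasure_empty) simp
    qed (use le\<gamma> in simp)
  qed
  also have "\<dots> = ennreal \<gamma> * ennreal (measure lborel (cball (0::'a) (2 * R)))"
    using emeasure_lborel_cball_finite[of "0::'a" "2 * R"]
    by (simp add: nn_integral_cmult_indicator emeasure_eq_ennreal_measure less_top)
  also have "\<dots> = ennreal (\<gamma> * measure lborel (cball (0::'a) (2 * R)))" using \<gamma>(1) by (simp add: ennreal_mult')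
  also have "\<dots> \<le> ennreal (\<delta>\<^sup>2 / (4 * R))" using \<gamma>(2) by (rule ennreal_leI)
  finally have up: "(\<integral>\<^sup>+z. a z * a z \<partial>lborel) \<le> ennreal (\<delta>\<^sup>2 / (4 * R))" using int_sq by simp
  \<comment> \<open>The mean of \<open>a\<close> over \<open>{-R..R}\<close> is at least \<open>s\<close>; with this choice \<open>2 * s * a z \<le> (a z)\<^sup>2 + s\<^sup>2\<close> integrates to the bound wanted.\<close>
  define s where "s = \<delta> / (2 * R)"
  have s: "0 < s" using \<delta> R by (simp add: s_def)
  have amgm: "ennreal (2 * s) * a z \<le> a z * a z + ennreal (s\<^sup>2) * indicator {-R..R} z" for z
  proof (cases "z \<in> {-R..R}")
    case True
    show ?thesis
    proof (cases "a z = \<infinity>")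
      case False
      then obtain b where b: "a z = ennreal b" "0 \<le> b" by (cases "a z") auto
      have "2 * s * b \<le> b * b + s\<^sup>2" using zero_le_power2[of "s - b"] by (simp add: power2_eq_square algebra_simps)
      then have "ennreal (2 * s * b) \<le> ennreal (b * b + s\<^sup>2)" by (rule ennreal_leI)
      then show ?thesis using b True s by (simp add: ennreal_mult ennreal_plus)
    qed (simp add: ennreal_top_mult)
  next
    case False
    then have "(slice z (B - D)) = {}" using sub by auto
    then have "a z = 0" unfolding a_def by (simp only: emeasure_empty)
    then show ?thesis by simp
  qed
  have "ennreal (2 * s * \<delta>) \<le> ennreal (2 * s) * vol (B - D)"
    using \<delta> s by (simp add: ennreal_mult mult_left_mono)
  also have "\<dots> = (\<integral>\<^sup>+z. ennreal (2 * s) * a z \<partial>lborel)"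
  proof -
    have "vol (B - D) = (\<integral>\<^sup>+z. a z \<partial>lborel)"
      unfolding a_def by (rule emeasure_by_sections) measurable
    then show ?thesis by (subst nn_integral_cmult) auto
  qed
  also have "\<dots> \<le> (\<integral>\<^sup>+z. a z * a z + ennreal (s\<^sup>2) * indicator {-R..R} z \<partial>lborel)"
    by (intro nn_integral_mono amgm)
  also have "\<dots> = (\<integral>\<^sup>+z. a z * a z \<partial>lborel) + ennreal (s\<^sup>2) * ennreal (2 * R)"
    using R by (subst nn_integral_add) (auto simp: nn_integral_cmult_indicator)
  also have "\<dots> \<le> ennreal (\<delta>\<^sup>2 / (4 * R)) + ennreal (s\<^sup>2) * ennreal (2 * R)" by (intro add_right_mono up)
  also have "\<dots> = ennreal (\<delta>\<^sup>2 / (4 * R) + s\<^sup>2 * (2 * R))"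
    using R by (simp add: ennreal_mult'[symmetric] ennreal_plus[symmetric] del: ennreal_plus)
  finally have "2 * s * \<delta> \<le> \<delta>\<^sup>2 / (4 * R) + s\<^sup>2 * (2 * R)"
    using R by (subst (asm) ennreal_le_iff) (auto intro!: add_nonneg_nonneg)
  moreover have "2 * s * \<delta> = \<delta>\<^sup>2 / R" "s\<^sup>2 * (2 * R) = \<delta>\<^sup>2 / (2 * R)"
    using R by (auto simp: s_def power2_eq_square field_simps)
  ultimately have "\<delta>\<^sup>2 / R \<le> \<delta>\<^sup>2 / R * (3 / 4)" by (simp add: field_simps)
  moreover have "0 < \<delta>\<^sup>2 / R" using \<delta> R by simp
  moreover have "X \<le> 0" if "X \<le> X * (3 / 4)" for X :: real using that by linarith
  ultimately show False by (meson not_le)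
qed


lemma ennreal_le_if_le_add_mult:
  fixes x y K :: ennreal
  assumes K: "K < \<infinity>" and le: "\<And>d. 0 < d \<Longrightarrow> x \<le> y + ennreal d * K"
  shows "x \<le> y"
proof (rule ennreal_le_epsilon)
  fix e :: real assume "0 < e"
  obtain k where k: "K = ennreal k" "0 \<le> k" using K by (cases K) auto
  have "ennreal (e / (1 + k)) * K = ennreal (e / (1 + k) * k)" using k \<open>0 < e\<close> by (simp add: ennreal_mult'[symmetric])
  also have "\<dots> \<le> ennreal e" using k \<open>0 < e\<close> by (intro ennreal_leI) (simp add: field_simps)
  finally show "x \<le> y + ennreal e"
    using le[of "e / (1 + k)"] k \<open>0 < e\<close> by (meson add_left_mono add_pos_nonneg divide_pos_pos order_trans zero_less_one)
qed

text \<open>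
  Consider the families \<open>B\<close> in the same box that have convex slices of the same measures as those of \<open>A\<close>,
  and for which the measure of \<open>C \<inter> PiE I B\<close> is at least that of \<open>C \<inter> PiE I A\<close>.  Some of them come
  arbitrarily close to the stacks of balls: otherwise every such family could be symmetrized so that its
  overlap with the balls grows by a fixed amount.
\<close>

lemma emeasure_PiE_le_level_balls_bounded:
  fixes A :: "'i \<Rightarrow> ('a::euclidean_space \<times> real) set"
  assumes I: "finite I" and R: "0 < R"
    and A: "\<And>i. i \<in> I \<Longrightarrow> A i \<in> sets borel" "\<And>i. i \<in> I \<Longrightarrow> A i \<subseteq> cball 0 R \<times> {-R..R}"
      "\<And>i. i \<in> I \<Longrightarrow> horizontally_convex (A i)"
    and C: "C \<in> sets (lborels I)" and mC: "\<And>u. norm u = 1 \<Longrightarrow> mirror_midpoint_closed I u C"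
  shows "emeasure (lborels I) (C \<inter> PiE I A)
    \<le> emeasure (lborels I) (C \<inter> PiE I (\<lambda>i. level_balls (level_radius (A i))))"
proof -
  let ?E = "PiM I (\<lambda>_. lborel :: ('a \<times> real) measure)"
  interpret E: product_sigma_finite "\<lambda>_::'i. lborel :: ('a \<times> real) measure" by standard
  define box where "box = cball (0::'a) R \<times> {-R..R}"
  have bbox: "bounded box" unfolding box_def by (intro bounded_Times) auto
  define D :: "'i \<Rightarrow> ('a \<times> real) set" where "D i = level_balls (level_radius (A i))" for i
  have D[measurable]: "D i \<in> sets borel" if "i \<in> I" for i
    unfolding D_def by (intro level_balls_borel level_radius_borel A that)
  have finA: "vol (slice z (A i)) < \<infinity>" if "i \<in> I" for i z
    using A(2)[OF that] by (intro emeasure_bounded_finite bounded_subset[OF bounded_cball[of "0::'a" R]]) auto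
  have secD: "vol (slice z (D i)) = vol (slice z (A i))" if "i \<in> I" for i z
    unfolding D_def section_level_balls by (rule emeasure_ball_level_radius[OF finA[OF that]])
  have Dbox: "D i \<subseteq> box" if i: "i \<in> I" for i
  proof
    fix p assume p: "p \<in> D i"
    obtain x z where xz: "p = (x, z)" by (cases p)
    have ball: "x \<in> ball 0 (level_radius (A i) z)" using p by (simp add: D_def level_balls_def xz)
    have "vol (ball (0::'a) (level_radius (A i) z)) \<noteq> 0"
    proof
      assume "vol (ball (0::'a) (level_radius (A i) z)) = 0"
      moreover have "0 < level_radius (A i) z" using ball by (simp) (meson norm_ge_zero order_le_less_trans)
      ultimately show False
        using content_ball_pos[of "level_radius (A i) z" "0::'a"] by (simp add: measure_def)
    qed
    then have ne: "(slice z (A i)) \<noteq> {}"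
      using emeasure_ball_level_radius[OF finA[OF i, of z]] by (metis emeasure_empty)
    then have z: "z \<in> {-R..R}" using A(2)[OF i] by auto
    have "measure lborel (slice z (A i)) \<le> measure lborel (cball (0::'a) R)"
      using A(1,2)[OF i] section_borel[OF A(1)[OF i], of z] emeasure_lborel_cball_finite[of "0::'a" R]
      by (intro measure_mono_fmeasurable) (auto simp: fmeasurable_def)
    also have "\<dots> = R ^ DIM('a) * measure lborel (ball (0::'a) 1)"
      using content_cball_conv_ball[of "0::'a" R] content_ball_conv_unit_ball[of R "0::'a"] R by simp
    finally have "measure lborel (slice z (A i)) / measure lborel (ball (0::'a) 1) \<le> R ^ DIM('a)"
      using content_ball_pos[of 1 "0::'a"] by (simp add: divide_le_eq)
    then have "level_radius (A i) z \<le> root DIM('a) (R ^ DIM('a))"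
      unfolding level_radius_def by simp
    also have "\<dots> = R" using R by (simp add: real_root_power_cancel)
    finally show "p \<in> box" using ball z by (simp add: box_def xz)
  qed
  \<comment> \<open>The families that the symmetrizations may reach.\<close>
  define adm where "adm B \<longleftrightarrow> (\<forall>i\<in>I. B i \<in> sets borel \<and> B i \<subseteq> box \<and> horizontally_convex (B i)
     \<and> (\<forall>z. vol (slice z (B i)) = vol (slice z (A i))))
     \<and> emeasure ?E (C \<inter> PiE I A) \<le> emeasure ?E (C \<inter> PiE I B)" for B
  have admA: "adm A" using A by (auto simp: adm_def box_def)
  define G where "G B = (\<Sum>i\<in>I. vol (B i \<inter> D i))" for B
  have step: "\<exists>B'. adm B' \<and> G B + ennreal (\<delta>\<^sup>2 / (4 * R) / measure lborel (cball (0::'a) (2 * R))) \<le> G B'"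
    if B: "adm B" and j: "j \<in> I" and \<delta>: "0 < \<delta>" "ennreal \<delta> \<le> vol (B j - D j)" for B j \<delta>
  proof -
    define \<gamma> where "\<gamma> = \<delta>\<^sup>2 / (4 * R) / measure lborel (cball (0::'a) (2 * R))"
    have V: "0 < measure lborel (cball (0::'a) (2 * R))" using content_cball_pos[of "2 * R" "0::'a"] R by simp
    have Bm: "B i \<in> sets borel" "bounded (B i)" "B i \<subseteq> box" "horizontally_convex (B i)"
      "vol (slice z (B i)) = vol (slice z (A i))" if "i \<in> I" for i z
      using B that bounded_subset[OF bbox] by (auto simp: adm_def)
    have "\<exists>w. w \<noteq> 0 \<and> ennreal \<gamma> < vol {x \<in> B j - D j. x + (w, 0) \<in> D j - B j}"
      using Bm[OF j] D[OF j] Dbox[OF j] secD[OF j] R \<delta> V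
      by (intro exists_shift_with_gain[of _ _ R \<delta>]) (auto simp: box_def \<gamma>_def)
    then obtain w where w: "w \<noteq> 0" "ennreal \<gamma> < vol {x \<in> B j - D j. x + (w, 0) \<in> D j - B j}" by blast
    define u where "u = w /\<^sub>R norm w"
    have u: "norm u = 1" and wu: "(w, 0::real) = norm w *\<^sub>R (u, 0)" using w(1) by (auto simp: u_def)
    let ?B = "\<lambda>i. steiner_symmetral u (B i)"
    have gain: "vol (B i \<inter> D i) + vol {x \<in> B i - D i. x + (w, 0) \<in> D i - B i}
        \<le> vol (?B i \<inter> D i)" if "i \<in> I" for i
      unfolding D_def wu by (intro steiner_gain Bm that level_radius_borel A(1) u)
    have "adm ?B"
      unfolding adm_def
    proof (intro conjI ballI allI)
      fix i assume i: "i \<in> I"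
      show "?B i \<in> sets borel" using Bm(1)[OF i] by (rule steiner_borel)
      show "?B i \<subseteq> box" unfolding box_def using Bm(3)[OF i] by (intro steiner_subset_cball Bm(1) i u) (simp add: box_def)
      show "horizontally_convex (?B i)" by (intro steiner_horizontally_convex Bm i u)
      show "vol (slice z (?B i)) = vol (slice z (A i))" for z
        using emeasure_section_steiner[OF Bm(1,2)[OF i] u, of z] Bm(5)[OF i] by simp
    next
      have "emeasure ?E (C \<inter> PiE I B) \<le> emeasure ?E (C \<inter> PiE I ?B)"
        by (intro emeasure_steiner_mono I Bm u C mC)
      then show "emeasure ?E (C \<inter> PiE I A) \<le> emeasure ?E (C \<inter> PiE I ?B)"
        using B by (auto simp: adm_def)
    qed
    moreover have "G B + ennreal \<gamma> \<le> G ?B"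
    proof -
      have "G B + ennreal \<gamma> \<le> (\<Sum>i\<in>I. vol (B i \<inter> D i)) + (\<Sum>i\<in>I. vol {x \<in> B i - D i. x + (w, 0) \<in> D i - B i})"
        unfolding G_def
        by (intro add_left_mono order_trans[OF less_imp_le[OF w(2)]] member_le_sum[of j I "\<lambda>i. vol {x \<in> B i - D i. x + (w, 0) \<in> D i - B i}"] j I) auto
      also have "\<dots> \<le> G ?B"
        unfolding G_def sum.distrib[symmetric] by (intro sum_mono gain)
      finally show ?thesis .
    qed
    ultimately show ?thesis unfolding \<gamma>_def by blast
  qed
  have Dfin: "vol (D i) < \<infinity>" if "i \<in> I" for i
    by (rule emeasure_bounded_finite) (rule bounded_subset[OF bbox Dbox[OF that]])
  have approx: "\<exists>B. adm B \<and> (\<forall>j\<in>I. vol (B j - D j) < ennreal \<delta>)" if \<delta>: "0 < \<delta>" for \<delta>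
  proof (rule ccontr)
    assume "\<not> ?thesis"
    then have far: "\<exists>j\<in>I. ennreal \<delta> \<le> vol (B j - D j)" if "adm B" for B
      using that by (auto simp: not_less)
    define \<gamma> where "\<gamma> = \<delta>\<^sup>2 / (4 * R) / measure lborel (cball (0::'a) (2 * R))"
    have \<gamma>: "0 < \<gamma>" using \<delta> R content_cball_pos[of "2 * R" "0::'a"] by (simp add: \<gamma>_def)
    have grow: "\<exists>B. adm B \<and> ennreal (real n * \<gamma>) \<le> G B" for n
    proof (induction n)
      case 0
      show ?case using admA by auto
    next
      case (Suc n)
      then obtain B where B: "adm B" "ennreal (real n * \<gamma>) \<le> G B" by blast
      obtain j where "j \<in> I" "ennreal \<delta> \<le> vol (B j - D j)" using far[OF B(1)] by blast
      from step[OF B(1) this(1) \<delta> this(2)] obtain B' where B': "adm B'" "G B + ennreal \<gamma> \<le> G B'"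
        unfolding \<gamma>_def by blast
      have "ennreal (real (Suc n) * \<gamma>) = ennreal (real n * \<gamma>) + ennreal \<gamma>"
        using \<gamma> by (simp add: ennreal_plus[symmetric] distrib_right del: ennreal_plus)
      also have "\<dots> \<le> G B'" using B(2) B'(2) by (meson add_right_mono order_trans)
      finally show ?case using B'(1) by blast
    qed
    have GD: "G B \<le> (\<Sum>i\<in>I. vol (D i))" if "adm B" for B
      unfolding G_def by (intro sum_mono emeasure_mono) (auto simp: D)
    have "(\<Sum>i\<in>I. vol (D i)) < \<infinity>" using Dfin I by (auto simp: less_top)
    then obtain k where k: "(\<Sum>i\<in>I. vol (D i)) = ennreal k" "0 \<le> k"
      by (cases "\<Sum>i\<in>I. vol (D i)") auto
    obtain n :: nat where n: "k < real n * \<gamma>" using reals_Archimedean3[OF \<gamma>] by blast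
    obtain B where "adm B" "ennreal (real n * \<gamma>) \<le> G B" using grow by blast
    then have "ennreal (real n * \<gamma>) \<le> ennreal k" using GD k by (metis order_trans)
    then show False using n k by (simp add: ennreal_le_iff)
  qed
  define K where "K = (\<Sum>j\<in>I. \<Prod>i\<in>I - {j}. vol (A i))"
  have Afin: "vol (A i) < \<infinity>" if "i \<in> I" for i
    using A(2)[OF that] by (intro emeasure_bounded_finite bounded_subset[OF bbox]) (auto simp: box_def)
  have Kfin: "K < \<infinity>"
    unfolding K_def using Afin I by (auto simp: less_top[symmetric] ennreal_prod_eq_top)
  have "emeasure ?E (C \<inter> PiE I A) \<le> emeasure ?E (C \<inter> PiE I D)"
  proof (rule ennreal_le_if_le_add_mult[OF Kfin])
    fix \<delta> :: real assume "0 < \<delta>"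
    then obtain B where B: "adm B" and near: "\<And>j. j \<in> I \<Longrightarrow> vol (B j - D j) < ennreal \<delta>"
      using approx by blast
    have Bm: "B i \<in> sets borel" if "i \<in> I" for i using B that by (auto simp: adm_def)
    have eqA: "vol (B i) = vol (A i)" if "i \<in> I" for i
      using B that by (subst (1 2) emeasure_by_sections) (auto simp: adm_def A)
    \<comment> \<open>A tuple in the product of the \<open>B i\<close> but not of the \<open>D i\<close> has some coordinate in \<open>B j - D j\<close>.\<close>
    define Q where "Q j = PiE I (\<lambda>i. if i = j then B j - D j else B i)" for j
    have Qm: "Q j \<in> sets ?E" if "j \<in> I" for j
      unfolding Q_def using I Bm D that by (intro sets_PiM_I_finite) auto
    have Dm: "C \<inter> PiE I D \<in> sets ?E" using I D C by (intro sets.Int sets_PiM_I_finite) auto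
    have "emeasure ?E (C \<inter> PiE I A) \<le> emeasure ?E (C \<inter> PiE I B)" using B by (simp add: adm_def)
    also have "\<dots> \<le> emeasure ?E ((C \<inter> PiE I D) \<union> (\<Union>j\<in>I. Q j))"
    proof (rule emeasure_mono)
      show "C \<inter> PiE I B \<subseteq> (C \<inter> PiE I D) \<union> (\<Union>j\<in>I. Q j)"
        by (auto simp: Q_def PiE_iff)
      show "C \<inter> PiE I D \<union> (\<Union>j\<in>I. Q j) \<in> sets ?E"
        using Dm Qm I by (intro sets.Un sets.finite_UN) auto
    qed
    also have "\<dots> \<le> emeasure ?E (C \<inter> PiE I D) + emeasure ?E (\<Union>j\<in>I. Q j)"
      using Dm Qm I by (intro emeasure_subadditive sets.finite_UN) auto
    also have "emeasure ?E (\<Union>j\<in>I. Q j) \<le> (\<Sum>j\<in>I. emeasure ?E (Q j))"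
      using Qm I by (intro emeasure_subadditive_finite) auto
    also have "\<dots> \<le> (\<Sum>j\<in>I. ennreal \<delta> * (\<Prod>i\<in>I - {j}. vol (A i)))"
    proof (rule sum_mono)
      fix j assume j: "j \<in> I"
      have "emeasure ?E (Q j) = (\<Prod>i\<in>I. vol (if i = j then B j - D j else B i))"
        unfolding Q_def using I Bm D j by (intro E.emeasure_PiM) auto
      also have "\<dots> = vol (B j - D j) * (\<Prod>i\<in>I - {j}. vol (A i))"
        using j I eqA by (subst prod.remove[of I j]) (auto intro!: prod.cong arg_cong2[where f="(*)"])
      also have "\<dots> \<le> ennreal \<delta> * (\<Prod>i\<in>I - {j}. vol (A i))"
        using near[OF j] by (intro mult_right_mono) auto
      finally show "emeasure ?E (Q j) \<le> ennreal \<delta> * (\<Prod>i\<in>I - {j}. vol (A i))" .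
    qed
    also have "\<dots> = ennreal \<delta> * K" by (simp add: K_def sum_distrib_left)
    finally show "emeasure ?E (C \<inter> PiE I A) \<le> emeasure ?E (C \<inter> PiE I D) + ennreal \<delta> * K"
      by (auto intro: add_left_mono)
  qed
  then show ?thesis unfolding D_def[abs_def] .
qed

text \<open>
  Exhaustion by bounded sets: cutting \<open>A i\<close> down to a box preserves the convexity of its slices and can
  only shrink the balls.
\<close>

lemma emeasure_PiE_le_level_balls:
  fixes A :: "'i \<Rightarrow> ('a::euclidean_space \<times> real) set"
  assumes I: "finite I"
    and A: "\<And>i. i \<in> I \<Longrightarrow> A i \<in> sets borel" "\<And>i z. i \<in> I \<Longrightarrow> vol (slice z (A i)) < \<infinity>"
      "\<And>i. i \<in> I \<Longrightarrow> horizontally_convex (A i)"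
    and C: "C \<in> sets (lborels I)" and mC: "\<And>u. norm u = 1 \<Longrightarrow> mirror_midpoint_closed I u C"
  shows "emeasure (lborels I) (C \<inter> PiE I A)
    \<le> emeasure (lborels I) (C \<inter> PiE I (\<lambda>i. level_balls (level_radius (A i))))"
proof -
  let ?E = "PiM I (\<lambda>_. lborel :: ('a \<times> real) measure)"
  define T where "T n i = A i \<inter> cball 0 (real (Suc n)) \<times> {- real (Suc n)..real (Suc n)}" for n i
  have Tm: "T n i \<in> sets borel" if "i \<in> I" for n i
    unfolding T_def by (intro sets.Int[OF A(1)[OF that] borel_closed] closed_Times) auto
  have le: "emeasure ?E (C \<inter> PiE I (T n)) \<le> emeasure ?E (C \<inter> PiE I (\<lambda>i. level_balls (level_radius (A i))))" for n
  proof -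
    have "emeasure ?E (C \<inter> PiE I (T n)) \<le> emeasure ?E (C \<inter> PiE I (\<lambda>i. level_balls (level_radius (T n i))))"
    proof (rule emeasure_PiE_le_level_balls_bounded[OF I _ Tm _ _ C mC, of "real (Suc n)"])
      fix i assume i: "i \<in> I"
      show "horizontally_convex (T n i)"
        unfolding horizontally_convex_def
      proof
        fix z
        have "convex ((slice z (A i)) \<inter> (if z \<in> {- real (Suc n)..real (Suc n)} then cball 0 (real (Suc n)) else {}))"
          using A(3)[OF i] by (intro convex_Int) (auto simp: horizontally_convex_def)
        also have "\<dots> = (slice z (T n i))" by (auto simp: T_def split: if_splits)
        finally show "convex (slice z (T n i))" .
      qed
    qed (auto simp: T_def)
    also have "\<dots> \<le> emeasure ?E (C \<inter> PiE I (\<lambda>i. level_balls (level_radius (A i))))"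
    proof (rule emeasure_mono)
      have "level_radius (T n i) z \<le> level_radius (A i) z" if i: "i \<in> I" for i z
        unfolding level_radius_def
        using section_borel[OF Tm[OF i], of z n] section_borel[OF A(1)[OF i], of z] A(2)[OF i, of z]
        by (intro real_root_le_mono divide_right_mono measure_mono_fmeasurable) (auto simp: T_def fmeasurable_def)
      then have "level_balls (level_radius (T n i)) \<subseteq> (level_balls (level_radius (A i)) :: ('a \<times> real) set)" if "i \<in> I" for i
        unfolding level_balls_def using less_le_trans[OF _ \<open>\<And>z i. i \<in> I \<Longrightarrow> level_radius (T n i) z \<le> level_radius (A i) z\<close>[OF that]]
        by (intro Collect_mono impI)
      then show "C \<inter> PiE I (\<lambda>i. level_balls (level_radius (T n i))) \<subseteq> C \<inter> PiE I (\<lambda>i. level_balls (level_radius (A i)))"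
        by (intro Int_mono order_refl PiE_mono)
      show "C \<inter> PiE I (\<lambda>i. level_balls (level_radius (A i))) \<in> sets ?E"
        using I A(1) C by (intro sets.Int sets_PiM_I_finite) (auto intro!: level_balls_borel level_radius_borel)
    qed
    finally show ?thesis .
  qed
  have "incseq (\<lambda>n. C \<inter> PiE I (T n))"
    by (intro incseq_SucI) (force simp: T_def PiE_iff)
  then have "(SUP n. emeasure ?E (C \<inter> PiE I (T n))) = emeasure ?E (\<Union>n. C \<inter> PiE I (T n))"
    using C I Tm by (intro SUP_emeasure_incseq) (auto intro!: sets_PiM_I_finite)
  also have "(\<Union>n. C \<inter> PiE I (T n)) = C \<inter> PiE I A"
  proof (intro equalityI subsetI)
    fix p assume p: "p \<in> C \<inter> PiE I A"
    obtain n :: nat where n: "(\<Sum>i\<in>I. norm (p i)) \<le> real n" using real_arch_simple by blast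
    have "p i \<in> T n i" if i: "i \<in> I" for i
    proof -
      have "norm (p i) \<le> real n"
        using n member_le_sum[of i I "\<lambda>i. norm (p i)"] i I by auto
      then have "norm (fst (p i)) \<le> real (Suc n)" "norm (snd (p i)) \<le> real (Suc n)"
        using norm_fst_le[of "fst (p i)" "snd (p i)"] norm_snd_le[of "snd (p i)" "fst (p i)"] by auto
      then show ?thesis using p i by (auto simp: T_def PiE_iff mem_Times_iff abs_le_iff)
    qed
    then show "p \<in> (\<Union>n. C \<inter> PiE I (T n))" using p by (auto simp: PiE_iff)
  qed (auto simp: T_def PiE_iff)
  finally show ?thesis by (elim subst) (rule SUP_least, rule le)
qed

section \<open>Shadow systems of suprema over weights\<close>

lemma countable_dense_subset_in:
  fixes S :: "'a::{second_countable_topology} set"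
  obtains D where "countable D" "D \<subseteq> S" "S \<subseteq> closure D"
proof -
  obtain B :: "'a set set" where B: "countable B" "topological_basis B"
    using ex_countable_basis by blast
  define f where "f b = (SOME x. x \<in> b \<inter> S)" for b
  define D where "D = f ` {b \<in> B. b \<inter> S \<noteq> {}}"
  have f: "f b \<in> b \<inter> S" if "b \<inter> S \<noteq> {}" for b using that unfolding f_def by (metis ex_in_conv someI_ex)
  show thesis
  proof
    show "countable D" unfolding D_def using B(1) by auto
    show "D \<subseteq> S" unfolding D_def using f by blast
    show "S \<subseteq> closure D"
    proof
      fix x assume x: "x \<in> S"
      have "D \<inter> T \<noteq> {}" if T: "open T" "x \<in> T" for T
      proof -
        obtain b where "b \<in> B" "x \<in> b" "b \<subseteq> T" using topological_basisE[OF B(2) T] by metis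
        then show ?thesis using f[of b] x unfolding D_def by blast
      qed
      then show "x \<in> closure D" unfolding closure_iff_nhds_not_empty by blast
    qed
  qed
qed

text \<open>
  Rewrites an existential quantifier over a compact set by countably many conditions; this is how suprema
  over weights are shown to be measurable.
\<close>

lemma compact_nonpos_iff_dense:
  fixes h :: "'a::topological_space \<Rightarrow> real"
  assumes "compact S" "continuous_on S h" and D: "D \<subseteq> S" "S \<subseteq> closure D"
  shows "(\<exists>a\<in>S. h a \<le> 0) \<longleftrightarrow> (\<forall>k::nat. \<exists>a\<in>D. h a < 1 / real (Suc k))"
proof
  assume "\<exists>a\<in>S. h a \<le> 0"
  then obtain a where a: "a \<in> S" "h a \<le> 0" by blast
  show "\<forall>k::nat. \<exists>a\<in>D. h a < 1 / real (Suc k)"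
  proof
    fix k :: nat
    obtain T where T: "open T" "T \<inter> S = h -` {..<1 / real (Suc k)} \<inter> S"
      using assms(2) open_lessThan unfolding continuous_on_open_invariant by metis
    have "0 < 1 / real (Suc k)" by simp
    then have "h a < 1 / real (Suc k)" using a(2) by linarith
    then have "a \<in> T" using T(2) a by auto
    then have "T \<inter> D \<noteq> {}" using open_Int_closure_eq_empty[OF T(1), of D] a(1) D(2) by blast
    then show "\<exists>a\<in>D. h a < 1 / real (Suc k)" using T(2) D(1) by blast
  qed
next
  assume *: "\<forall>k::nat. \<exists>a\<in>D. h a < 1 / real (Suc k)"
  then have "S \<noteq> {}" using D(1) by blast
  then obtain a where a: "a \<in> S" "\<And>b. b \<in> S \<Longrightarrow> h a \<le> h b"
    using continuous_attains_inf[OF assms(1) _ assms(2)] by blast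
  have "h a \<le> 0"
  proof (rule ccontr)
    assume "\<not> h a \<le> 0"
    then obtain k where "1 / real (Suc k) < h a" using reals_Archimedean[of "h a"] by (auto simp: inverse_eq_divide)
    moreover obtain b where "b \<in> D" "h b < 1 / real (Suc k)" using * by blast
    ultimately show False using a(2)[of b] D(1) by fastforce
  qed
  then show "\<exists>a\<in>S. h a \<le> 0" using a(1) by blast
qed

definition coefficient_convex :: "('i \<Rightarrow> real) set \<Rightarrow> bool" where
  "coefficient_convex S \<longleftrightarrow> (\<forall>a\<in>S. \<forall>b\<in>S. \<forall>s t. 0 \<le> s \<longrightarrow> 0 \<le> t \<longrightarrow> s + t = 1 \<longrightarrow> (\<lambda>i. s * a i + t * b i) \<in> S)"

definition log_height :: "'i set \<Rightarrow> ('i \<Rightarrow> 'a \<times> real) \<Rightarrow> ('i \<Rightarrow> real) \<Rightarrow> real" where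
  "log_height I p a = (\<Sum>i\<in>I. a i * ln (snd (p i)))"

definition mixed_point :: "'i set \<Rightarrow> ('i \<Rightarrow> 'a::real_vector \<times> real) \<Rightarrow> ('i \<Rightarrow> real) \<Rightarrow> 'a" where
  "mixed_point I p a = (\<Sum>i\<in>I. a i *\<^sub>R fst (p i))"

text \<open>
  For \<open>S\<close> the set of convex weights, this is the exponential of the upper boundary of the convex hull of
  the points \<open>(x\<^sub>i, ln z\<^sub>i)\<close>.  Other sets \<open>S\<close> of weights describe sup-convolutions of such functions; see
  \<open>sup_conv_stoch_approx\<close>.
\<close>

definition weighted_sup :: "'i set \<Rightarrow> ('i \<Rightarrow> real) set \<Rightarrow> ('i \<Rightarrow> 'a::real_vector \<times> real) \<Rightarrow> 'a \<Rightarrow> ennreal" where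
  "weighted_sup I S p v = Sup {ennreal (exp (log_height I p a)) | a. a \<in> S \<and> mixed_point I p a = v}"

definition weighted_sup_integral :: "'i set \<Rightarrow> ('i \<Rightarrow> real) set \<Rightarrow> ('i \<Rightarrow> 'a::euclidean_space \<times> real) \<Rightarrow> ennreal" where
  "weighted_sup_integral I S p = (\<integral>\<^sup>+v. weighted_sup I S p v \<partial>lborel)"

lemma weighted_sup_greater_iff:
  "y < weighted_sup I S p v \<longleftrightarrow> (\<exists>a\<in>S. mixed_point I p a = v \<and> y < ennreal (exp (log_height I p a)))"
  unfolding weighted_sup_def less_Sup_iff by auto

lemma continuous_log_height: "continuous_on S (log_height I p)"
  unfolding log_height_def
  by (intro continuous_intros continuous_on_subset[OF continuous_on_product_coordinates]) auto

lemma continuous_mixed_point: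
  fixes p :: "'i \<Rightarrow> 'a::real_normed_vector \<times> real"
  shows "continuous_on S (mixed_point I p)"
  unfolding mixed_point_def
  by (intro continuous_intros continuous_on_subset[OF continuous_on_product_coordinates]) auto

text \<open>
  The supremum is attained, because the weights with a given mixed point form a compact set.
\<close>

lemma weighted_sup_ge_iff:
  fixes p :: "'i \<Rightarrow> 'a::real_normed_vector \<times> real"
  assumes S: "compact S" and y: "0 < y"
  shows "ennreal y \<le> weighted_sup I S p v \<longleftrightarrow> (\<exists>a\<in>S. max (norm (mixed_point I p a - v)) (ln y - log_height I p a) \<le> 0)"
proof
  assume "\<exists>a\<in>S. max (norm (mixed_point I p a - v)) (ln y - log_height I p a) \<le> 0"
  then obtain a where a: "a \<in> S" "mixed_point I p a = v" "ln y \<le> log_height I p a" by auto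
  have "y \<le> exp (log_height I p a)" using a(3) y by (metis exp_le_cancel_iff exp_ln)
  then show "ennreal y \<le> weighted_sup I S p v"
    unfolding weighted_sup_def using a by (intro Sup_upper2[of "ennreal (exp (log_height I p a))"]) (auto intro: ennreal_leI)
next
  assume le: "ennreal y \<le> weighted_sup I S p v"
  let ?F = "{a \<in> S. mixed_point I p a = v}"
  have "closed {a. mixed_point I p a = v}"
    by (intro closed_Collect_eq continuous_mixed_point continuous_on_const)
  then have "compact (S \<inter> {a. mixed_point I p a = v})" by (rule compact_Int_closed[OF S])
  then have F: "compact ?F" by (simp add: Int_def)
  have "?F \<noteq> {}"
  proof
    assume "?F = {}"
    then have "{ennreal (exp (log_height I p a)) | a. a \<in> S \<and> mixed_point I p a = v} = {}" by blast
    then have "weighted_sup I S p v = 0" unfolding weighted_sup_def by (simp only: Sup_empty bot_ennreal)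
    then show False using le y by simp
  qed
  then obtain a where a: "a \<in> ?F" "\<And>b. b \<in> ?F \<Longrightarrow> log_height I p b \<le> log_height I p a"
    using continuous_attains_sup[OF F _ continuous_log_height] by blast
  have "weighted_sup I S p v \<le> ennreal (exp (log_height I p a))"
    unfolding weighted_sup_def using a by (intro Sup_least) (auto intro!: ennreal_leI)
  then have "ennreal y \<le> ennreal (exp (log_height I p a))" by (rule order_trans[OF le])
  then have "y \<le> exp (log_height I p a)" by (simp add: ennreal_le_iff)
  then have "ln y \<le> log_height I p a" using y by (metis ln_exp ln_mono exp_gt_zero)
  then show "\<exists>a\<in>S. max (norm (mixed_point I p a - v)) (ln y - log_height I p a) \<le> 0" using a(1) by auto
qed

lemma weighted_sup_measurable:
  fixes S :: "('i::countable \<Rightarrow> real) set"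
  assumes S: "compact S"
  shows "(\<lambda>(p, v). weighted_sup I S p v) \<in> borel_measurable (PiM I (\<lambda>_. lborel :: ('a::euclidean_space \<times> real) measure) \<Otimes>\<^sub>M lborel)"
    (is "_ \<in> borel_measurable ?M")
proof (rule borel_measurableI_ge)
  fix y :: ennreal
  obtain D where D: "countable D" "D \<subseteq> S" "S \<subseteq> closure D" using countable_dense_subset_in by blast
  consider "y = 0" | "y = \<infinity>" | r where "y = ennreal r" "0 < r"
    by (cases y) (auto simp: less_le)
  then show "{x \<in> space ?M. y \<le> (case x of (p, v) \<Rightarrow> weighted_sup I S p v)} \<in> sets ?M"
  proof cases
    case 1
    then have "{x \<in> space ?M. y \<le> (case x of (p, v) \<Rightarrow> weighted_sup I S p v)} = space ?M" by simp
    then show ?thesis by (metis sets.top)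
  next
    case 2
    have "weighted_sup I S p v \<noteq> \<infinity>" for p :: "'i \<Rightarrow> 'a \<times> real" and v
    proof (cases "S = {}")
      case True
      then show ?thesis by (simp add: weighted_sup_def bot_ennreal)
    next
      case False
      then obtain a where "\<And>b. b \<in> S \<Longrightarrow> log_height I p b \<le> log_height I p a"
        using continuous_attains_sup[OF S _ continuous_log_height] by blast
      then have "weighted_sup I S p v \<le> ennreal (exp (log_height I p a))"
        unfolding weighted_sup_def by (intro Sup_least) (auto intro!: ennreal_leI)
      then show ?thesis by (auto simp: top_unique)
    qed
    then have "{x \<in> space ?M. y \<le> (case x of (p, v) \<Rightarrow> weighted_sup I S p v)} = {}"
      using 2 by (auto simp: top_unique)
    then show ?thesis by (metis sets.empty_sets)
  next
    case (3 r)
    \<comment> \<open>Both requirements on the weights, a given mixed point and a minimal height, in one continuous function.\<close>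
    define h where "h p v a = max (norm (mixed_point I p a - v)) (ln r - log_height I p a)"
      for p :: "'i \<Rightarrow> 'a \<times> real" and v a
    have cont: "continuous_on S (h p v)" for p v
      unfolding h_def by (intro continuous_intros continuous_mixed_point continuous_log_height)
    have "ennreal r \<le> weighted_sup I S p v \<longleftrightarrow> (\<forall>k::nat. \<exists>a\<in>D. h p v a < 1 / real (Suc k))" for p v
      by (simp only: weighted_sup_ge_iff[OF S 3(2)] compact_nonpos_iff_dense[OF S cont D(2,3), symmetric]) (simp only: h_def)
    then have "{x \<in> space ?M. y \<le> (case x of (p, v) \<Rightarrow> weighted_sup I S p v)}
        = {x \<in> space ?M. \<forall>k::nat. \<exists>a\<in>D. h (fst x) (snd x) a < 1 / real (Suc k)}"
      using 3(1) by (simp add: case_prod_beta)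
    also have "\<dots> \<in> sets ?M"
    proof -
      have [measurable]: "(\<lambda>x. h (fst x) (snd x) a) \<in> borel_measurable ?M" for a
        unfolding h_def mixed_point_def log_height_def by measurable
      show ?thesis using D(1) by measurable
    qed
    finally show ?thesis .
  qed
qed

lemma nn_integral_layer_cake:
  fixes f :: "real \<Rightarrow> ennreal"
  assumes [measurable]: "f \<in> borel_measurable borel"
  shows "(\<integral>\<^sup>+s. f s \<partial>lborel) = (\<integral>\<^sup>+t. indicator {0<..} t * vol {s. ennreal t < f s} \<partial>lborel)"
proof -
  have f: "f s = (\<integral>\<^sup>+t. indicator {0<..} t * indicator {s. ennreal t < f s} s \<partial>lborel)" for s
  proof (cases "f s")
    case (real r)
    have "(\<integral>\<^sup>+t. indicator {0<..} t * indicator {s. ennreal t < f s} s \<partial>lborel) = (\<integral>\<^sup>+t. indicator {0<..<r} t \<partial>lborel)"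
      by (intro nn_integral_cong) (auto simp: indicator_def real ennreal_less_iff)
    also have "\<dots> = ennreal r" by (subst nn_integral_indicator) (use real in auto)
    finally show ?thesis using real by simp
  next
    case top
    have "(\<integral>\<^sup>+t. indicator {0<..} t * indicator {s. ennreal t < f s} s \<partial>lborel) = (\<integral>\<^sup>+t. indicator {0::real<..} t \<partial>lborel)"
      by (intro nn_integral_cong) (auto simp: indicator_def top)
    also have "\<dots> = vol {0::real<..}" by (subst nn_integral_indicator) auto
    also have "\<dots> = \<infinity>"
    proof (rule ccontr)
      assume fin: "vol {0::real<..} \<noteq> \<infinity>"
      obtain c where c: "vol {0::real<..} = ennreal c" "0 \<le> c"
        using fin by (cases "vol {0::real<..}") auto
      have "vol {0<..<c + 1} \<le> vol {0::real<..}" by (intro emeasure_mono) auto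
      then show False using c by (simp add: ennreal_le_iff)
    qed
    finally show ?thesis using top by simp
  qed
  have "(\<integral>\<^sup>+s. f s \<partial>lborel) = (\<integral>\<^sup>+s. (\<integral>\<^sup>+t. indicator {0<..} t * indicator {s. ennreal t < f s} s \<partial>lborel) \<partial>lborel)"
    by (rule nn_integral_cong) (rule f)
  also have "\<dots> = (\<integral>\<^sup>+t. (\<integral>\<^sup>+s. indicator {0<..} t * indicator {s. ennreal t < f s} s \<partial>lborel) \<partial>lborel)"
    by (rule lborel_pair.Fubini') auto
  also have "\<dots> = (\<integral>\<^sup>+t. indicator {0<..} t * vol {s. ennreal t < f s} \<partial>lborel)"
    by (intro nn_integral_cong, subst nn_integral_cmult) auto
  finally show ?thesis .
qed

lemma weighted_sup_borel:
  fixes S :: "('i::countable \<Rightarrow> real) set" and p :: "'i \<Rightarrow> 'a::euclidean_space \<times> real"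
  assumes "compact S"
  shows "weighted_sup I S p \<in> borel_measurable borel"
proof -
  have eq: "weighted_sup I S p = (\<lambda>v. weighted_sup I S (restrict p I) v)"
    by (simp add: weighted_sup_def mixed_point_def log_height_def fun_eq_iff cong: sum.cong)
  have "(\<lambda>v. (restrict p I, v)) \<in> measurable borel (PiM I (\<lambda>_. lborel :: ('a \<times> real) measure) \<Otimes>\<^sub>M lborel)"
    by (intro measurable_Pair) (auto simp: space_PiM)
  from measurable_compose[OF this weighted_sup_measurable[OF assms]] show ?thesis unfolding eq by simp
qed

lemma weighted_sup_integral_measurable:
  fixes S :: "('i::countable \<Rightarrow> real) set"
  assumes "compact S"
  shows "weighted_sup_integral I S \<in> borel_measurable (PiM I (\<lambda>_. lborel :: ('a::euclidean_space \<times> real) measure))"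
  unfolding weighted_sup_integral_def[abs_def]
  by (rule sigma_finite_measure.borel_measurable_nn_integral[OF _ weighted_sup_measurable[OF assms]]) unfold_locales

lemma weighted_sup_integral_by_lines:
  fixes S :: "('i::countable \<Rightarrow> real) set" and p :: "'i \<Rightarrow> 'a::euclidean_space \<times> real"
  assumes S: "compact S" and u: "norm u = 1"
  shows "weighted_sup_integral I S p = (\<integral>\<^sup>+x. indicator (unit_slab u) x * (\<integral>\<^sup>+t. weighted_sup I S p (x + t *\<^sub>R u) \<partial>lborel) \<partial>lborel)"
  unfolding weighted_sup_integral_def by (rule nn_integral_by_lines[OF u weighted_sup_borel[OF S]])

lemma weighted_sup_line_level_convex:
  fixes p :: "'i \<Rightarrow> 'a::real_vector \<times> real"
  assumes S: "coefficient_convex S" and "0 < t"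
  shows "convex {s. ennreal t < weighted_sup I S p (x + s *\<^sub>R u)}"
proof (rule convexI)
  fix s s' c d :: real
  assume "s \<in> {s. ennreal t < weighted_sup I S p (x + s *\<^sub>R u)}" "s' \<in> {s. ennreal t < weighted_sup I S p (x + s *\<^sub>R u)}"
    and cd: "0 \<le> c" "0 \<le> d" "c + d = 1"
  then obtain a b where a: "a \<in> S" "mixed_point I p a = x + s *\<^sub>R u" "t < exp (log_height I p a)"
    and b: "b \<in> S" "mixed_point I p b = x + s' *\<^sub>R u" "t < exp (log_height I p b)"
    using \<open>0 < t\<close> by (auto simp: weighted_sup_greater_iff ennreal_less_iff)
  let ?m = "\<lambda>i. c * a i + d * b i"
  have mS: "?m \<in> S" using S a(1) b(1) cd by (auto simp: coefficient_convex_def)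
  have "mixed_point I p ?m = c *\<^sub>R mixed_point I p a + d *\<^sub>R mixed_point I p b"
    by (simp add: mixed_point_def scaleR_sum_right scaleR_add_left sum.distrib)
  also have "\<dots> = (c + d) *\<^sub>R x + (c * s + d * s') *\<^sub>R u" unfolding a(2) b(2) by (simp add: algebra_simps)
  finally have mp: "mixed_point I p ?m = x + (c *\<^sub>R s + d *\<^sub>R s') *\<^sub>R u" using cd by simp
  have "log_height I p ?m = c * log_height I p a + d * log_height I p b"
    by (simp add: log_height_def sum_distrib_left distrib_right sum.distrib mult.assoc)
  moreover have "ln t < log_height I p a" "ln t < log_height I p b"
    using a(3) b(3) \<open>0 < t\<close> by (metis exp_gt_zero ln_exp ln_less_cancel_iff)+
  then have "- (c * log_height I p a + d * log_height I p b) < - ln t"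
    using convex_bound_lt[of "- log_height I p a" "- ln t" "- log_height I p b" c d] cd by simp
  ultimately have "ln t < log_height I p ?m" by linarith
  then have "exp (ln t) < exp (log_height I p ?m)" by (rule exp_less_mono)
  then have "t < exp (log_height I p ?m)" using \<open>0 < t\<close> by (simp only: exp_ln)
  then show "c *\<^sub>R s + d *\<^sub>R s' \<in> {s. ennreal t < weighted_sup I S p (x + s *\<^sub>R u)}"
    using mS mp \<open>0 < t\<close> by (auto simp: weighted_sup_greater_iff ennreal_less_iff)
qed

text \<open>
  Every point moves by \<open>e i *\<^sub>R u\<close>, in two steps from \<open>p\<close> over \<open>m\<close> to \<open>q\<close>.  A choice of weights \<open>a\<close>
  then moves by the fixed multiple \<open>E a\<close> of \<open>u\<close> in each step.  So two choices of weights that reach a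
  level on the same line at distance \<open>d\<close> for \<open>m\<close> reach it for \<open>p\<close> and for \<open>q\<close> at
  signed distances whose mean is \<open>d\<close>.
  Hence the length of the superlevel set on the line is at most the mean of the lengths for \<open>p\<close> and \<open>q\<close>,
  and integration over levels and lines preserves this inequality.
\<close>

lemma weighted_sup_integral_shadow_midpoint:
  fixes S :: "('i::countable \<Rightarrow> real) set" and p q :: "'i \<Rightarrow> 'a::euclidean_space \<times> real"
  assumes S: "compact S" "coefficient_convex S" and u: "norm u = 1"
    and pq: "\<forall>i\<in>I. \<exists>s. q i = p i + s *\<^sub>R (u, 0)"
    and m: "\<And>i. i \<in> I \<Longrightarrow> m i = (1/2) *\<^sub>R (p i + q i)"
  shows "2 * weighted_sup_integral I S m \<le> weighted_sup_integral I S p + weighted_sup_integral I S q"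
proof -
  obtain e where e: "\<And>i. i \<in> I \<Longrightarrow> q i = p i + e i *\<^sub>R (u, 0)" using pq by metis
  have snds: "log_height I q = log_height I p" "log_height I m = log_height I p"
    by (auto simp: log_height_def e m fun_eq_iff intro!: sum.cong)
  define E where "E a = (\<Sum>i\<in>I. a i * e i) / 2" for a
  have fp: "mixed_point I m a = mixed_point I p a + E a *\<^sub>R u" for a
    unfolding mixed_point_def E_def sum_divide_distrib scaleR_sum_left sum.distrib[symmetric]
    by (intro sum.cong) (auto simp: e m algebra_simps simp flip: scaleR_add_left)
  have fq: "mixed_point I q a = mixed_point I m a + E a *\<^sub>R u" for a
    unfolding mixed_point_def E_def sum_divide_distrib scaleR_sum_left sum.distrib[symmetric]
    by (intro sum.cong) (auto simp: e m algebra_simps simp flip: scaleR_add_left)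
  have fp': "mixed_point I p a = x + (s - E a) *\<^sub>R u" if "mixed_point I m a = x + s *\<^sub>R u" for a x s
    using fp[of a] that by (simp add: algebra_simps)
  have fq': "mixed_point I q a = x + (s + E a) *\<^sub>R u" if "mixed_point I m a = x + s *\<^sub>R u" for a x s
    using fq[of a] that by (simp add: algebra_simps)
  let ?L = "\<lambda>p x t. {s. ennreal t < weighted_sup I S p (x + s *\<^sub>R u)}"
  note weighted_sup_borel[OF S(1), measurable]
  have Lm: "?L p x t \<in> sets borel" for p :: "'i \<Rightarrow> 'a \<times> real" and x t by measurable
  have lev: "2 * vol (?L m x t) \<le> vol (?L p x t) + vol (?L q x t)" if t: "0 < t" for x t
  proof (cases "vol (?L p x t) < \<infinity> \<and> vol (?L q x t) < \<infinity>")
    case fin: True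
    let ?P = "measure lborel (?L p x t)" and ?Q = "measure lborel (?L q x t)"
    have "s' - s \<le> (?P + ?Q) / 2" if ss: "s \<in> ?L m x t" "s' \<in> ?L m x t" for s s'
    proof -
      obtain a b where a: "a \<in> S" "mixed_point I m a = x + s *\<^sub>R u" "ennreal t < exp (log_height I p a)"
        and b: "b \<in> S" "mixed_point I m b = x + s' *\<^sub>R u" "ennreal t < exp (log_height I p b)"
        using ss by (auto simp: weighted_sup_greater_iff snds)
      have "s - E a \<in> ?L p x t" "s' - E b \<in> ?L p x t"
        using a b fp' by (auto simp: weighted_sup_greater_iff)
      then have "(s' - E b) - (s - E a) \<le> ?P"
        using fin by (intro convex_real_diff_le_measure weighted_sup_line_level_convex S t Lm) auto
      moreover have "s + E a \<in> ?L q x t" "s' + E b \<in> ?L q x t"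
        using a b fq' by (auto simp: weighted_sup_greater_iff snds)
      then have "(s' + E b) - (s + E a) \<le> ?Q"
        using fin by (intro convex_real_diff_le_measure weighted_sup_line_level_convex S t Lm) auto
      ultimately show ?thesis by simp
    qed
    then have "vol (?L m x t) \<le> ennreal ((?P + ?Q) / 2)" by (rule emeasure_real_le_if_diff_le)
    then have "2 * vol (?L m x t) \<le> 2 * ennreal ((?P + ?Q) / 2)" by (intro mult_left_mono) auto
    also have "\<dots> = ennreal (2 * ((?P + ?Q) / 2))" by (subst ennreal_mult) auto
    also have "\<dots> = ennreal (?P + ?Q)" by (rule arg_cong[where f=ennreal]) simp
    also have "\<dots> = vol (?L p x t) + vol (?L q x t)"
      using fin by (simp add: emeasure_eq_ennreal_measure less_top)
    finally show ?thesis .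
  next
    case False
    then show ?thesis by (auto simp: not_less top_unique)
  qed
  have line: "2 * (\<integral>\<^sup>+s. weighted_sup I S m (x + s *\<^sub>R u) \<partial>lborel)
    \<le> (\<integral>\<^sup>+s. weighted_sup I S p (x + s *\<^sub>R u) \<partial>lborel) + (\<integral>\<^sup>+s. weighted_sup I S q (x + s *\<^sub>R u) \<partial>lborel)" for x
  proof -
    have lay: "(\<integral>\<^sup>+s. weighted_sup I S p (x + s *\<^sub>R u) \<partial>lborel) = (\<integral>\<^sup>+t. indicator {0<..} t * vol (?L p x t) \<partial>lborel)"
      for p :: "'i \<Rightarrow> 'a \<times> real" by (rule nn_integral_layer_cake) measurable
    have [measurable]: "(\<lambda>t. vol (?L p x t)) \<in> borel_measurable borel" for p :: "'i \<Rightarrow> 'a \<times> real"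
    proof -
      have "vol (?L p x t) = (\<integral>\<^sup>+s. (if ennreal t < weighted_sup I S p (x + s *\<^sub>R u) then 1 else 0) \<partial>lborel)" for t
      proof -
        have "vol (?L p x t) = (\<integral>\<^sup>+s. indicator (?L p x t) s \<partial>lborel)"
          by (rule nn_integral_indicator[symmetric]) (use Lm in simp)
        then show ?thesis by (simp add: indicator_def of_bool_def)
      qed
      then show ?thesis by simp
    qed
    have "2 * (\<integral>\<^sup>+s. weighted_sup I S m (x + s *\<^sub>R u) \<partial>lborel) = (\<integral>\<^sup>+t. indicator {0<..} t * (2 * vol (?L m x t)) \<partial>lborel)"
      unfolding lay by (subst nn_integral_cmult[symmetric]) (auto simp: mult.left_commute)
    also have "\<dots> \<le> (\<integral>\<^sup>+t. indicator {0<..} t * (vol (?L p x t) + vol (?L q x t)) \<partial>lborel)"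
      using lev by (intro nn_integral_mono) (auto simp: indicator_def)
    also have "\<dots> = (\<integral>\<^sup>+s. weighted_sup I S p (x + s *\<^sub>R u) \<partial>lborel) + (\<integral>\<^sup>+s. weighted_sup I S q (x + s *\<^sub>R u) \<partial>lborel)"
      unfolding lay by (subst nn_integral_add[symmetric]) (auto simp: distrib_left)
    finally show ?thesis .
  qed
  have "2 * weighted_sup_integral I S m = (\<integral>\<^sup>+x. indicator (unit_slab u) x * (2 * (\<integral>\<^sup>+s. weighted_sup I S m (x + s *\<^sub>R u) \<partial>lborel)) \<partial>lborel)"
    unfolding weighted_sup_integral_by_lines[OF S(1) u] by (subst nn_integral_cmult[symmetric]) (auto simp: mult.left_commute)
  also have "\<dots> \<le> (\<integral>\<^sup>+x. indicator (unit_slab u) x * ((\<integral>\<^sup>+s. weighted_sup I S p (x + s *\<^sub>R u) \<partial>lborel) + (\<integral>\<^sup>+s. weighted_sup I S q (x + s *\<^sub>R u) \<partial>lborel)) \<partial>lborel)"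
    by (intro nn_integral_mono mult_left_mono line) auto
  also have "\<dots> = weighted_sup_integral I S p + weighted_sup_integral I S q"
    unfolding weighted_sup_integral_by_lines[OF S(1) u] by (subst nn_integral_add[symmetric]) (auto simp: distrib_left)
  finally show ?thesis .
qed

text \<open>
  On each line parallel to \<open>u\<close>, reflecting the points reflects the function.
\<close>

lemma weighted_sup_integral_mirror:
  fixes S :: "('i::countable \<Rightarrow> real) set" and p :: "'i \<Rightarrow> 'a::euclidean_space \<times> real"
  assumes S: "compact S" and u: "norm u = 1"
  shows "weighted_sup_integral I S (\<lambda>i. mirror_point u (p i)) = weighted_sup_integral I S p"
proof -
  let ?r = "\<lambda>x::'a. x - (2 * (x \<bullet> u)) *\<^sub>R u"
  have u1: "u \<bullet> u = 1" using u by (simp add: norm_eq_1)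
  have inv: "?r (?r x) = x" for x using u1 by (simp add: inner_diff_left algebra_simps)
  have mp: "mixed_point I (\<lambda>i. mirror_point u (p i)) a = ?r (mixed_point I p a)" for a
    by (simp add: mixed_point_def mirror_point_def inner_sum_left scaleR_diff_right sum_subtractf
        scaleR_sum_left sum_distrib_left mult.left_commute)
  have lh: "log_height I (\<lambda>i. mirror_point u (p i)) = log_height I p"
    by (simp add: log_height_def mirror_point_def fun_eq_iff)
  have "?r y = v \<longleftrightarrow> y = ?r v" for y v using inv by metis
  then have refl: "weighted_sup I S (\<lambda>i. mirror_point u (p i)) v = weighted_sup I S p (?r v)" for v
    by (simp add: weighted_sup_def mp lh)
  note weighted_sup_borel[OF S, measurable]
  have "(\<integral>\<^sup>+t. weighted_sup I S (\<lambda>i. mirror_point u (p i)) (x + t *\<^sub>R u) \<partial>lborel) = (\<integral>\<^sup>+t. weighted_sup I S p (x + t *\<^sub>R u) \<partial>lborel)" for x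
  proof -
    have "?r (x + t *\<^sub>R u) = x + (- 2 * (x \<bullet> u) + (-1) * t) *\<^sub>R u" for t
      using u1 by (simp add: inner_add_left algebra_simps) (metis mult_2_right scaleR_add_left)
    then have "(\<integral>\<^sup>+t. weighted_sup I S (\<lambda>i. mirror_point u (p i)) (x + t *\<^sub>R u) \<partial>lborel)
      = (\<integral>\<^sup>+t. weighted_sup I S p (x + (- 2 * (x \<bullet> u) + (-1) * t) *\<^sub>R u) \<partial>lborel)" by (simp only: refl)
    also have "\<dots> = (\<integral>\<^sup>+t. weighted_sup I S p (x + t *\<^sub>R u) \<partial>lborel)"
      using nn_integral_real_affine[of "\<lambda>t. weighted_sup I S p (x + t *\<^sub>R u)" "-1" "- 2 * (x \<bullet> u)"] by simp
    finally show ?thesis .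
  qed
  then show ?thesis unfolding weighted_sup_integral_by_lines[OF S u] by simp
qed

text \<open>
  Reflecting \<open>q\<close> does not change the integral, and the points of the mirror image still lie on the same
  lines as those of \<open>p\<close>.
\<close>

lemma weighted_sup_sublevel_mirror_midpoint_closed:
  fixes S :: "('i::countable \<Rightarrow> real) set" and u :: "'a::euclidean_space"
  assumes S: "compact S" "coefficient_convex S" and u: "norm u = 1"
  shows "mirror_midpoint_closed I u {p \<in> space (lborels I). weighted_sup_integral I S p \<le> c}"
  unfolding mirror_midpoint_closed_def
proof (intro ballI impI)
  fix p q :: "'i \<Rightarrow> 'a \<times> real"
  assume p: "p \<in> {p \<in> space (lborels I). weighted_sup_integral I S p \<le> c}"
    and q: "q \<in> {p \<in> space (lborels I). weighted_sup_integral I S p \<le> c}"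
    and pq: "\<forall>i\<in>I. \<exists>s. q i = p i + s *\<^sub>R (u, 0)"
  let ?m = "\<lambda>i\<in>I. (1/2) *\<^sub>R (p i + mirror_point u (q i))"
  have "2 * weighted_sup_integral I S ?m \<le> weighted_sup_integral I S p + weighted_sup_integral I S (\<lambda>i. mirror_point u (q i))"
  proof (rule weighted_sup_integral_shadow_midpoint[OF S u])
    show "\<forall>i\<in>I. \<exists>s. mirror_point u (q i) = p i + s *\<^sub>R (u, 0)"
    proof
      fix i assume "i \<in> I"
      then obtain s where "q i = p i + s *\<^sub>R (u, 0)" using pq by blast
      then have "mirror_point u (q i) = p i + (s - 2 * (fst (q i) \<bullet> u)) *\<^sub>R (u, 0)"
        by (auto simp: mirror_point_def prod_eq_iff algebra_simps)
      then show "\<exists>s. mirror_point u (q i) = p i + s *\<^sub>R (u, 0)" by blast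
    qed
  qed simp
  also have "\<dots> = weighted_sup_integral I S p + weighted_sup_integral I S q" by (simp add: weighted_sup_integral_mirror[OF S(1) u])
  also have "\<dots> \<le> c + c" using p q by (intro add_mono) auto
  also have "c + c = 2 * c" by (simp add: mult_2)
  finally have "weighted_sup_integral I S ?m \<le> c" by (subst (asm) ennreal_mult_le_mult_iff) auto
  then show "?m \<in> {p \<in> space (lborels I). weighted_sup_integral I S p \<le> c}" by (auto simp: space_PiM)
qed

section \<open>Sup-convolution of two stochastic approximations\<close>

text \<open>
  The weights are attached to the indices, so that coinciding points need no separate treatment.
\<close>

lemma convex_hull_finite_image:
  fixes f :: "'i \<Rightarrow> 'a::real_vector"
  assumes J: "finite J"
  shows "convex hull (f ` J) = {x. \<exists>a::'i \<Rightarrow> real. (\<forall>j\<in>J. 0 \<le> a j) \<and> sum a J = 1 \<and> x = (\<Sum>j\<in>J. a j *\<^sub>R f j)}" (is "_ = ?H")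
proof
  show "convex hull (f ` J) \<subseteq> ?H"
  proof (rule hull_minimal)
    show "f ` J \<subseteq> ?H"
    proof clarify
      fix j assume j: "j \<in> J"
      show "\<exists>a::'i \<Rightarrow> real. (\<forall>j\<in>J. 0 \<le> a j) \<and> sum a J = 1 \<and> f j = (\<Sum>j\<in>J. a j *\<^sub>R f j)"
      proof (intro exI[of _ "\<lambda>k. if k = j then 1 else 0"] conjI)
        show "f j = (\<Sum>k\<in>J. (if k = j then 1 else 0) *\<^sub>R f k)"
          using j J by (simp add: if_distrib[of "\<lambda>c. c *\<^sub>R _"] cong: if_cong)
      qed (use j J in auto)
    qed
    show "convex ?H"
    proof (rule convexI, clarify)
      fix a b :: "'i \<Rightarrow> real" and s t :: real
      assume *: "0 \<le> s" "0 \<le> t" "s + t = 1" "\<forall>j\<in>J. 0 \<le> a j" "sum a J = 1" "\<forall>j\<in>J. 0 \<le> b j" "sum b J = 1"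
      show "\<exists>c::'i \<Rightarrow> real. (\<forall>j\<in>J. 0 \<le> c j) \<and> sum c J = 1 \<and>
        s *\<^sub>R (\<Sum>j\<in>J. a j *\<^sub>R f j) + t *\<^sub>R (\<Sum>j\<in>J. b j *\<^sub>R f j) = (\<Sum>j\<in>J. c j *\<^sub>R f j)"
      proof (intro exI[of _ "\<lambda>j. s * a j + t * b j"] conjI)
        have "(\<Sum>j\<in>J. s * a j + t * b j) = s * sum a J + t * sum b J" by (simp add: sum.distrib sum_distrib_left)
        then show "(\<Sum>j\<in>J. s * a j + t * b j) = 1" using * by simp
      qed (use * in \<open>auto simp: scaleR_sum_right scaleR_add_left sum.distrib\<close>)
    qed
  qed
next
  show "?H \<subseteq> convex hull (f ` J)"
  proof clarify
    fix a :: "'i \<Rightarrow> real" assume "\<forall>j\<in>J. 0 \<le> a j" "sum a J = 1"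
    then show "(\<Sum>j\<in>J. a j *\<^sub>R f j) \<in> convex hull (f ` J)"
      by (intro convex_sum[OF J convex_convex_hull]) (auto intro: hull_inc)
  qed
qed

text \<open>
  The hull of finitely many points is compact, and so are its vertical sections.
\<close>

lemma log_hull_vertical_attains:
  fixes p :: "nat \<Rightarrow> 'a::euclidean_space \<times> real"
  assumes x: "x \<in> convex hull ((\<lambda>i. fst (p i)) ` {1..N})"
  shows "bdd_above {z. (x, z) \<in> log_hull N p}" "Sup {z. (x, z) \<in> log_hull N p} \<in> {z. (x, z) \<in> log_hull N p}"
proof -
  have "compact (log_hull N p)" unfolding log_hull_def by (intro finite_imp_compact_convex_hull) auto
  then have "compact (snd ` (log_hull N p \<inter> {x} \<times> UNIV))"
    by (intro compact_continuous_image compact_Int_closed closed_Times continuous_intros) auto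
  also have "snd ` (log_hull N p \<inter> {x} \<times> UNIV) = {z. (x, z) \<in> log_hull N p}" by force
  finally have K: "compact {z. (x, z) \<in> log_hull N p}" .
  obtain a where a: "\<forall>i\<in>{1..N}. 0 \<le> a i" "sum a {1..N} = 1" "x = (\<Sum>i\<in>{1..N}. a i *\<^sub>R fst (p i))"
    using x unfolding convex_hull_finite_image[OF finite_atLeastAtMost] by blast
  have "(x, \<Sum>i\<in>{1..N}. a i * ln (snd (p i))) \<in> log_hull N p"
    unfolding log_hull_def convex_hull_finite_image[OF finite_atLeastAtMost]
    using a by (auto intro!: exI[of _ a] simp: sum_prod)
  then have ne: "{z. (x, z) \<in> log_hull N p} \<noteq> {}" by blast
  show bdd: "bdd_above {z. (x, z) \<in> log_hull N p}" using K by (simp add: compact_imp_bounded bounded_imp_bdd_above)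
  show "Sup {z. (x, z) \<in> log_hull N p} \<in> {z. (x, z) \<in> log_hull N p}"
    by (rule closed_contains_Sup[OF ne bdd compact_imp_closed[OF K]])
qed

lemma stoch_approx_ge:
  fixes p :: "nat \<Rightarrow> 'a::euclidean_space \<times> real"
  assumes a: "\<And>i. i \<in> {1..N} \<Longrightarrow> 0 \<le> a i" "sum a {1..N} = 1"
  shows "exp (log_height {1..N} p a) \<le> stoch_approx N p (mixed_point {1..N} p a)"
proof -
  let ?x = "mixed_point {1..N} p a"
  have x: "?x \<in> convex hull ((\<lambda>i. fst (p i)) ` {1..N})"
    unfolding convex_hull_finite_image[OF finite_atLeastAtMost] mixed_point_def
    by (intro CollectI exI[of _ a] conjI refl ballI a)
  have "(?x, log_height {1..N} p a) \<in> log_hull N p"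
    unfolding log_hull_def convex_hull_finite_image[OF finite_atLeastAtMost] mixed_point_def log_height_def
    using a by (auto intro!: exI[of _ a] simp: sum_prod)
  then have "log_height {1..N} p a \<le> Sup {z. (?x, z) \<in> log_hull N p}"
    by (intro cSup_upper log_hull_vertical_attains(1) x) simp
  then show ?thesis using x by (simp add: stoch_approx_def)
qed

lemma stoch_approx_attained:
  fixes p :: "nat \<Rightarrow> 'a::euclidean_space \<times> real"
  assumes x: "stoch_approx N p x \<noteq> 0"
  obtains a where "\<And>i. i \<in> {1..N} \<Longrightarrow> 0 \<le> a i" "sum a {1..N} = 1" "mixed_point {1..N} p a = x"
    "stoch_approx N p x = exp (log_height {1..N} p a)"
proof -
  have x: "x \<in> convex hull ((\<lambda>i. fst (p i)) ` {1..N})" using x by (auto simp: stoch_approx_def split: if_splits)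
  have "(x, Sup {z. (x, z) \<in> log_hull N p}) \<in> log_hull N p"
    using log_hull_vertical_attains(2)[OF x] by simp
  then obtain a where a: "\<forall>i\<in>{1..N}. 0 \<le> a i" "sum a {1..N} = 1"
    "(x, Sup {z. (x, z) \<in> log_hull N p}) = (\<Sum>i\<in>{1..N}. a i *\<^sub>R (fst (p i), ln (snd (p i))))"
    unfolding log_hull_def convex_hull_finite_image[OF finite_atLeastAtMost] by auto
  then have eq: "mixed_point {1..N} p a = x" "Sup {z. (x, z) \<in> log_hull N p} = log_height {1..N} p a"
    by (auto simp: sum_prod mixed_point_def log_height_def)
  show thesis by (rule that[of a]) (use a(1,2) eq x in \<open>auto simp: stoch_approx_def\<close>)
qed

text \<open>
  Weights of total mass \<open>lam\<close> on the points of the first sample and \<open>1 - lam\<close> on those of the second.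
  Bounding each weight by \<open>1\<close> displays the set as a closed part of a cube.
\<close>

definition split_weights :: "nat \<Rightarrow> nat \<Rightarrow> real \<Rightarrow> (nat + nat \<Rightarrow> real) set" where
  "split_weights N M lam = {a. (\<forall>k. 0 \<le> a k \<and> a k \<le> 1) \<and> (\<forall>k. k \<notin> {1..N} <+> {1..M} \<longrightarrow> a k = 0) \<and>
     (\<Sum>i\<in>{1..N}. a (Inl i)) = lam \<and> (\<Sum>j\<in>{1..M}. a (Inr j)) = 1 - lam}"

lemma coefficient_convex_split_weights: "coefficient_convex (split_weights N M lam)"
  unfolding coefficient_convex_def
proof (intro ballI allI impI)
  fix a b and s t :: real
  assume *: "a \<in> split_weights N M lam" "b \<in> split_weights N M lam" "0 \<le> s" "0 \<le> t" "s + t = 1"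
  have "s * a k + t * b k \<le> 1" for k
    using * convex_bound_le[of "a k" 1 "b k" s t] by (auto simp: split_weights_def)
  moreover have "(\<Sum>i\<in>{1..N}. s * a (Inl i) + t * b (Inl i)) = (s + t) * lam"
    using *(1,2) by (simp add: split_weights_def sum.distrib sum_distrib_left[symmetric] distrib_right)
  moreover have "(\<Sum>i\<in>{1..M}. s * a (Inr i) + t * b (Inr i)) = (s + t) * (1 - lam)"
    using *(1,2) by (simp add: split_weights_def sum.distrib sum_distrib_left[symmetric] distrib_right)
  ultimately show "(\<lambda>i. s * a i + t * b i) \<in> split_weights N M lam"
    using * by (auto simp: split_weights_def)
qed

lemma compact_split_weights: "compact (split_weights N M lam)"
proof -
  have "compactin (product_topology (\<lambda>_. euclidean) UNIV) (PiE UNIV (\<lambda>_::nat + nat. {0..1::real}))"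
    by (simp add: compactin_PiE compactin_euclidean_iff)
  then have box: "compact (PiE UNIV (\<lambda>_::nat + nat. {0..1::real}))"
    by (simp add: euclidean_product_topology compactin_euclidean_iff)
  have coord: "continuous_on UNIV (\<lambda>a::nat + nat \<Rightarrow> real. a k)" for k
    by (rule continuous_on_product_coordinates)
  have "closed ((\<Inter>k\<in>- ({1..N} <+> {1..M}). {a::nat + nat \<Rightarrow> real. a k = 0}) \<inter>
     {a. (\<Sum>i\<in>{1..N}. a (Inl i)) = lam} \<inter> {a. (\<Sum>j\<in>{1..M}. a (Inr j)) = 1 - lam})"
    by (intro closed_Int closed_INT ballI closed_Collect_eq continuous_intros coord)
  from compact_Int_closed[OF box this] show ?thesis
    by (rule back_subst[of compact]) (auto simp: split_weights_def PiE_def Pi_def)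
qed

text \<open>
  The suprema defining the two hull functions are attained, so the supremum over decompositions of \<open>v\<close>
  and the suprema over weights merge into one: weights \<open>a\<close> and \<open>b\<close> for the two samples combine to the
  weights \<open>lam * a\<close> and \<open>(1 - lam) * b\<close> of the joint sample.
\<close>

lemma sup_conv_stoch_approx:
  fixes p q :: "nat \<Rightarrow> 'a::euclidean_space \<times> real"
  assumes lam: "0 < lam" "lam < 1"
  shows "sup_conv lam (stoch_approx N p) (stoch_approx M q) v
    = weighted_sup ({1..N} <+> {1..M}) (split_weights N M lam) (case_sum p q) v"
proof (rule antisym)
  let ?I = "{1..N} <+> {1..M}" and ?f = "stoch_approx N p" and ?g = "stoch_approx M q"
  have mp: "mixed_point ?I (case_sum p q) c = mixed_point {1..N} p (\<lambda>i. c (Inl i)) + mixed_point {1..M} q (\<lambda>j. c (Inr j))" for c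
    by (simp add: mixed_point_def sum.Plus)
  have lh: "log_height ?I (case_sum p q) c = log_height {1..N} p (\<lambda>i. c (Inl i)) + log_height {1..M} q (\<lambda>j. c (Inr j))" for c
    by (simp add: log_height_def sum.Plus)
  have mscale: "mixed_point J r (\<lambda>i. t * a i) = t *\<^sub>R mixed_point J r a" for J t a and r :: "nat \<Rightarrow> 'a \<times> real"
    by (simp add: mixed_point_def scaleR_sum_right)
  have hscale: "log_height J r (\<lambda>i. t * a i) = t * log_height J r a" for J t a and r :: "nat \<Rightarrow> 'a \<times> real"
    by (simp add: log_height_def sum_distrib_left mult.assoc)
  show "sup_conv lam ?f ?g v \<le> weighted_sup ?I (split_weights N M lam) (case_sum p q) v"
    unfolding sup_conv_def
  proof (intro Sup_least, clarify)
    fix x y assume v: "v = lam *\<^sub>R x + (1 - lam) *\<^sub>R y"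
    show "ennreal (?f x powr lam * ?g y powr (1 - lam)) \<le> weighted_sup ?I (split_weights N M lam) (case_sum p q) (lam *\<^sub>R x + (1 - lam) *\<^sub>R y)"
    proof (cases "?f x = 0 \<or> ?g y = 0")
      case False
      obtain a where a: "\<And>i. i \<in> {1..N} \<Longrightarrow> 0 \<le> a i" "sum a {1..N} = 1" "mixed_point {1..N} p a = x"
        "?f x = exp (log_height {1..N} p a)" using stoch_approx_attained[of N p x] False by blast
      obtain b where b: "\<And>i. i \<in> {1..M} \<Longrightarrow> 0 \<le> b i" "sum b {1..M} = 1" "mixed_point {1..M} q b = y"
        "?g y = exp (log_height {1..M} q b)" using stoch_approx_attained[of M q y] False by blast
      define c where "c = (\<lambda>k. case k of Inl i \<Rightarrow> if i \<in> {1..N} then lam * a i else 0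
         | Inr j \<Rightarrow> if j \<in> {1..M} then (1 - lam) * b j else 0)"
      have restr: "mixed_point J r (\<lambda>i. if i \<in> J then h i else 0) = mixed_point J r h"
        "log_height J r (\<lambda>i. if i \<in> J then h i else 0) = log_height J r h" for J h and r :: "nat \<Rightarrow> 'a \<times> real"
        by (auto simp: mixed_point_def log_height_def intro!: sum.cong)
      have a1: "a i \<le> 1" if "i \<in> {1..N}" for i using member_le_sum[OF that, of a] a(1,2) by auto
      have b1: "b i \<le> 1" if "i \<in> {1..M}" for i using member_le_sum[OF that, of b] b(1,2) by auto
      have "c \<in> split_weights N M lam"
        unfolding split_weights_def mem_Collect_eq
      proof (intro conjI allI impI)
        fix k
        show "0 \<le> c k" using a(1) b(1) lam by (auto simp: c_def split: sum.split)
        show "c k \<le> 1" using a1 b1 a(1) b(1) lam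
          by (auto simp: c_def split: sum.split intro!: mult_le_one)
        show "c k = 0" if "k \<notin> {1..N} <+> {1..M}"
          using that by (auto simp: c_def split: sum.split)
      next
        have "(\<Sum>i\<in>{1..N}. c (Inl i)) = (\<Sum>i\<in>{1..N}. lam * a i)" by (intro sum.cong) (auto simp: c_def)
        then show "(\<Sum>i\<in>{1..N}. c (Inl i)) = lam" using a(2) by (simp add: sum_distrib_left[symmetric])
        have "(\<Sum>i\<in>{1..M}. c (Inr i)) = (\<Sum>i\<in>{1..M}. (1 - lam) * b i)" by (intro sum.cong) (auto simp: c_def)
        then show "(\<Sum>i\<in>{1..M}. c (Inr i)) = 1 - lam" using b(2) by (simp add: sum_distrib_left[symmetric])
      qed
      moreover have "mixed_point ?I (case_sum p q) c = lam *\<^sub>R x + (1 - lam) *\<^sub>R y"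
        unfolding mp by (simp only: c_def sum.case restr mscale a(3) b(3))
      moreover have "log_height ?I (case_sum p q) c = lam * log_height {1..N} p a + (1 - lam) * log_height {1..M} q b"
        unfolding lh by (simp only: c_def sum.case restr hscale)
      then have "?f x powr lam * ?g y powr (1 - lam) = exp (log_height ?I (case_sum p q) c)"
        unfolding a(4) b(4) by (simp add: powr_def exp_add)
      ultimately show ?thesis unfolding weighted_sup_def by (intro Sup_upper) auto
    qed auto
  qed
  show "weighted_sup ?I (split_weights N M lam) (case_sum p q) v \<le> sup_conv lam ?f ?g v"
    unfolding weighted_sup_def
  proof (intro Sup_least, clarify)
    fix c assume c: "c \<in> split_weights N M lam"
    define a where "a i = c (Inl i) / lam" for i
    define b where "b j = c (Inr j) / (1 - lam)" for j
    have ca: "(\<lambda>i. c (Inl i)) = (\<lambda>i. lam * a i)" and cb: "(\<lambda>j. c (Inr j)) = (\<lambda>j. (1 - lam) * b j)"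
      using lam by (auto simp: a_def b_def)
    have a: "\<And>i. i \<in> {1..N} \<Longrightarrow> 0 \<le> a i" "sum a {1..N} = 1"
      using c lam by (auto simp: a_def split_weights_def sum_divide_distrib[symmetric])
    have b: "\<And>i. i \<in> {1..M} \<Longrightarrow> 0 \<le> b i" "sum b {1..M} = 1"
      using c lam by (auto simp: b_def split_weights_def sum_divide_distrib[symmetric])
    let ?x = "mixed_point {1..N} p a" and ?y = "mixed_point {1..M} q b"
    have "exp (log_height ?I (case_sum p q) c) = exp (log_height {1..N} p a) powr lam * exp (log_height {1..M} q b) powr (1 - lam)"
      unfolding lh ca cb hscale by (simp add: powr_def exp_add)
    also have "\<dots> \<le> ?f ?x powr lam * ?g ?y powr (1 - lam)"
      using lam stoch_approx_ge[OF a, of p] stoch_approx_ge[OF b, of q]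
      by (intro mult_mono powr_mono2) auto
    finally have "ennreal (exp (log_height ?I (case_sum p q) c)) \<le> ennreal (?f ?x powr lam * ?g ?y powr (1 - lam))"
      by (rule ennreal_leI)
    also have "\<dots> \<le> sup_conv lam ?f ?g (mixed_point ?I (case_sum p q) c)"
      unfolding sup_conv_def mp ca cb mscale by (intro Sup_upper) blast
    finally show "ennreal (exp (log_height ?I (case_sum p q) c)) \<le> sup_conv lam ?f ?g (mixed_point ?I (case_sum p q) c)" .
  qed
qed

section \<open>Regions under log-concave functions and their rearrangements\<close>

lemma emeasure_by_fibres:
  fixes B :: "('a::euclidean_space \<times> real) set"
  assumes "B \<in> sets borel"
  shows "vol B = (\<integral>\<^sup>+x. vol {z. (x, z) \<in> B} \<partial>lborel)"
proof -
  have "B \<in> sets (lborel \<Otimes>\<^sub>M lborel)" unfolding lborel_prod using assms by simp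
  from lborel.emeasure_pair_measure_alt[OF this] show ?thesis
    unfolding lborel_prod by (simp add: vimage_def)
qed

lemma fibre_borel[measurable]:
  fixes B :: "('a::euclidean_space \<times> real) set"
  assumes [measurable]: "B \<in> sets borel"
  shows "{z. (x, z) \<in> B} \<in> sets borel"
proof -
  have "{z \<in> space borel. (x, z) \<in> B} \<in> sets borel" by measurable
  then show ?thesis by simp
qed

lemma emeasure_fibre_borel[measurable]:
  fixes B :: "('a::euclidean_space \<times> real) set"
  assumes [measurable]: "B \<in> sets borel"
  shows "(\<lambda>x. vol {z. (x, z) \<in> B}) \<in> borel_measurable borel"
proof -
  have "vol {z. (x, z) \<in> B} = (\<integral>\<^sup>+z. indicator B (x, z) \<partial>lborel)" for x
    by (subst nn_integral_indicator[symmetric]) (auto simp: indicator_def simp del: nn_integral_indicator intro!: nn_integral_cong)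
  then show ?thesis by simp
qed

lemma emeasure_eq_upto_null:
  assumes A: "A \<in> sets borel" and X: "X \<in> null_sets (lborel :: 'a::euclidean_space measure)"
    and "A - X \<subseteq> U" "U \<subseteq> A \<union> X"
  shows "emeasure lebesgue U = vol A"
proof -
  have "X \<in> null_sets lebesgue" using X by (rule null_sets_completionI)
  then have UX: "U \<inter> X \<in> null_sets lebesgue" by (rule null_sets_completion_subset[rotated]) auto
  have AX: "A - X \<in> sets borel" using A X by auto
  have "U = (A - X) \<union> (U \<inter> X)" using assms by blast
  then have "emeasure lebesgue U = emeasure lebesgue ((A - X) \<union> (U \<inter> X))" by simp
  also have "\<dots> = emeasure lebesgue (A - X)" using AX UX by (intro emeasure_Un_null_set) auto
  also have "\<dots> = vol (A - X)" using AX by simp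
  also have "\<dots> = vol A" using A X by (intro emeasure_Diff_null_set) auto
  finally show ?thesis .
qed

text \<open>
  Over points outside \<open>N\<close>, the vertical fibres of \<open>under_graph h\<close> and \<open>A\<close> differ at most in the points \<open>0\<close> and \<open>h x\<close>.  The function
  \<open>h\<close> need not be Borel, but off \<open>N\<close> it agrees with the Borel function \<open>g\<close> that measures the fibres of \<open>A\<close>,
  so the difference is contained in a Borel null set.
\<close>

lemma emeasure_under_graph_Int:
  fixes A :: "('a::euclidean_space \<times> real) set"
  assumes A[measurable]: "A \<in> sets borel" and h: "\<And>x. 0 \<le> h x"
    and N: "N \<in> null_sets lborel"
    and fib: "\<And>x. x \<notin> N \<Longrightarrow> {0<..<h x} \<subseteq> {z. (x, z) \<in> A}" "\<And>x. x \<notin> N \<Longrightarrow> {z. (x, z) \<in> A} \<subseteq> {0<..h x}"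
    and B: "B \<in> sets borel"
  shows "emeasure lebesgue (under_graph h \<inter> B) = vol (A \<inter> B)"
proof -
  have [measurable]: "N \<in> sets borel" using N by auto
  define g where "g x = enn2real (vol {z. (x, z) \<in> A})" for x
  have [measurable]: "g \<in> borel_measurable borel" unfolding g_def[abs_def] by measurable
  have g: "g x = h x" if "x \<notin> N" for x
  proof -
    have "vol {0<..<h x} \<le> vol {z. (x, z) \<in> A}"
      using fib(1)[OF that] by (intro emeasure_mono) auto
    moreover have "vol {z. (x, z) \<in> A} \<le> vol {0<..h x}"
      using fib(2)[OF that] by (intro emeasure_mono) auto
    ultimately have "vol {z. (x, z) \<in> A} = ennreal (h x)" using h[of x] by (intro antisym) auto
    then show ?thesis using h[of x] by (simp add: g_def)
  qed
  \<comment> \<open>The exceptional points: fibres over \<open>N\<close>, and the two end points of the other fibres.\<close>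
  define X where "X = {p::'a \<times> real. fst p \<in> N \<or> snd p = 0 \<or> snd p = g (fst p)}"
  have Xm: "X \<in> sets borel"
  proof -
    have "{p \<in> space (borel :: ('a \<times> real) measure). fst p \<in> N \<or> snd p = 0 \<or> snd p = g (fst p)} \<in> sets borel" by measurable
    then show ?thesis by (simp add: X_def)
  qed
  have null: "vol {z. (x, z) \<in> X} = 0" if "x \<notin> N" for x
  proof -
    have "{z. (x, z) \<in> X} = {0, g x}" using that by (auto simp: X_def)
    then show ?thesis by (simp add: emeasure_lborel_countable)
  qed
  have "AE x in lborel. vol {z. (x, z) \<in> X} = 0"
    using AE_not_in[OF N] by (rule eventually_mono) (rule null)
  then have "vol X = 0"
    unfolding emeasure_by_fibres[OF Xm] using Xm by (subst nn_integral_0_iff_AE) auto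
  then have X: "X \<in> null_sets lborel" using Xm by auto
  show ?thesis
  proof (rule emeasure_eq_upto_null[OF _ X])
    show "A \<inter> B - X \<subseteq> under_graph h \<inter> B"
    proof (intro subsetI, unfold split_paired_all)
      fix x z assume "(x, z) \<in> A \<inter> B - X"
      then have *: "(x, z) \<notin> X" "(x, z) \<in> A" "(x, z) \<in> B" by auto
      then have "x \<notin> N" by (auto simp: X_def)
      with fib(2)[OF this] * have "0 < z" "z \<le> h x" by auto
      then show "(x, z) \<in> under_graph h \<inter> B" using * by (auto simp: under_graph_def)
    qed
    show "under_graph h \<inter> B \<subseteq> A \<inter> B \<union> X"
    proof (intro subsetI, unfold split_paired_all, rule ccontr)
      fix x z assume "(x, z) \<in> under_graph h \<inter> B" "(x, z) \<notin> A \<inter> B \<union> X"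
      then have *: "(x, z) \<in> under_graph h" "(x, z) \<in> B" "(x, z) \<notin> X" "(x, z) \<notin> A" by auto
      then have "x \<notin> N" "z \<noteq> 0" "z \<noteq> h x" using g by (auto simp: X_def)
      moreover have "0 \<le> z" "z \<le> h x" using * by (auto simp: under_graph_def)
      ultimately show False using fib(1)[of x] * by (auto simp: subset_iff)
    qed
  qed (use A B in auto)
qed

text \<open>
  An open set that agrees with \<open>under_graph f\<close> up to a null set when \<open>f\<close> is log-concave.  Rational levels
  make the exceptional set, a union of frontiers of convex sets, a countable union of null sets.
\<close>

definition open_under_graph :: "('a::euclidean_space \<Rightarrow> real) \<Rightarrow> ('a \<times> real) set" where
  "open_under_graph f = (\<Union>q\<in>\<rat> \<inter> {0<..}. interior {y. q < f y} \<times> {0<..<q})"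

lemma mem_open_under_graph:
  "(x, z) \<in> open_under_graph f \<longleftrightarrow> 0 < z \<and> (\<exists>q\<in>\<rat>. z < q \<and> x \<in> interior {y. q < f y})"
  by (auto simp: open_under_graph_def intro: less_trans)

lemma open_under_graph_borel: "open_under_graph f \<in> sets borel"
  unfolding open_under_graph_def by (intro borel_open open_UN ballI open_Times) auto

lemma log_concave_superlevel_convex:
  assumes f: "log_concave f" and t: "0 < t"
  shows "convex {x. t < f x}"
proof (rule convexI)
  fix x y and a b :: real
  assume xy: "x \<in> {x. t < f x}" "y \<in> {x. t < f x}" and ab: "0 \<le> a" "0 \<le> b" "a + b = 1"
  then have pos: "0 < f x" "0 < f y" using t by auto
  have cv: "convex {x. 0 < f x}" and cc: "concave_on {x. 0 < f x} (\<lambda>x. ln (f x))"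
    using f by (auto simp: log_concave_def)
  let ?m = "a *\<^sub>R x + b *\<^sub>R y"
  have m: "0 < f ?m" using convexD[OF cv, of x y a b] pos ab by auto
  have "a * ln (f x) + b * ln (f y) \<le> ln (f ?m)"
    using cc pos ab unfolding concave_on_iff by auto
  moreover have "- (a * ln (f x) + b * ln (f y)) < - ln t"
    using convex_bound_lt[of "- ln (f x)" "- ln t" "- ln (f y)" a b] ab xy t by simp
  ultimately have "ln t < ln (f ?m)" by linarith
  then show "?m \<in> {x. t < f x}" using t m by simp
qed

lemma open_under_graph_horizontally_convex:
  assumes f: "log_concave f"
  shows "horizontally_convex (open_under_graph f)"
  unfolding horizontally_convex_def
proof (intro allI convexI)
  fix z x y and a b :: real
  assume xy: "x \<in> (slice z (open_under_graph f))" "y \<in> (slice z (open_under_graph f))"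
    and ab: "0 \<le> a" "0 \<le> b" "a + b = 1"
  then obtain q r where q: "q \<in> \<rat>" "z < q" "x \<in> interior {y. q < f y}"
    and r: "r \<in> \<rat>" "z < r" "y \<in> interior {y. r < f y}" and z: "0 < z"
    by (auto simp: mem_open_under_graph)
  let ?s = "min q r"
  have "interior {y. q < f y} \<subseteq> interior {y. ?s < f y}" "interior {y. r < f y} \<subseteq> interior {y. ?s < f y}"
    by (auto intro!: interior_mono)
  then have "a *\<^sub>R x + b *\<^sub>R y \<in> interior {y. ?s < f y}"
    using q r z ab by (intro convexD convex_interior log_concave_superlevel_convex f) auto
  then show "a *\<^sub>R x + b *\<^sub>R y \<in> (slice z (open_under_graph f))"
    using q r z by (auto simp: mem_open_under_graph min_def intro!: bexI[of _ ?s])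
qed

definition level_frontiers :: "('a::euclidean_space \<Rightarrow> real) \<Rightarrow> 'a set" where
  "level_frontiers f = (\<Union>q\<in>\<rat> \<inter> {0<..}. frontier {y. q < f y})"

lemma level_frontiers_null:
  assumes f: "log_concave f"
  shows "level_frontiers f \<in> null_sets lborel"
  unfolding level_frontiers_def
proof (rule null_sets_UN')
  show "countable (\<rat> \<inter> {0::real<..})" by (intro countable_Int1 countable_rat)
  fix q :: real assume q: "q \<in> \<rat> \<inter> {0<..}"
  have "negligible (frontier {y. q < f y})"
    using q by (intro negligible_convex_frontier log_concave_superlevel_convex f) auto
  then have "frontier {y. q < f y} \<in> null_sets lebesgue" by (simp add: negligible_iff_null_sets)
  then show "frontier {y. q < f y} \<in> null_sets lborel"
    by (simp add: null_sets_completion_iff borel_closed)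
qed

lemma fibre_open_under_graph:
  assumes x: "x \<notin> level_frontiers f"
  shows "{z. (x, z) \<in> open_under_graph f} = {0<..<f x}"
proof (intro equalityI subsetI)
  fix z assume "z \<in> {z. (x, z) \<in> open_under_graph f}"
  then obtain q where q: "0 < z" "z < q" "x \<in> interior {y. q < f y}" by (auto simp: mem_open_under_graph)
  then have "q < f x" using interior_subset[of "{y. q < f y}"] by auto
  then show "z \<in> {0<..<f x}" using q by auto
next
  fix z assume z: "z \<in> {0<..<f x}"
  then obtain q where q: "q \<in> \<rat>" "z < q" "q < f x" using Rats_dense_in_real[of z "f x"] by auto
  then have "x \<notin> frontier {y. q < f y}" using x z by (auto simp: level_frontiers_def)
  moreover have "x \<in> closure {y. q < f y}" using q closure_subset[of "{y. q < f y}"] by auto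
  ultimately have "x \<in> interior {y. q < f y}" by (auto simp: frontier_def)
  then show "z \<in> {z. (x, z) \<in> open_under_graph f}" using q z by (auto simp: mem_open_under_graph)
qed

lemma emeasure_section_open_under_graph:
  assumes f: "log_concave f" and z: "0 < z"
  shows "emeasure lebesgue {x. z < f x} = vol (slice z (open_under_graph f))"
proof (rule emeasure_eq_upto_null[OF section_borel[OF open_under_graph_borel] level_frontiers_null[OF f]])
  have fibre: "(x, z) \<in> open_under_graph f \<longleftrightarrow> 0 < z \<and> z < f x" if "x \<notin> level_frontiers f" for x
    using fibre_open_under_graph[OF that] by (auto simp: set_eq_iff)
  show "(slice z (open_under_graph f)) - level_frontiers f \<subseteq> {x. z < f x}"
    using fibre by auto
  show "{x. z < f x} \<subseteq> (slice z (open_under_graph f)) \<union> level_frontiers f"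
    using fibre z by auto
qed

lemma emeasure_open_under_graph_finite:
  assumes f: "log_concave f" and int: "integrable lebesgue f"
  shows "vol (open_under_graph f) < \<infinity>"
proof -
  have "vol (open_under_graph f) = (\<integral>\<^sup>+x. vol {z. (x, z) \<in> open_under_graph f} \<partial>lborel)"
    by (rule emeasure_by_fibres[OF open_under_graph_borel])
  also have "\<dots> = (\<integral>\<^sup>+x. ennreal (f x) \<partial>lborel)"
  proof (rule nn_integral_cong_AE)
    show "AE x in lborel. vol {z. (x, z) \<in> open_under_graph f} = ennreal (f x)"
      using AE_not_in[OF level_frontiers_null[OF f]]
    proof eventually_elim
      case (elim x)
      then show ?case using f by (simp add: fibre_open_under_graph log_concave_def)
    qed
  qed
  also have "\<dots> = (\<integral>\<^sup>+x. ennreal (f x) \<partial>lebesgue)" by (rule nn_integral_completion[symmetric])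
  also have "\<dots> = (\<integral>\<^sup>+x. ennreal (norm (f x)) \<partial>lebesgue)" using f by (simp add: log_concave_def)
  also have "\<dots> < \<infinity>" using int by (simp add: integrable_iff_bounded)
  finally show ?thesis .
qed

lemma emeasure_under_graph_open:
  assumes f: "log_concave f" and B: "B \<in> sets borel"
  shows "emeasure lebesgue (under_graph f \<inter> B) = vol (open_under_graph f \<inter> B)"
  by (rule emeasure_under_graph_Int[OF open_under_graph_borel _ level_frontiers_null[OF f] _ _ B])
    (use f in \<open>auto simp: fibre_open_under_graph log_concave_def\<close>)

text \<open>
  Balls around the origin are determined by their measure, the empty ball included.
\<close>

lemma ball_rearrangement_eq:
  fixes A :: "'a::euclidean_space set"
  assumes eq: "emeasure lebesgue A = vol (ball (0::'a) r)"
  shows "ball_rearrangement A = ball 0 r"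
  unfolding ball_rearrangement_def
proof (rule the_equality)
  show "(\<exists>s. ball 0 r = ball (0::'a) s) \<and> emeasure lebesgue (ball (0::'a) r) = emeasure lebesgue A"
    using eq by auto
  fix B :: "'a set" assume "(\<exists>s. B = ball 0 s) \<and> emeasure lebesgue B = emeasure lebesgue A"
  then obtain s where B: "B = ball 0 s" and m: "vol (ball (0::'a) s) = vol (ball (0::'a) r)"
    using eq by auto
  have c: "measure lborel (ball (0::'a) s) = measure lborel (ball (0::'a) r)" using m by (simp add: measure_def)
  have V: "0 < measure lborel (ball (0::'a) 1)" using content_ball_pos[of 1 "0::'a"] by simp
  have pos: "0 < t \<longleftrightarrow> 0 < measure lborel (ball (0::'a) t)" for t
    using content_ball_pos[of t "0::'a"] by (cases "0 < t") auto
  have "0 < s \<longleftrightarrow> 0 < r" using c pos by metis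
  then show "B = ball 0 r"
  proof (cases "0 < r")
    case True
    then have "0 < s" using \<open>0 < s \<longleftrightarrow> 0 < r\<close> by simp
    have "s ^ DIM('a) * measure lborel (ball (0::'a) 1) = r ^ DIM('a) * measure lborel (ball (0::'a) 1)"
      using c content_ball_conv_unit_ball[of s "0::'a"] content_ball_conv_unit_ball[of r "0::'a"] True \<open>0 < s\<close> by simp
    then have "s ^ DIM('a) = r ^ DIM('a)" using V by simp
    then have "s = r" using True \<open>0 < s\<close> by (intro power_eq_imp_eq_base[of s "DIM('a)" r]) auto
    then show ?thesis using B by simp
  next
    case False
    then have "ball (0::'a) s = {}" "ball (0::'a) r = {}" using \<open>0 < s \<longleftrightarrow> 0 < r\<close> by simp_all
    then show ?thesis using B by (simp only:)
  qed
qed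

text \<open>
  Markov's inequality.
\<close>

lemma emeasure_section_open_under_graph_finite:
  fixes f :: "'a::euclidean_space \<Rightarrow> real"
  assumes f: "log_concave f" and int: "integrable lebesgue f"
  shows "vol (slice z (open_under_graph f)) < \<infinity>"
proof (cases "0 < z")
  case True
  have fin: "(\<integral>\<^sup>+x. ennreal (f x) * indicator UNIV x \<partial>lebesgue) < \<infinity>"
    using int f by (simp add: integrable_iff_bounded log_concave_def)
  have [measurable]: "f \<in> borel_measurable lebesgue" using int by simp
  have "emeasure lebesgue {x. z < f x} \<le> emeasure lebesgue {x \<in> UNIV. 1 \<le> ennreal (1 / z) * ennreal (f x)}"
  proof (rule emeasure_mono)
    show "{x. z < f x} \<subseteq> {x \<in> UNIV. 1 \<le> ennreal (1 / z) * ennreal (f x)}"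
      using True by (auto simp: ennreal_mult'[symmetric] field_simps)
    have "{x \<in> space lebesgue. 1 \<le> ennreal (1 / z) * ennreal (f x)} \<in> sets lebesgue" by measurable
    then show "{x \<in> UNIV. 1 \<le> ennreal (1 / z) * ennreal (f x)} \<in> sets lebesgue" by simp
  qed
  also have "\<dots> \<le> ennreal (1 / z) * (\<integral>\<^sup>+x. ennreal (f x) * indicator UNIV x \<partial>lebesgue)"
    by (rule nn_integral_Markov_inequality) auto
  also have "\<dots> < \<infinity>" using fin by (simp add: ennreal_mult_less_top)
  finally show ?thesis unfolding emeasure_section_open_under_graph[OF f True] .
next
  case False
  then have "(slice z (open_under_graph f)) = {}" by (auto simp: mem_open_under_graph)
  then show ?thesis by simp
qed

text \<open>
  The region under the graph of the symmetric decreasing rearrangement, up to a null set.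
\<close>

definition rearranged_under_graph :: "('a::euclidean_space \<Rightarrow> real) \<Rightarrow> ('a \<times> real) set" where
  "rearranged_under_graph f = level_balls (level_radius (open_under_graph f))"

lemma rearranged_under_graph_borel: "rearranged_under_graph f \<in> sets borel"
  unfolding rearranged_under_graph_def by (intro level_balls_borel level_radius_borel open_under_graph_borel)

lemma emeasure_rearranged_under_graph:
  assumes f: "log_concave f" and int: "integrable lebesgue f"
  shows "vol (rearranged_under_graph f) = vol (open_under_graph f)"
  unfolding emeasure_by_sections[OF rearranged_under_graph_borel] emeasure_by_sections[OF open_under_graph_borel]
  unfolding rearranged_under_graph_def section_level_balls
  by (intro nn_integral_cong emeasure_ball_level_radius emeasure_section_open_under_graph_finite f int)

lemma sym_decr_rearrangement_eq:
  fixes f :: "'a::euclidean_space \<Rightarrow> real"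
  assumes f: "log_concave f" and int: "integrable lebesgue f"
  shows "sym_decr_rearrangement f x = measure lborel {z. (x, z) \<in> rearranged_under_graph f}"
proof -
  have ball: "ball_rearrangement {y. t < f y} = ball 0 (level_radius (open_under_graph f) t)" if "0 < t" for t
    using emeasure_section_open_under_graph[OF f that]
      emeasure_ball_level_radius[OF emeasure_section_open_under_graph_finite[OF f int], of t]
    by (intro ball_rearrangement_eq) simp
  have neg: "level_radius (open_under_graph f) t = 0" if "t \<le> 0" for t
  proof -
    have "(slice t (open_under_graph f)) = {}" using that by (auto simp: mem_open_under_graph)
    then show ?thesis by (simp add: level_radius_def)
  qed
  have "indicator {0<..} t *\<^sub>R indicator (ball_rearrangement {y. t < f y}) x
      = (indicator {z. (x, z) \<in> rearranged_under_graph f} t :: real)" for t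
    using ball[of t] neg[of t]
    by (cases "0 < t") (auto simp: indicator_def rearranged_under_graph_def level_balls_def)
  then have "sym_decr_rearrangement f x = (LINT t|lborel. indicator {z. (x, z) \<in> rearranged_under_graph f} t)"
    by (simp add: sym_decr_rearrangement_def set_lebesgue_integral_def)
  also have "\<dots> = measure lborel {z. (x, z) \<in> rearranged_under_graph f}" by simp
  finally show ?thesis .
qed

lemma level_radius_open_under_graph_antimono:
  fixes f :: "'a::euclidean_space \<Rightarrow> real"
  assumes f: "log_concave f" and int: "integrable lebesgue f" and st: "0 < s" "s \<le> t"
  shows "level_radius (open_under_graph f) t \<le> level_radius (open_under_graph f) s"
proof -
  have "(slice t (open_under_graph f)) \<subseteq> (slice s (open_under_graph f))"
    using st by (force simp: mem_open_under_graph)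
  then have "measure lborel (slice t (open_under_graph f)) \<le> measure lborel (slice s (open_under_graph f))"
    using emeasure_section_open_under_graph_finite[OF f int, of s] section_borel[OF open_under_graph_borel]
    by (intro measure_mono_fmeasurable) (auto simp: fmeasurable_def)
  then show ?thesis unfolding level_radius_def by (intro real_root_le_mono divide_right_mono) auto
qed

text \<open>
  The radii of the balls decrease with the height, so each vertical fibre of the stack of balls is an
  interval that starts at \<open>0\<close>.  Its length is the value of the rearrangement, provided that the fibre has
  finite measure, as almost every fibre does.
\<close>

lemma emeasure_under_graph_rearrangement:
  fixes f :: "'a::euclidean_space \<Rightarrow> real"
  assumes f: "log_concave f" and int: "integrable lebesgue f" and B: "B \<in> sets borel"
  shows "emeasure lebesgue (under_graph (sym_decr_rearrangement f) \<inter> B) = vol (rearranged_under_graph f \<inter> B)"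
proof -
  let ?A = "rearranged_under_graph f"
  let ?E = "\<lambda>x. {z. (x, z) \<in> ?A}"
  have meas: "(\<lambda>x. vol (?E x)) \<in> borel_measurable lborel"
    using emeasure_fibre_borel[OF rearranged_under_graph_borel, of f] by simp
  have "(\<integral>\<^sup>+x. vol (?E x) \<partial>lborel) \<noteq> \<infinity>"
    using emeasure_by_fibres[OF rearranged_under_graph_borel, of f]
      emeasure_rearranged_under_graph[OF f int] emeasure_open_under_graph_finite[OF f int] by simp
  then have "AE x in lborel. vol (?E x) \<noteq> \<infinity>"
    by (rule nn_integral_PInf_AE[OF meas])
  then obtain N where N: "N \<in> null_sets lborel" "{x \<in> space lborel. \<not> vol (?E x) \<noteq> \<infinity>} \<subseteq> N"
    by (auto simp: eventually_ae_filter)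
  have fin: "vol (?E x) < \<infinity>" if "x \<notin> N" for x using N(2) that by (auto simp: less_top)
  have pos: "0 < z" if "(x, z) \<in> ?A" for x :: 'a and z
  proof (rule ccontr)
    assume "\<not> 0 < z"
    then have "(slice z (open_under_graph f)) = {}" by (auto simp: mem_open_under_graph)
    then have "level_radius (open_under_graph f) z = 0" by (simp add: level_radius_def)
    then show False using that by (simp add: rearranged_under_graph_def level_balls_def)
  qed
  have down: "(x, s) \<in> ?A" if "(x, t) \<in> ?A" "0 < s" "s \<le> t" for x :: 'a and s t
    using that level_radius_open_under_graph_antimono[OF f int that(2,3)]
    by (auto simp: rearranged_under_graph_def level_balls_def)
  show ?thesis
  proof (rule emeasure_under_graph_Int[OF rearranged_under_graph_borel _ N(1) _ _ B])
    show "0 \<le> sym_decr_rearrangement f x" for x by (simp add: sym_decr_rearrangement_eq[OF f int])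
    fix x assume x: "x \<notin> N"
    have E: "?E x \<in> sets borel" by (rule fibre_borel[OF rearranged_under_graph_borel])
    have h: "vol (?E x) = ennreal (sym_decr_rearrangement f x)"
      using fin[OF x] by (simp add: sym_decr_rearrangement_eq[OF f int] emeasure_eq_ennreal_measure less_top)
    show "?E x \<subseteq> {0<..sym_decr_rearrangement f x}"
    proof
      fix t assume t: "t \<in> ?E x"
      then have "0 < t" using pos by auto
      have "{0<..t} \<subseteq> ?E x" using down t by auto
      then have "vol {0<..t} \<le> vol (?E x)" using E by (intro emeasure_mono) auto
      then have "ennreal t \<le> ennreal (sym_decr_rearrangement f x)" using h \<open>0 < t\<close> by simp
      then show "t \<in> {0<..sym_decr_rearrangement f x}"
        using \<open>0 < t\<close> by (simp add: ennreal_le_iff sym_decr_rearrangement_eq[OF f int])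
    qed
    show "{0<..<sym_decr_rearrangement f x} \<subseteq> ?E x"
    proof (rule ccontr)
      assume "\<not> ?thesis"
      then obtain s where "s \<in> {0<..<sym_decr_rearrangement f x}" "s \<notin> ?E x" by blast
      then have s: "0 < s" "s < sym_decr_rearrangement f x" "(x, s) \<notin> ?A" by auto
      have "t < s" if "(x, t) \<in> ?A" for t using down[OF that s(1)] s(3) by force
      then have "?E x \<subseteq> {0<..<s}" using pos by auto
      then have "vol (?E x) \<le> vol {0<..<s}" by (intro emeasure_mono) auto
      then show False using h s by (simp add: ennreal_le_iff)
    qed
  qed
qed

section \<open>Comparison of the two probabilities\<close>

lemma (in prob_space) indep_vars_reindex_inj:
  assumes ind: "indep_vars M' X (f ` I)" and inj: "inj_on f I"
  shows "indep_vars (\<lambda>i. M' (f i)) (\<lambda>i. X (f i)) I"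
  unfolding indep_vars_def2
proof (intro conjI ballI)
  show "random_variable (M' (f i)) (X (f i))" if "i \<in> I" for i
    using ind that by (auto simp: indep_vars_def2)
  let ?F = "\<lambda>i. {X i -` A \<inter> space M |A. A \<in> sets (M' i)}"
  have F: "indep_sets ?F (f ` I)" using ind by (auto simp: indep_vars_def2)
  show "indep_sets (\<lambda>i. ?F (f i)) I"
  proof (rule indep_setsI)
    show "?F (f i) \<subseteq> events" if "i \<in> I" for i using F that by (auto simp: indep_sets_def)
    fix A J assume J: "J \<noteq> {}" "J \<subseteq> I" "finite J" and A: "\<forall>j\<in>J. A j \<in> ?F (f j)"
    let ?A = "\<lambda>k. A (inv_into J f k)"
    have injJ: "inj_on f J" using inj J(2) by (rule inj_on_subset)
    have "prob (\<Inter>k\<in>f ` J. ?A k) = (\<Prod>k\<in>f ` J. prob (?A k))"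
      by (rule indep_setsD[OF F]) (use J A injJ in auto)
    then show "prob (\<Inter>j\<in>J. A j) = (\<Prod>j\<in>J. prob (A j))"
      using injJ by (simp add: prod.reindex cong: INF_cong_simp prod.cong)
  qed
qed

text \<open>
  A product of measures with densities \<open>indicator (A i) / c i\<close> has the product of the densities.
\<close>

lemma emeasure_PiM_relative_lborel:
  fixes A :: "'i \<Rightarrow> 'b::euclidean_space set" and \<mu> :: "'i \<Rightarrow> 'b measure"
  assumes I: "finite I" and \<mu>: "product_sigma_finite \<mu>" "\<And>i. i \<in> I \<Longrightarrow> sets (\<mu> i) = sets borel"
    and A: "\<And>i. i \<in> I \<Longrightarrow> A i \<in> sets borel"
    and eq: "\<And>i B. i \<in> I \<Longrightarrow> B \<in> sets borel \<Longrightarrow> emeasure (\<mu> i) B = vol (A i \<inter> B) / c i"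
    and X: "X \<in> sets (lborels I)"
  shows "emeasure (PiM I \<mu>) X = (\<Prod>i\<in>I. inverse (c i)) * emeasure (lborels I) (X \<inter> PiE I A)"
proof -
  let ?L = "PiM I (\<lambda>_. lborel :: 'b measure)"
  interpret L: product_sigma_finite "\<lambda>_::'i. lborel :: 'b measure" by standard
  interpret \<mu>: product_sigma_finite \<mu> by fact
  let ?d = "\<lambda>p. \<Prod>i\<in>I. inverse (c i) * indicator (A i) (p i)"
  have [measurable]: "?d \<in> borel_measurable ?L"
  proof (rule borel_measurable_prod_ennreal)
    fix i assume i: "i \<in> I"
    have [measurable]: "A i \<in> sets borel" by (rule A[OF i])
    show "(\<lambda>p. inverse (c i) * indicator (A i) (p i)) \<in> borel_measurable ?L" using i by measurable
  qed
  have "density ?L ?d = PiM I \<mu>"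
  proof (rule \<mu>.PiM_eqI[OF I])
    show "sets (density ?L ?d) = sets (PiM I \<mu>)"
      unfolding sets_density by (rule sets_PiM_cong) (auto simp: \<mu>)
    fix B assume "\<And>i. i \<in> I \<Longrightarrow> B i \<in> sets (\<mu> i)"
    then have B: "B i \<in> sets borel" if "i \<in> I" for i using that \<mu>(2) by simp
    have BL: "PiE I B \<in> sets ?L" using B I by (intro sets_PiM_I_finite) auto
    have "emeasure (density ?L ?d) (PiE I B) = (\<integral>\<^sup>+p. ?d p * indicator (PiE I B) p \<partial>?L)"
      by (rule emeasure_density) (use BL in auto)
    also have "\<dots> = (\<integral>\<^sup>+p. (\<Prod>i\<in>I. inverse (c i) * indicator (A i \<inter> B i) (p i)) \<partial>?L)"
    proof (rule nn_integral_cong)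
      fix p assume p: "p \<in> space ?L"
      have "indicator (PiE I B) p = (\<Prod>i\<in>I. indicator (B i) (p i) :: ennreal)"
        using p I by (auto simp: indicator_def space_PiM PiE_def Pi_def prod_zero_iff)
      then show "?d p * indicator (PiE I B) p = (\<Prod>i\<in>I. inverse (c i) * indicator (A i \<inter> B i) (p i))"
        by (simp add: prod.distrib[symmetric] indicator_inter_arith mult.assoc)
    qed
    also have "\<dots> = (\<Prod>i\<in>I. \<integral>\<^sup>+x. inverse (c i) * indicator (A i \<inter> B i) x \<partial>lborel)"
      using A B I by (intro L.product_nn_integral_prod) auto
    also have "\<dots> = (\<Prod>i\<in>I. emeasure (\<mu> i) (B i))"
      using A B by (intro prod.cong refl)
        (simp add: nn_integral_cmult_indicator eq divide_ennreal_def mult.commute)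
    finally show "emeasure (density ?L ?d) (PiE I B) = (\<Prod>i\<in>I. emeasure (\<mu> i) (B i))" .
  qed
  then have "emeasure (PiM I \<mu>) X = emeasure (density ?L ?d) X" by simp
  also have "\<dots> = (\<integral>\<^sup>+p. ?d p * indicator X p \<partial>?L)" by (rule emeasure_density) (use X in auto)
  also have "\<dots> = (\<integral>\<^sup>+p. (\<Prod>i\<in>I. inverse (c i)) * indicator (X \<inter> PiE I A) p \<partial>?L)"
  proof (rule nn_integral_cong)
    fix p assume p: "p \<in> space ?L"
    have "indicator (PiE I A) p = (\<Prod>i\<in>I. indicator (A i) (p i) :: ennreal)"
      using p I by (auto simp: indicator_def space_PiM PiE_def Pi_def prod_zero_iff)
    then show "?d p * indicator X p = (\<Prod>i\<in>I. inverse (c i)) * indicator (X \<inter> PiE I A) p"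
      by (simp add: prod.distrib indicator_inter_arith mult_ac)
  qed
  also have "\<dots> = (\<Prod>i\<in>I. inverse (c i)) * emeasure ?L (X \<inter> PiE I A)"
    using X A I by (intro nn_integral_cmult_indicator sets.Int sets_PiM_I_finite) auto
  finally show ?thesis .
qed

lemma emeasure_independent_relative_lborel:
  fixes A :: "'i \<Rightarrow> 'b::euclidean_space set" and V :: "'i \<Rightarrow> 'w \<Rightarrow> 'b"
  assumes P: "prob_space P" and I: "finite I" "I \<noteq> {}" and A: "\<And>i. i \<in> I \<Longrightarrow> A i \<in> sets borel"
    and ind: "prob_space.indep_vars P (\<lambda>_. borel) V I"
    and eq: "\<And>i B. i \<in> I \<Longrightarrow> B \<in> sets borel \<Longrightarrow> emeasure P (V i -` B \<inter> space P) = vol (A i \<inter> B) / c i"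
    and X: "X \<in> sets (lborels I)"
  shows "{\<omega> \<in> space P. (\<lambda>i\<in>I. V i \<omega>) \<in> X} \<in> sets P"
    "emeasure P {\<omega> \<in> space P. (\<lambda>i\<in>I. V i \<omega>) \<in> X}
      = (\<Prod>i\<in>I. inverse (c i)) * emeasure (lborels I) (X \<inter> PiE I A)"
proof -
  interpret prob_space P by fact
  have V: "V i \<in> borel_measurable P" if "i \<in> I" for i using ind that by (auto simp: indep_vars_def)
  have joint: "(\<lambda>\<omega>. \<lambda>i\<in>I. V i \<omega>) \<in> measurable P (PiM I (\<lambda>_. borel))"
    using V by (intro measurable_restrict) auto
  have sets_eq: "sets (PiM I (\<lambda>_. lborel :: 'b measure)) = sets (PiM I (\<lambda>_. borel))"
    by (rule sets_PiM_cong) auto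
  have Xb: "X \<in> sets (PiM I (\<lambda>_. borel))" using X sets_eq by simp
  have pre: "{\<omega> \<in> space P. (\<lambda>i\<in>I. V i \<omega>) \<in> X} = (\<lambda>\<omega>. \<lambda>i\<in>I. V i \<omega>) -` X \<inter> space P" by auto
  show "{\<omega> \<in> space P. (\<lambda>i\<in>I. V i \<omega>) \<in> X} \<in> sets P"
    unfolding pre by (rule measurable_sets[OF joint Xb])
  define \<mu> where "\<mu> i = (if i \<in> I then distr P borel (V i) else lborel)" for i
  have "emeasure P {\<omega> \<in> space P. (\<lambda>i\<in>I. V i \<omega>) \<in> X} = emeasure (distr P (PiM I (\<lambda>_. borel)) (\<lambda>\<omega>. \<lambda>i\<in>I. V i \<omega>)) X"
    unfolding pre by (rule emeasure_distr[OF joint Xb, symmetric])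
  also have "distr P (PiM I (\<lambda>_. borel)) (\<lambda>\<omega>. \<lambda>i\<in>I. V i \<omega>) = PiM I (\<lambda>i. distr P borel (V i))"
    using indep_vars_iff_distr_eq_PiM'[OF I(2), where M'="\<lambda>_. borel" and X=V] V ind by auto
  also have "\<dots> = PiM I \<mu>" by (rule PiM_cong) (auto simp: \<mu>_def)
  also have "emeasure (PiM I \<mu>) X = (\<Prod>i\<in>I. inverse (c i)) * emeasure (lborels I) (X \<inter> PiE I A)"
  proof (rule emeasure_PiM_relative_lborel[OF I(1) _ _ A _ X])
    show "product_sigma_finite \<mu>"
    proof (unfold product_sigma_finite_def, rule allI)
      fix i
      show "sigma_finite_measure (\<mu> i)"
      proof (cases "i \<in> I")
        case True
        interpret D: prob_space "distr P borel (V i)" by (rule prob_space_distr[OF V[OF True]])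
        show ?thesis using True D.sigma_finite_measure_axioms by (simp add: \<mu>_def)
      qed (simp add: \<mu>_def lborel.sigma_finite_measure_axioms)
    qed
    fix i B assume i: "i \<in> I" and B: "B \<in> sets (borel :: 'b measure)"
    have "emeasure (\<mu> i) B = emeasure P (V i -` B \<inter> space P)"
      using i by (simp add: \<mu>_def emeasure_distr[OF V[OF i] B])
    then show "emeasure (\<mu> i) B = vol (A i \<inter> B) / c i" using eq[OF i B] by simp
  qed (auto simp: \<mu>_def)
  finally show "emeasure P {\<omega> \<in> space P. (\<lambda>i\<in>I. V i \<omega>) \<in> X}
      = (\<Prod>i\<in>I. inverse (c i)) * emeasure (lborels I) (X \<inter> PiE I A)" .
qed

lemma uniformly_distributed_under_graph:
  assumes f: "log_concave f" and V: "uniformly_distributed P V (under_graph f)" and B: "B \<in> sets borel"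
  shows "emeasure P (V -` B \<inter> space P) = vol (open_under_graph f \<inter> B) / vol (open_under_graph f)"
  using V B emeasure_under_graph_open[OF f B] emeasure_under_graph_open[OF f, of UNIV]
  by (simp add: uniformly_distributed_def)

lemma uniformly_distributed_under_rearrangement:
  assumes f: "log_concave f" "integrable lebesgue f"
    and V: "uniformly_distributed P V (under_graph (sym_decr_rearrangement f))" and B: "B \<in> sets borel"
  shows "emeasure P (V -` B \<inter> space P) = vol (rearranged_under_graph f \<inter> B) / vol (open_under_graph f)"
  using V B emeasure_under_graph_rearrangement[OF f B] emeasure_under_graph_rearrangement[OF f, of UNIV]
    emeasure_rearranged_under_graph[OF f]
  by (simp add: uniformly_distributed_def)

lemma weighted_sup_integral_restrict: "weighted_sup_integral I S (restrict p I) = weighted_sup_integral I S p"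
  by (simp add: weighted_sup_integral_def weighted_sup_def mixed_point_def log_height_def cong: sum.cong)

theorem theorem1p1:
  fixes f g :: "real ^ 'n \<Rightarrow> real"
    and lam \<alpha> :: real
    and N M :: nat
    and P :: "'w measure"
    and F G F' G' :: "nat \<Rightarrow> 'w \<Rightarrow> (real ^ 'n) \<times> real"
  assumes "log_concave f" and "integrable lebesgue f" and "0 < integral\<^sup>L lebesgue f"
    and "log_concave g" and "integrable lebesgue g" and "0 < integral\<^sup>L lebesgue g"
    and "0 < lam" and "lam < 1"
    and "CARD('n) + 1 < N" and "CARD('n) + 1 < M"
    and "prob_space P"
    and "\<And>i. i \<in> {1..N} \<Longrightarrow> uniformly_distributed P (F i) (under_graph f)"
    and "\<And>j. j \<in> {1..M} \<Longrightarrow> uniformly_distributed P (G j) (under_graph g)"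
    and "\<And>i. i \<in> {1..N} \<Longrightarrow>
           uniformly_distributed P (F' i) (under_graph (sym_decr_rearrangement f))"
    and "\<And>j. j \<in> {1..M} \<Longrightarrow>
           uniformly_distributed P (G' j) (under_graph (sym_decr_rearrangement g))"
    and "prob_space.indep_vars P (\<lambda>_. borel)
           (case_sum (case_sum F G) (case_sum F' G'))
           (({1..N} <+> {1..M}) <+> ({1..N} <+> {1..M}))"
    and "0 < \<alpha>"
  shows "measure P {\<omega> \<in> space P.
           (\<integral>\<^sup>+ v. sup_conv lam (stoch_approx N (\<lambda>i. F i \<omega>)) (stoch_approx M (\<lambda>j. G j \<omega>)) v \<partial>lebesgue)
             > ennreal \<alpha>}
       \<ge> measure P {\<omega> \<in> space P.
           (\<integral>\<^sup>+ v. sup_conv lam (stoch_approx N (\<lambda>i. F' i \<omega>)) (stoch_approx M (\<lambda>j. G' j \<omega>)) v \<partial>lebesgue)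
             > ennreal \<alpha>}"
proof -
  interpret prob_space P by fact
  define I where "I = {1..N} <+> {1..M}"
  define S where "S = split_weights N M lam"
  have I: "finite I" "I \<noteq> {}" using assms(9) by (auto simp: I_def)
  have S: "compact S" "coefficient_convex S"
    unfolding S_def by (rule compact_split_weights coefficient_convex_split_weights)+
  define A where "A = case_sum (\<lambda>_::nat. open_under_graph f) (\<lambda>_::nat. open_under_graph g)"
  define D where "D = case_sum (\<lambda>_::nat. rearranged_under_graph f) (\<lambda>_::nat. rearranged_under_graph g)"
  have AD: "D k = level_balls (level_radius (A k))" for k
    by (simp add: A_def D_def rearranged_under_graph_def split: sum.split)
  have Am: "A k \<in> sets borel" "D k \<in> sets borel" for k
    by (auto simp: A_def D_def open_under_graph_borel rearranged_under_graph_borel split: sum.split)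
  \<comment> \<open>The complement of the event in question, for a deterministic tuple of sample points.\<close>
  define C where "C = {p \<in> space (PiM I (\<lambda>_. lborel :: ((real ^ 'n) \<times> real) measure)). weighted_sup_integral I S p \<le> ennreal \<alpha>}"
  have C: "C \<in> sets (lborels I)"
  proof -
    note weighted_sup_integral_measurable[OF S(1), of I, measurable]
    show ?thesis unfolding C_def by measurable
  qed
  have rearr: "emeasure (lborels I) (C \<inter> PiE I A) \<le> emeasure (lborels I) (C \<inter> PiE I D)"
    unfolding AD[abs_def]
  proof (rule emeasure_PiE_le_level_balls[OF I(1) Am(1) _ _ C])
    show "vol (slice z (A k)) < \<infinity>" for k z
      using emeasure_section_open_under_graph_finite assms(1,2,4,5) by (auto simp: A_def split: sum.split)
    show "horizontally_convex (A k)" for k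
      using open_under_graph_horizontally_convex assms(1,4) by (auto simp: A_def split: sum.split)
    show "mirror_midpoint_closed I u C" if "norm u = 1" for u
      unfolding C_def by (rule weighted_sup_sublevel_mirror_midpoint_closed[OF S that])
  qed
  \<comment> \<open>The samples under \<open>f\<close> and under its rearrangement have the same normalizing constants.\<close>
  define c where "c = case_sum (\<lambda>_::nat. vol (open_under_graph f)) (\<lambda>_::nat. vol (open_under_graph g))"
  have ind: "indep_vars (\<lambda>_. borel) (case_sum F G) I" "indep_vars (\<lambda>_. borel) (case_sum F' G') I"
    using indep_vars_reindex_inj[OF indep_vars_subset[OF assms(16), of "Inl ` I"]]
      indep_vars_reindex_inj[OF indep_vars_subset[OF assms(16), of "Inr ` I"]]
    by (auto simp: I_def)
  have conv: "(\<integral>\<^sup>+ v. sup_conv lam (stoch_approx N p) (stoch_approx M q) v \<partial>lebesgue) = weighted_sup_integral I S (case_sum p q)"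
    for p q :: "nat \<Rightarrow> (real ^ 'n) \<times> real"
    by (simp add: sup_conv_stoch_approx[OF assms(7,8)] nn_integral_completion weighted_sup_integral_def I_def S_def)
  have event: "{\<omega> \<in> space P. (\<integral>\<^sup>+ v. sup_conv lam (stoch_approx N (\<lambda>i. X i \<omega>)) (stoch_approx M (\<lambda>j. Y j \<omega>)) v \<partial>lebesgue) > ennreal \<alpha>}
      = space P - {\<omega> \<in> space P. (\<lambda>k\<in>I. case_sum X Y k \<omega>) \<in> C}" for X Y :: "nat \<Rightarrow> 'w \<Rightarrow> (real ^ 'n) \<times> real"
  proof -
    have "(\<lambda>k. case_sum X Y k \<omega>) = case_sum (\<lambda>i. X i \<omega>) (\<lambda>j. Y j \<omega>)" for \<omega>
      by (auto simp: fun_eq_iff split: sum.split)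
    then have "weighted_sup_integral I S (\<lambda>k\<in>I. case_sum X Y k \<omega>) = weighted_sup_integral I S (case_sum (\<lambda>i. X i \<omega>) (\<lambda>j. Y j \<omega>))" for \<omega>
      using weighted_sup_integral_restrict[of I S "\<lambda>k. case_sum X Y k \<omega>"] by simp
    then show ?thesis unfolding conv by (auto simp: C_def space_PiM not_le)
  qed
  have lawF: "emeasure P (case_sum F G k -` B \<inter> space P) = vol (A k \<inter> B) / c k" if "k \<in> I" "B \<in> sets borel" for k B
    using that uniformly_distributed_under_graph[OF assms(1) assms(12)] uniformly_distributed_under_graph[OF assms(4) assms(13)]
    by (auto simp: I_def A_def c_def)
  have lawF': "emeasure P (case_sum F' G' k -` B \<inter> space P) = vol (D k \<inter> B) / c k" if "k \<in> I" "B \<in> sets borel" for k B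
    using that uniformly_distributed_under_rearrangement[OF assms(1,2) assms(14)] uniformly_distributed_under_rearrangement[OF assms(4,5) assms(15)]
    by (auto simp: I_def D_def c_def)
  have sF: "{\<omega> \<in> space P. (\<lambda>k\<in>I. case_sum F G k \<omega>) \<in> C} \<in> events"
    and pF: "emeasure P {\<omega> \<in> space P. (\<lambda>k\<in>I. case_sum F G k \<omega>) \<in> C}
      = (\<Prod>k\<in>I. inverse (c k)) * emeasure (lborels I) (C \<inter> PiE I A)"
    by (rule emeasure_independent_relative_lborel[OF assms(11) I Am(1) ind(1) lawF C]; assumption)+
  have sF': "{\<omega> \<in> space P. (\<lambda>k\<in>I. case_sum F' G' k \<omega>) \<in> C} \<in> events"
    and pF': "emeasure P {\<omega> \<in> space P. (\<lambda>k\<in>I. case_sum F' G' k \<omega>) \<in> C}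
      = (\<Prod>k\<in>I. inverse (c k)) * emeasure (lborels I) (C \<inter> PiE I D)"
    by (rule emeasure_independent_relative_lborel[OF assms(11) I Am(2) ind(2) lawF' C]; assumption)+
  have "emeasure P {\<omega> \<in> space P. (\<lambda>k\<in>I. case_sum F G k \<omega>) \<in> C} \<le> emeasure P {\<omega> \<in> space P. (\<lambda>k\<in>I. case_sum F' G' k \<omega>) \<in> C}"
    unfolding pF pF' by (intro mult_left_mono rearr) auto
  then have "prob {\<omega> \<in> space P. (\<lambda>k\<in>I. case_sum F G k \<omega>) \<in> C} \<le> prob {\<omega> \<in> space P. (\<lambda>k\<in>I. case_sum F' G' k \<omega>) \<in> C}"
    by (simp add: emeasure_eq_measure)
  then show ?thesis unfolding event by (simp add: prob_compl sF sF')
qed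

end
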